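(* Let $k \ge 3$ be fixed. For all sufficiently large $n$ with $n \equiv 1 \pmod{2k}$ there is a regular $n$-vertex tournament $T$ such that $\nu_k(T)=\nu^*_k(T)=\frac{n(n-1)}{2k}$ and $\tau_k(T) = \frac{n^2}{4}-o(n^2)$ (where $o(n^2)/n^2\to 0$ as $n\to\infty$).
   Context: A tournament is an orientation of a complete graph; it is regular if all vertices have the same out-degree. $\overrightarrow{C_k}$ is the directed cycle on $k$ vertices. For a directed graph $D$ (unweighted, i.e. all arc weights 1): $\nu_k(D)$ is the maximum number of pairwise arc-disjoint copies of $\overrightarrow{C_k}$ in $D$; $\tau_k(D)$ is the minimum number of arcs whose removal leaves no copy of $\overrightarrow{C_k}$; a fractional $\overrightarrow{C_k}$-packing is a function $m$ from the set of copies of $\overrightarrow{C_k}$ in $D$ to $[0,\infty)$ such that for every arc $e$ the sum of $m(X)$ over copies $X$ containing $e$ is at most $1$, and $\nu_k^*(D)$ is the maximum of $\sum_X m(X)$ over fractional packings. *)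

theory Defs
  imports
    "Graph_Theory.Pair_Digraph"
    "Graph_Theory.Digraph_Component"
    "Graph_Theory.Digraph_Isomorphism"
    "HOL-Library.Landau_Symbols"
    "HOL-Number_Theory.Cong"
begin

locale tournament = pair_digraph G for G :: "'a pair_pre_digraph" +
  assumes exactly_one_arc:
    "\<lbrakk>u \<in> pverts G; v \<in> pverts G; u \<noteq> v\<rbrakk> \<Longrightarrow> ((u, v) \<in> parcs G) \<noteq> ((v, u) \<in> parcs G)"

definition regular_tournament :: "'a pair_pre_digraph \<Rightarrow> bool" where
  "regular_tournament T \<longleftrightarrow>
     tournament T \<and> (\<exists>d. \<forall>v \<in> pverts T. out_degree (with_proj T) v = d)"

definition directed_cycle :: "nat \<Rightarrow> nat pair_pre_digraph" where
  "directed_cycle k = \<lparr>pverts = {..<k}, parcs = (\<lambda>i. (i, Suc i mod k)) ` {..<k}\<rparr>"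

text \<open>Copies are subgraphs, not labelled embeddings: rotations of a cycle count once.\<close>

definition cycle_copies :: "nat \<Rightarrow> 'a pair_pre_digraph \<Rightarrow> 'a pair_pre_digraph set" where
  "cycle_copies k D =
     {X. subgraph (with_proj X) (with_proj D) \<and>
         digraph_iso (with_proj (directed_cycle k)) (with_proj X)}"

definition arc_disjoint :: "'a pair_pre_digraph \<Rightarrow> 'a pair_pre_digraph \<Rightarrow> bool" where
  "arc_disjoint X Y \<longleftrightarrow> parcs X \<inter> parcs Y = {}"

definition nu :: "nat \<Rightarrow> 'a pair_pre_digraph \<Rightarrow> nat" where
  "nu k D = Max {card P | P. P \<subseteq> cycle_copies k D \<and> pairwise arc_disjoint P}"

definition tau :: "nat \<Rightarrow> 'a pair_pre_digraph \<Rightarrow> nat" where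
  "tau k D =
     Min {card F | F. F \<subseteq> parcs D \<and> cycle_copies k (D\<lparr>parcs := parcs D - F\<rparr>) = {}}"

definition fractional_packing ::
    "nat \<Rightarrow> 'a pair_pre_digraph \<Rightarrow> ('a pair_pre_digraph \<Rightarrow> real) \<Rightarrow> bool" where
  "fractional_packing k D m \<longleftrightarrow>
     (\<forall>X \<in> cycle_copies k D. 0 \<le> m X) \<and>
     (\<forall>e \<in> parcs D. (\<Sum>X \<in> {X \<in> cycle_copies k D. e \<in> parcs X}. m X) \<le> 1)"

text \<open>The set of values is infinite, so \<^const>\<open>Max\<close> does not apply;
  \<^const>\<open>Greatest\<close> denotes its maximum.\<close>

definition nu_frac :: "nat \<Rightarrow> 'a pair_pre_digraph \<Rightarrow> real" where
  "nu_frac k D =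
     (GREATEST s. \<exists>m. fractional_packing k D m \<and> s = (\<Sum>X \<in> cycle_copies k D. m X))"

end

theory Submission
  imports Defs "HOL-Analysis.Convex"
begin

text \<open>
  Decompose \<open>K\<^sub>n\<close> into \<open>k\<close>-cycles and orient each cycle at random in one of its two directions. Every
  such orientation is a regular tournament whose arcs are partitioned into copies of the directed
  cycle, which settles the packing numbers. With positive probability the arcs from \<open>A\<close> to \<open>B\<close>
  number at most \<open>|A||B|/2 + o(n\<^sup>2)\<close> for all vertex sets \<open>A, B\<close>.

  Let \<open>H\<close> be a subgraph of such a tournament with at least \<open>(1/4 + \<epsilon>) n\<^sup>2\<close> arcs. By weak regularity
  \<open>H\<close> is close in cut norm to a block kernel \<open>W\<close>, whose values are essentially at most \<open>1/2\<close>; hence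
  more than half of all ordered pairs have non-negligible weight in \<open>W\<close>. A digraph with more
  than \<open>n\<^sup>2/2\<close> arcs has two-way arcs, even inside a subset of large minimum degree where each
  two-way arc lies on many directed triangles, and therefore a positive proportion of all
  \<open>k\<close>-tuples are closed walks. The cut norm transfers this to \<open>H\<close>, so \<open>H\<close> contains a \<open>k\<close>-cycle:
  a set of arcs meeting all \<open>k\<close>-cycles has at least \<open>n\<^sup>2/4 - o(n\<^sup>2)\<close> elements.

  The decomposition of \<open>K\<^sub>n\<close> for \<open>n = 2kp + 1\<close> is cyclic for even \<open>k\<close>. For odd \<open>k\<close> it is assembled from
  decompositions of \<open>K\<^bsub>2k+1\<^esub>\<close> along a commutative quasigroup with holes of size two.
\<close>

section \<open>Weak regularity\<close>

text \<open>A tournament has no two-way arcs, so closed walks that run back and forth along one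
  cannot be sought in \<open>H\<close>. They exist in the support of the block kernel, where a
  two-way arc joins two blocks; the bound 1/2 on the kernel turns density 1/4 of \<open>H\<close>
  into density 1/2 of the support, beyond which two-way arcs are forced. The \<open>k\<close>-tuples
  with a repetition number O(n^(k-1)), so a single closed walk is of no help: order n^k of them are
  needed, and subsets of large minimum degree have to take the place of single arcs. Reversing whole
  cycles instead of single arcs keeps every vertex balanced and the copies arc-disjoint. About
  n^2/(2k) independent signs remain, enough for a union bound over the 4^n pairs of vertex sets. The
  upper bound on \<open>tau\<close> is elementary: the arcs ascending and those descending in a
  linear order of the vertices are both sets whose removal destroys all cycles. The tournament found
  depends on the error allowed, so the final error function is read off from a tournament with the
  largest \<open>tau\<close> among all those with the required packing numbers.\<close>

definition block_avg :: "'a set \<Rightarrow> ('a \<Rightarrow> nat) \<Rightarrow> ('a \<Rightarrow> real) \<Rightarrow> 'a \<Rightarrow> real" where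
  "block_avg V \<phi> f x = (\<Sum>x' | x' \<in> V \<and> \<phi> x = \<phi> x'. f x') / card {x' \<in> V. \<phi> x = \<phi> x'}"

text \<open>The conditional expectation of \<open>h\<close> on the product partition, written as an
  iterated average so that the one-variable facts apply to each coordinate in turn.\<close>

definition block_avg2 :: "'a set \<Rightarrow> ('a \<Rightarrow> nat) \<Rightarrow> ('a \<Rightarrow> 'a \<Rightarrow> real) \<Rightarrow> 'a \<Rightarrow> 'a \<Rightarrow> real" where
  "block_avg2 V \<phi> h x y = block_avg V \<phi> (\<lambda>x'. block_avg V \<phi> (h x') y) x"

lemma block_avg_nonneg:
  assumes "\<And>x. x \<in> V \<Longrightarrow> 0 \<le> f x"
  shows "0 \<le> block_avg V \<phi> f x"
  unfolding block_avg_def using assms by (intro divide_nonneg_nonneg sum_nonneg) auto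

lemma block_avg_le:
  assumes "finite V" "\<And>x. x \<in> V \<Longrightarrow> f x \<le> c" "0 \<le> c"
  shows "block_avg V \<phi> f x \<le> c"
proof -
  have "(\<Sum>x' | x' \<in> V \<and> \<phi> x = \<phi> x'. f x') \<le> card {x' \<in> V. \<phi> x = \<phi> x'} * c"
    using assms(2) by (intro sum_bounded_above) auto
  then show ?thesis
    using \<open>0 \<le> c\<close> by (cases "card {x' \<in> V. \<phi> x = \<phi> x'} = 0")
      (simp_all add: block_avg_def divide_le_eq mult.commute del: card_eq_0_iff)
qed

text \<open>Averaging is the orthogonal projection onto the functions constant on blocks: both sides
  sum over pairs in a common block, and neither \<open>g\<close> nor the block size changes when the
  two members are exchanged.\<close>

lemma sum_block_avg:
  assumes fin: "finite V" and g: "\<And>x x'. x \<in> V \<Longrightarrow> x' \<in> V \<Longrightarrow> \<phi> x = \<phi> x' \<Longrightarrow> g x = g x'"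
  shows "(\<Sum>x\<in>V. block_avg V \<phi> f x * g x) = (\<Sum>x\<in>V. f x * g x)"
proof -
  let ?c = "\<lambda>x. real (card {x' \<in> V. \<phi> x = \<phi> x'})"
  have "(\<Sum>x\<in>V. block_avg V \<phi> f x * g x) = (\<Sum>x\<in>V. \<Sum>x' | x' \<in> V \<and> \<phi> x = \<phi> x'. f x' * g x / ?c x)"
    by (simp add: block_avg_def sum_distrib_right sum_divide_distrib)
  also have "\<dots> = (\<Sum>x'\<in>V. \<Sum>x | x \<in> V \<and> \<phi> x = \<phi> x'. f x' * g x / ?c x)"
    using sum.swap_restrict[OF fin fin, of "\<lambda>x x'. f x' * g x / ?c x" "\<lambda>x x'. \<phi> x = \<phi> x'"] by simp
  also have "\<dots> = (\<Sum>x'\<in>V. \<Sum>x | x \<in> V \<and> \<phi> x = \<phi> x'. f x' * g x' / ?c x')"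
  proof (intro sum.cong refl)
    fix y x assume "y \<in> V" and "x \<in> {x \<in> V. \<phi> x = \<phi> y}"
    then have "g x = g y" "\<phi> x = \<phi> y" using g[of x y] by auto
    then show "f y * g x / ?c x = f y * g y / ?c y" by simp
  qed
  also have "\<dots> = (\<Sum>x'\<in>V. f x' * g x')"
  proof (rule sum.cong[OF refl])
    fix y assume y: "y \<in> V"
    have "{x \<in> V. \<phi> x = \<phi> y} = {x \<in> V. \<phi> y = \<phi> x}" by auto
    moreover have "card {x \<in> V. \<phi> y = \<phi> x} > 0" using fin y by (auto simp: card_gt_0_iff)
    ultimately show "(\<Sum>x | x \<in> V \<and> \<phi> x = \<phi> y. f y * g y / ?c y) = f y * g y"
      by (simp only: sum_constant) simp
  qed
  finally show ?thesis .
qed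

lemma sum_block_avg2:
  assumes fin: "finite V"
    and g: "\<And>x x' y y'. x \<in> V \<Longrightarrow> x' \<in> V \<Longrightarrow> y \<in> V \<Longrightarrow> y' \<in> V \<Longrightarrow> \<phi> x = \<phi> x' \<Longrightarrow> \<phi> y = \<phi> y'
      \<Longrightarrow> g x y = g x' y'"
  shows "(\<Sum>x\<in>V. \<Sum>y\<in>V. block_avg2 V \<phi> h x y * g x y) = (\<Sum>x\<in>V. \<Sum>y\<in>V. h x y * g x y)"
proof -
  have "(\<Sum>x\<in>V. \<Sum>y\<in>V. block_avg2 V \<phi> h x y * g x y)
      = (\<Sum>y\<in>V. \<Sum>x\<in>V. block_avg V \<phi> (\<lambda>x'. block_avg V \<phi> (h x') y) x * g x y)"
    unfolding block_avg2_def by (rule sum.swap)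
  also have "\<dots> = (\<Sum>y\<in>V. \<Sum>x\<in>V. block_avg V \<phi> (h x) y * g x y)"
    by (rule sum.cong[OF refl], rule sum_block_avg[OF fin]) (auto intro: g)
  also have "\<dots> = (\<Sum>x\<in>V. \<Sum>y\<in>V. block_avg V \<phi> (h x) y * g x y)"
    by (rule sum.swap)
  also have "\<dots> = (\<Sum>x\<in>V. \<Sum>y\<in>V. h x y * g x y)"
    by (rule sum.cong[OF refl], rule sum_block_avg[OF fin]) (auto intro: g)
  finally show ?thesis .
qed

lemma block_avg2_cong:
  "\<phi> x = \<phi> x' \<Longrightarrow> \<phi> y = \<phi> y' \<Longrightarrow> block_avg2 V \<phi> h x y = block_avg2 V \<phi> h x' y'"
  by (simp add: block_avg2_def block_avg_def)

lemma block_avg2_bounds: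
  assumes "finite V" "\<And>x y. x \<in> V \<Longrightarrow> y \<in> V \<Longrightarrow> 0 \<le> h x y \<and> h x y \<le> 1"
  shows "0 \<le> block_avg2 V \<phi> h x y" "block_avg2 V \<phi> h x y \<le> 1"
  unfolding block_avg2_def using assms
  by (auto intro!: block_avg_nonneg block_avg_le)

lemma double_sum_Cauchy_Schwarz:
  fixes f g :: "'a \<Rightarrow> 'b \<Rightarrow> real"
  shows "(\<Sum>x\<in>A. \<Sum>y\<in>B. f x y * g x y)\<^sup>2
    \<le> (\<Sum>x\<in>A. \<Sum>y\<in>B. (f x y)\<^sup>2) * (\<Sum>x\<in>A. \<Sum>y\<in>B. (g x y)\<^sup>2)"
  using Cauchy_Schwarz_ineq_sum[of "\<lambda>p. f (fst p) (snd p)" "\<lambda>p. g (fst p) (snd p)" "A \<times> B"]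
  by (simp add: sum.cartesian_product split_def)

text \<open>Pythagoras for nested projections: the coarse average is constant on the blocks of
  \<open>\<psi>\<close>, so the energies differ by the squared norm of the difference of the two
  averages. The indicator of \<open>A \<times> B\<close> is constant on these blocks too, so the cut
  discrepancy is its inner product with that difference, and Cauchy-Schwarz applies.\<close>

lemma energy_increment:
  fixes \<eta> :: real
  assumes fin: "finite V" and A: "A \<subseteq> V" and B: "B \<subseteq> V"
    and ref: "\<And>x y. x \<in> V \<Longrightarrow> y \<in> V \<Longrightarrow> \<psi> x = \<psi> y
      \<Longrightarrow> \<phi> x = \<phi> y \<and> (x \<in> A \<longleftrightarrow> y \<in> A) \<and> (x \<in> B \<longleftrightarrow> y \<in> B)"
    and big: "\<bar>\<Sum>x\<in>A. \<Sum>y\<in>B. h x y - block_avg2 V \<phi> h x y\<bar> > \<eta> * (card V)\<^sup>2" and \<eta>: "0 < \<eta>"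
  shows "(\<Sum>x\<in>V. \<Sum>y\<in>V. (block_avg2 V \<psi> h x y)\<^sup>2)
    \<ge> (\<Sum>x\<in>V. \<Sum>y\<in>V. (block_avg2 V \<phi> h x y)\<^sup>2) + \<eta>\<^sup>2 * (card V)\<^sup>2"
proof -
  let ?P = "block_avg2 V \<psi> h" and ?W = "block_avg2 V \<phi> h"
  let ?S = "\<lambda>f. \<Sum>x\<in>V. \<Sum>y\<in>V. f x y :: real"
  let ?g = "\<lambda>x y. of_bool (x \<in> A) * of_bool (y \<in> B) :: real"
  let ?n = "real (card V)"
  have W\<psi>: "?W x y = ?W x' y'"
    if "x \<in> V" "x' \<in> V" "y \<in> V" "y' \<in> V" "\<psi> x = \<psi> x'" "\<psi> y = \<psi> y'" for x x' y y'
    using ref[of x x'] ref[of y y'] that by (intro block_avg2_cong) simp_all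
  have 1: "?S (\<lambda>x y. ?P x y * ?W x y) = ?S (\<lambda>x y. h x y * ?W x y)"
    using W\<psi> by (intro sum_block_avg2[OF fin]) blast
  have 2: "?S (\<lambda>x y. ?W x y * ?W x y) = ?S (\<lambda>x y. h x y * ?W x y)"
    by (rule sum_block_avg2[OF fin]) (rule block_avg2_cong)
  have 3: "?S (\<lambda>x y. ?P x y * ?g x y) = ?S (\<lambda>x y. h x y * ?g x y)"
  proof (rule sum_block_avg2[OF fin])
    fix x x' y y' assume "x \<in> V" "x' \<in> V" "y \<in> V" "y' \<in> V" "\<psi> x = \<psi> x'" "\<psi> y = \<psi> y'"
    then have "(x \<in> A) = (x' \<in> A)" "(y \<in> B) = (y' \<in> B)" using ref by blast+
    then show "?g x y = ?g x' y'" by simp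
  qed
  have "?S (\<lambda>x y. (?P x y - ?W x y)\<^sup>2)
      = ?S (\<lambda>x y. (?P x y)\<^sup>2) - 2 * ?S (\<lambda>x y. ?P x y * ?W x y) + ?S (\<lambda>x y. ?W x y * ?W x y)"
    by (simp add: power2_diff sum.distrib sum_subtractf sum_distrib_left power2_eq_square algebra_simps)
  then have 4: "?S (\<lambda>x y. (?P x y - ?W x y)\<^sup>2) = ?S (\<lambda>x y. (?P x y)\<^sup>2) - ?S (\<lambda>x y. (?W x y)\<^sup>2)"
    using 1 2 by (simp add: power2_eq_square)
  have "(\<Sum>x\<in>A. \<Sum>y\<in>B. h x y - ?W x y) = ?S (\<lambda>x y. (h x y - ?W x y) * ?g x y)"
  proof -
    have "?S (\<lambda>x y. (h x y - ?W x y) * ?g x y)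
      = (\<Sum>x\<in>V. if x \<in> A then \<Sum>y\<in>V. if y \<in> B then h x y - ?W x y else 0 else 0)"
      by (intro sum.cong refl) (auto intro!: sum.cong)
    also have "\<dots> = (\<Sum>x\<in>A. \<Sum>y\<in>B. h x y - ?W x y)"
      using A B fin by (simp add: sum.If_cases Int_absorb1 Int_absorb2)
    finally show ?thesis ..
  qed
  also have "\<dots> = ?S (\<lambda>x y. (?P x y - ?W x y) * ?g x y)"
    using 3 by (simp add: left_diff_distrib sum_subtractf)
  finally have 5: "(\<Sum>x\<in>A. \<Sum>y\<in>B. h x y - ?W x y) = \<dots>" .
  have "(\<eta> * ?n\<^sup>2)\<^sup>2 \<le> (?S (\<lambda>x y. (?P x y - ?W x y) * ?g x y))\<^sup>2"
    using big \<eta> unfolding 5 by (subst abs_le_square_iff[symmetric]) auto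
  also have "\<dots> \<le> ?S (\<lambda>x y. (?P x y - ?W x y)\<^sup>2) * ?S (\<lambda>x y. (?g x y)\<^sup>2)"
    by (rule double_sum_Cauchy_Schwarz)
  also have "\<dots> \<le> ?S (\<lambda>x y. (?P x y - ?W x y)\<^sup>2) * ?n\<^sup>2"
  proof (rule mult_left_mono)
    have "?S (\<lambda>x y. (?g x y)\<^sup>2) \<le> ?S (\<lambda>x y. 1)" by (intro sum_mono) auto
    then show "?S (\<lambda>x y. (?g x y)\<^sup>2) \<le> ?n\<^sup>2" by (simp add: power2_eq_square)
  qed (simp add: sum_nonneg)
  finally have "\<eta>\<^sup>2 * ?n\<^sup>2 * ?n\<^sup>2 \<le> ?S (\<lambda>x y. (?P x y - ?W x y)\<^sup>2) * ?n\<^sup>2"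
    by (simp add: power2_eq_square algebra_simps)
  moreover have "?n > 0"
    using big A fin \<eta> by (cases "V = {}") (auto simp: card_gt_0_iff)
  ultimately have "\<eta>\<^sup>2 * ?n\<^sup>2 \<le> ?S (\<lambda>x y. (?P x y - ?W x y)\<^sup>2)" by simp
  then show ?thesis using 4 by simp
qed

text \<open>The energy lies between 0 and n^2, while each violated cut raises it by
  \<open>\<eta>\<close>^2 n^2 at the price of four times as many labels. Hence at most
  1/\<open>\<eta>\<close>^2 refinements are possible.\<close>

lemma weak_regularity:
  fixes h :: "'a \<Rightarrow> 'a \<Rightarrow> real" and \<eta> :: real
  assumes fin: "finite V" and h: "\<And>x y. x \<in> V \<Longrightarrow> y \<in> V \<Longrightarrow> 0 \<le> h x y \<and> h x y \<le> 1"
    and \<eta>: "0 < \<eta>"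
  shows "\<exists>\<phi>. (\<forall>x\<in>V. \<phi> x < 4 ^ nat \<lceil>1 / \<eta>\<^sup>2\<rceil>) \<and>
    (\<forall>A B. A \<subseteq> V \<longrightarrow> B \<subseteq> V \<longrightarrow>
      \<bar>\<Sum>x\<in>A. \<Sum>y\<in>B. h x y - block_avg2 V \<phi> h x y\<bar> \<le> \<eta> * (card V)\<^sup>2)"
proof (rule ccontr)
  let ?n = "real (card V)" and ?m = "nat \<lceil>1 / \<eta>\<^sup>2\<rceil>"
  let ?E = "\<lambda>\<phi>. \<Sum>x\<in>V. \<Sum>y\<in>V. (block_avg2 V \<phi> h x y)\<^sup>2"
  assume neg: "\<not> ?thesis"
  have "\<exists>\<phi>. (\<forall>x\<in>V. \<phi> x < 4 ^ j) \<and> ?E \<phi> \<ge> j * (\<eta>\<^sup>2 * ?n\<^sup>2)" if "j \<le> Suc ?m" for j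
    using that
  proof (induction j)
    case 0
    show ?case by (rule exI[of _ "\<lambda>_. 0"]) (simp add: sum_nonneg)
  next
    case (Suc j)
    then obtain \<phi> where \<phi>: "\<forall>x\<in>V. \<phi> x < 4 ^ j" "?E \<phi> \<ge> j * (\<eta>\<^sup>2 * ?n\<^sup>2)" by auto
    have "(4::nat) ^ j \<le> 4 ^ ?m" using Suc.prems by (intro power_increasing) auto
    then have "\<forall>x\<in>V. \<phi> x < 4 ^ ?m" using \<phi>(1) by (meson less_le_trans)
    then obtain A B where AB: "A \<subseteq> V" "B \<subseteq> V"
      "\<bar>\<Sum>x\<in>A. \<Sum>y\<in>B. h x y - block_avg2 V \<phi> h x y\<bar> > \<eta> * (card V)\<^sup>2"
      using neg by (meson not_le)
    \<comment> \<open>A new base-4 digit records membership in \<open>A\<close> and in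
      \<open>B\<close>, so equal labels give the common refinement.\<close>
    define \<psi> where "\<psi> x = 4 * \<phi> x + 2 * of_bool (x \<in> A) + of_bool (x \<in> B)" for x
    have ref: "\<phi> x = \<phi> y \<and> (x \<in> A \<longleftrightarrow> y \<in> A) \<and> (x \<in> B \<longleftrightarrow> y \<in> B)" if "\<psi> x = \<psi> y" for x y
      using that unfolding \<psi>_def
      by (cases "x \<in> A"; cases "y \<in> A"; cases "x \<in> B"; cases "y \<in> B"; simp; presburger)
    have "?E \<psi> \<ge> ?E \<phi> + \<eta>\<^sup>2 * ?n\<^sup>2"
      using energy_increment[OF fin AB(1,2) ref AB(3) \<eta>] by simp
    then have "?E \<psi> \<ge> Suc j * (\<eta>\<^sup>2 * ?n\<^sup>2)" using \<phi>(2) by (simp add: algebra_simps)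
    moreover have "\<psi> x < 4 ^ Suc j" if "x \<in> V" for x
    proof -
      have "\<phi> x < 4 ^ j" using \<phi> that by blast
      then show ?thesis unfolding \<psi>_def by (cases "x \<in> A"; cases "x \<in> B") auto
    qed
    ultimately show ?case by blast
  qed
  from this[of "Suc ?m"] obtain \<phi> where \<phi>: "?E \<phi> \<ge> Suc ?m * (\<eta>\<^sup>2 * ?n\<^sup>2)" by auto
  have "(block_avg2 V \<phi> h x y)\<^sup>2 \<le> 1" for x y
    using block_avg2_bounds[of V h \<phi> x y] fin h by (auto simp: power_le_one)
  then have "?E \<phi> \<le> (\<Sum>x\<in>V. \<Sum>y\<in>V. 1)" by (intro sum_mono)
  then have "Suc ?m * \<eta>\<^sup>2 * ?n\<^sup>2 \<le> 1 * ?n\<^sup>2" using \<phi> by (simp add: power2_eq_square algebra_simps)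
  moreover have "?n > 0" using neg fin by (cases "V = {}") (auto simp: card_gt_0_iff)
  ultimately have "Suc ?m * \<eta>\<^sup>2 \<le> 1" by simp
  moreover have "1 / \<eta>\<^sup>2 < Suc ?m" by linarith
  ultimately show False using \<eta> by (simp add: divide_simps split: if_splits)
qed

section \<open>Counting closed walks\<close>

primrec kernel_pow :: "'a set \<Rightarrow> ('a \<Rightarrow> 'a \<Rightarrow> real) \<Rightarrow> nat \<Rightarrow> 'a \<Rightarrow> 'a \<Rightarrow> real" where
  "kernel_pow V A 0 = (\<lambda>x y. of_bool (x = y))"
| "kernel_pow V A (Suc j) = (\<lambda>x y. \<Sum>z\<in>V. A x z * kernel_pow V A j z y)"

lemma sum_of_bool_eq_mult:
  fixes f :: "'a \<Rightarrow> real"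
  assumes "finite V" "w \<in> V"
  shows "(\<Sum>x\<in>V. of_bool (w = x) * f x) = f w"
proof -
  have "(\<Sum>x\<in>V. of_bool (w = x) * f x) = (\<Sum>x\<in>V. if w = x then f x else 0)"
    by (intro sum.cong) auto
  then show ?thesis using assms by simp
qed

lemma kernel_pow_1: "finite V \<Longrightarrow> y \<in> V \<Longrightarrow> kernel_pow V A (Suc 0) x y = A x y"
  by (simp add: if_distrib cong: if_cong)

lemma kernel_pow_Suc_right:
  assumes "finite V" "x \<in> V" "y \<in> V"
  shows "kernel_pow V A (Suc j) x y = (\<Sum>z\<in>V. kernel_pow V A j x z * A z y)"
  using assms(2)
proof (induction j arbitrary: x)
  case 0
  then show ?case using assms by (simp add: if_distrib if_distribR cong: if_cong)
next
  case (Suc j)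
  have "kernel_pow V A (Suc (Suc j)) x y = (\<Sum>w\<in>V. \<Sum>z\<in>V. A x w * (kernel_pow V A j w z * A z y))"
    using Suc.IH by (subst kernel_pow.simps) (simp add: sum_distrib_left del: kernel_pow.simps)
  also have "\<dots> = (\<Sum>z\<in>V. \<Sum>w\<in>V. A x w * (kernel_pow V A j w z * A z y))"
    by (rule sum.swap)
  also have "\<dots> = (\<Sum>z\<in>V. kernel_pow V A (Suc j) x z * A z y)"
    by (simp add: sum_distrib_left sum_distrib_right mult_ac)
  finally show ?case .
qed

lemma kernel_pow_nonneg:
  assumes "\<And>x y. x \<in> V \<Longrightarrow> y \<in> V \<Longrightarrow> 0 \<le> A x y" "x \<in> V" "y \<in> V"
  shows "0 \<le> kernel_pow V A j x y"
  using assms(2) by (induction j arbitrary: x) (auto intro!: sum_nonneg mult_nonneg_nonneg assms)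

lemma kernel_pow_le:
  assumes fin: "finite V" and A: "\<And>x y. x \<in> V \<Longrightarrow> y \<in> V \<Longrightarrow> 0 \<le> A x y \<and> A x y \<le> 1"
    and "x \<in> V" "y \<in> V"
  shows "kernel_pow V A (Suc j) x y \<le> real (card V) ^ j"
  using \<open>x \<in> V\<close>
proof (induction j arbitrary: x)
  case 0
  then show ?case using assms by (simp add: kernel_pow_1 del: kernel_pow.simps)
next
  case (Suc j)
  have "kernel_pow V A (Suc (Suc j)) x y = (\<Sum>z\<in>V. A x z * kernel_pow V A (Suc j) z y)" by simp
  also have "\<dots> \<le> card V * (1 * real (card V) ^ j)"
  proof (rule sum_bounded_above)
    fix z assume z: "z \<in> V"
    show "A x z * kernel_pow V A (Suc j) z y \<le> 1 * real (card V) ^ j"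
      using A z Suc \<open>y \<in> V\<close> by (intro mult_mono) (auto intro!: kernel_pow_nonneg simp del: kernel_pow.simps)
  qed
  finally show ?case by simp
qed

lemma kernel_pow_mono:
  assumes "0 \<le> c" "\<And>x y. x \<in> V \<Longrightarrow> y \<in> V \<Longrightarrow> 0 \<le> A x y \<and> c * A x y \<le> B x y" "x \<in> V" "y \<in> V"
  shows "c ^ j * kernel_pow V A j x y \<le> kernel_pow V B j x y"
  using \<open>x \<in> V\<close>
proof (induction j arbitrary: x)
  case (Suc j)
  have "c ^ Suc j * kernel_pow V A (Suc j) x y
      = (\<Sum>z\<in>V. (c * A x z) * (c ^ j * kernel_pow V A j z y))"
    by (simp add: sum_distrib_left mult_ac)
  also have "\<dots> \<le> (\<Sum>z\<in>V. B x z * kernel_pow V B j z y)"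
  proof (rule sum_mono)
    fix z assume z: "z \<in> V"
    have "0 \<le> c * A x z" using assms Suc.prems z by auto
    then have "0 \<le> B x z" using assms(2)[of x z] Suc.prems z by linarith
    then show "(c * A x z) * (c ^ j * kernel_pow V A j z y) \<le> B x z * kernel_pow V B j z y"
      using assms Suc z by (intro mult_mono) (auto intro!: kernel_pow_nonneg mult_nonneg_nonneg)
  qed
  finally show ?case by simp
qed simp

text \<open>A bilinear form on a box is largest at a corner: \<open>u\<close> is replaced by
  \<open>\<alpha>\<close> times the indicator of the set where its coefficient is positive, then
  \<open>v\<close> likewise.\<close>

lemma cut_bound_functions:
  fixes D :: "'a \<Rightarrow> 'a \<Rightarrow> real" and \<theta> :: real
  assumes fin: "finite V"
    and D: "\<And>A B. A \<subseteq> V \<Longrightarrow> B \<subseteq> V \<Longrightarrow> (\<Sum>x\<in>A. \<Sum>y\<in>B. D x y) \<le> \<theta>"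
    and u: "\<And>x. x \<in> V \<Longrightarrow> 0 \<le> u x \<and> u x \<le> \<alpha>" and v: "\<And>x. x \<in> V \<Longrightarrow> 0 \<le> v x \<and> v x \<le> \<beta>"
    and \<alpha>: "0 \<le> \<alpha>" and \<beta>: "0 \<le> \<beta>"
  shows "(\<Sum>x\<in>V. \<Sum>y\<in>V. D x y * u x * v y) \<le> \<alpha> * \<beta> * \<theta>"
proof -
  have max: "(\<Sum>x\<in>V. w x * d x) \<le> \<gamma> * (\<Sum>x | x \<in> V \<and> d x > 0. d x)"
    if w: "\<And>x. x \<in> V \<Longrightarrow> 0 \<le> w x \<and> w x \<le> \<gamma>" for w d :: "'a \<Rightarrow> real" and \<gamma>
  proof -
    have "(\<Sum>x\<in>V. w x * d x) \<le> (\<Sum>x\<in>V. if d x > 0 then \<gamma> * d x else 0)"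
      using w by (intro sum_mono) (auto intro!: mult_right_mono simp: mult_nonneg_nonpos not_less)
    also have "\<dots> = (\<Sum>x | x \<in> V \<and> d x > 0. \<gamma> * d x)"
      using fin by (simp add: sum.If_cases Int_def)
    finally show ?thesis by (simp add: sum_distrib_left)
  qed
  define A where "A = {x \<in> V. (\<Sum>y\<in>V. D x y * v y) > 0}"
  define B where "B = {y \<in> V. (\<Sum>x\<in>A. D x y) > 0}"
  have "(\<Sum>x\<in>V. \<Sum>y\<in>V. D x y * u x * v y) = (\<Sum>x\<in>V. u x * (\<Sum>y\<in>V. D x y * v y))"
    by (simp add: sum_distrib_left mult_ac)
  also have "\<dots> \<le> \<alpha> * (\<Sum>x\<in>A. \<Sum>y\<in>V. D x y * v y)"
    unfolding A_def using u by (rule max)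
  also have "(\<Sum>x\<in>A. \<Sum>y\<in>V. D x y * v y) = (\<Sum>y\<in>V. v y * (\<Sum>x\<in>A. D x y))"
    by (subst sum.swap) (simp add: sum_distrib_left mult_ac)
  also have "\<alpha> * \<dots> \<le> \<alpha> * (\<beta> * (\<Sum>y\<in>B. \<Sum>x\<in>A. D x y))"
    unfolding B_def using max[OF v] \<alpha> by (intro mult_left_mono) auto
  also have "(\<Sum>y\<in>B. \<Sum>x\<in>A. D x y) = (\<Sum>x\<in>A. \<Sum>y\<in>B. D x y)" by (rule sum.swap)
  also have "\<alpha> * (\<beta> * \<dots>) \<le> \<alpha> * (\<beta> * \<theta>)"
    using \<alpha> \<beta> by (intro mult_left_mono D) (auto simp: A_def B_def)
  finally show ?thesis by (simp add: mult.assoc)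
qed

text \<open>For each fixed \<open>x\<close> the factors \<open>P x z\<close> and
  \<open>Q w x\<close> are weights in one variable each; the sum over \<open>x\<close> costs the
  factor \<open>card V\<close>.\<close>

lemma cut_bound_product:
  fixes D :: "'a \<Rightarrow> 'a \<Rightarrow> real" and \<theta> :: real
  assumes fin: "finite V"
    and D: "\<And>A B. A \<subseteq> V \<Longrightarrow> B \<subseteq> V \<Longrightarrow> (\<Sum>x\<in>A. \<Sum>y\<in>B. D x y) \<le> \<theta>"
    and P: "\<And>x y. x \<in> V \<Longrightarrow> y \<in> V \<Longrightarrow> 0 \<le> P x y \<and> P x y \<le> \<alpha>"
    and Q: "\<And>x y. x \<in> V \<Longrightarrow> y \<in> V \<Longrightarrow> 0 \<le> Q x y \<and> Q x y \<le> \<beta>"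
    and ab: "0 \<le> \<alpha>" "0 \<le> \<beta>"
  shows "(\<Sum>z\<in>V. \<Sum>w\<in>V. D z w * (\<Sum>x\<in>V. Q w x * P x z)) \<le> card V * (\<alpha> * \<beta> * \<theta>)"
proof -
  have "(\<Sum>z\<in>V. \<Sum>w\<in>V. D z w * (\<Sum>x\<in>V. Q w x * P x z))
      = (\<Sum>z\<in>V. \<Sum>w\<in>V. \<Sum>x\<in>V. D z w * P x z * Q w x)"
    by (simp add: sum_distrib_left mult_ac)
  also have "\<dots> = (\<Sum>z\<in>V. \<Sum>x\<in>V. \<Sum>w\<in>V. D z w * P x z * Q w x)"
    by (intro sum.cong refl sum.swap)
  also have "\<dots> = (\<Sum>x\<in>V. \<Sum>z\<in>V. \<Sum>w\<in>V. D z w * P x z * Q w x)" by (rule sum.swap)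
  also have "\<dots> \<le> card V * (\<alpha> * \<beta> * \<theta>)"
    using P Q by (intro sum_bounded_above cut_bound_functions[OF fin D _ _ ab]) auto
  finally show ?thesis .
qed

text \<open>A telescoping sum over traces of mixed products: \<open>T j\<close> has \<open>j\<close>
  factors \<open>W\<close> and \<open>k - j\<close> factors \<open>h\<close>, and each exchange of
  one factor costs at most \<open>\<eta>\<close> n^k by the cut bound.\<close>

lemma closed_walk_counting:
  fixes h W :: "'a \<Rightarrow> 'a \<Rightarrow> real" and \<eta> :: real
  assumes fin: "finite V" and k: "k \<ge> 3"
    and h: "\<And>x y. x \<in> V \<Longrightarrow> y \<in> V \<Longrightarrow> 0 \<le> h x y \<and> h x y \<le> 1"
    and W: "\<And>x y. x \<in> V \<Longrightarrow> y \<in> V \<Longrightarrow> 0 \<le> W x y \<and> W x y \<le> 1"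
    and cut: "\<And>A B. A \<subseteq> V \<Longrightarrow> B \<subseteq> V \<Longrightarrow> (\<Sum>x\<in>A. \<Sum>y\<in>B. W x y - h x y) \<le> \<eta> * (card V)\<^sup>2"
  shows "(\<Sum>x\<in>V. kernel_pow V W k x x) \<le> (\<Sum>x\<in>V. kernel_pow V h k x x) + k * \<eta> * card V ^ k"
proof -
  let ?n = "real (card V)"
  let ?p = "kernel_pow V"
  define T where "T j = (\<Sum>x\<in>V. \<Sum>y\<in>V. ?p h (k - j) x y * ?p W j y x)" for j
  have step: "T (Suc j) \<le> T j + \<eta> * ?n ^ k" if j: "j < k" for j
  proof -
    define a where "a = k - Suc j"
    have a: "k - j = Suc a" "k - Suc j = a" "k = Suc (a + j)" using j by (auto simp: a_def)
    \<comment> \<open>The weight of the remaining \<open>k - 1\<close> steps, leading from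
      \<open>w\<close> back to \<open>z\<close>; \<open>T j\<close> and \<open>T (Suc j)\<close>
      differ only in the step from \<open>z\<close> to \<open>w\<close>.\<close>
    let ?R = "\<lambda>w z. \<Sum>x\<in>V. ?p W j w x * ?p h a x z"
    have Th: "T j = (\<Sum>z\<in>V. \<Sum>w\<in>V. h z w * ?R w z)"
    proof -
      have "T j = (\<Sum>x\<in>V. \<Sum>w\<in>V. \<Sum>z\<in>V. ?p h a x z * h z w * ?p W j w x)"
        unfolding T_def a
        by (intro sum.cong refl) (simp add: kernel_pow_Suc_right fin sum_distrib_right del: kernel_pow.simps)
      also have "\<dots> = (\<Sum>w\<in>V. \<Sum>x\<in>V. \<Sum>z\<in>V. ?p h a x z * h z w * ?p W j w x)"
        by (rule sum.swap)
      also have "\<dots> = (\<Sum>w\<in>V. \<Sum>z\<in>V. \<Sum>x\<in>V. ?p h a x z * h z w * ?p W j w x)"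
        by (intro sum.cong refl sum.swap)
      also have "\<dots> = (\<Sum>z\<in>V. \<Sum>w\<in>V. \<Sum>x\<in>V. ?p h a x z * h z w * ?p W j w x)"
        by (rule sum.swap)
      finally show ?thesis by (simp add: sum_distrib_left mult_ac)
    qed
    have TW: "T (Suc j) = (\<Sum>z\<in>V. \<Sum>w\<in>V. W z w * ?R w z)"
    proof -
      have "T (Suc j) = (\<Sum>x\<in>V. \<Sum>z\<in>V. \<Sum>w\<in>V. ?p h a x z * (W z w * ?p W j w x))"
        unfolding T_def a by (simp add: sum_distrib_left)
      also have "\<dots> = (\<Sum>z\<in>V. \<Sum>x\<in>V. \<Sum>w\<in>V. ?p h a x z * (W z w * ?p W j w x))"
        by (rule sum.swap)
      also have "\<dots> = (\<Sum>z\<in>V. \<Sum>w\<in>V. \<Sum>x\<in>V. ?p h a x z * (W z w * ?p W j w x))"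
        by (intro sum.cong refl sum.swap)
      finally show ?thesis by (simp add: sum_distrib_left mult_ac)
    qed
    have diff: "T (Suc j) - T j = (\<Sum>z\<in>V. \<Sum>w\<in>V. (W z w - h z w) * ?R w z)"
      unfolding Th TW by (simp add: left_diff_distrib sum_subtractf)
    \<comment> \<open>The cut bound requires the remaining walk to split at some \<open>x\<close>
      into two nontrivial parts, which is possible because \<open>k - 1 \<ge> 2\<close>. If
      \<open>a\<close> or \<open>j\<close> is 0, one of the given factors is the identity kernel,
      and the other power is split after its first step instead.\<close>
    have "\<exists>Q P b c. b + c + 3 = k \<and>
        (\<forall>x\<in>V. \<forall>y\<in>V. 0 \<le> P x y \<and> P x y \<le> ?n ^ b) \<and> (\<forall>x\<in>V. \<forall>y\<in>V. 0 \<le> Q x y \<and> Q x y \<le> ?n ^ c) \<and>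
        (\<forall>w\<in>V. \<forall>z\<in>V. ?R w z = (\<Sum>x\<in>V. Q w x * P x z))" (is ?ex)
    proof -
      have pb: "0 \<le> ?p A (Suc i) x y \<and> ?p A (Suc i) x y \<le> ?n ^ i"
        if "\<And>x y. x \<in> V \<Longrightarrow> y \<in> V \<Longrightarrow> 0 \<le> A x y \<and> A x y \<le> 1" "x \<in> V" "y \<in> V" for A i x y
        by (rule conjI[OF kernel_pow_nonneg kernel_pow_le[OF fin]]) (use that in blast)+
      have ex: ?ex if "b + c + 3 = k" "\<And>x y. x \<in> V \<Longrightarrow> y \<in> V \<Longrightarrow> 0 \<le> P x y \<and> P x y \<le> ?n ^ b"
        "\<And>x y. x \<in> V \<Longrightarrow> y \<in> V \<Longrightarrow> 0 \<le> Q x y \<and> Q x y \<le> ?n ^ c"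
        "\<And>w z. w \<in> V \<Longrightarrow> z \<in> V \<Longrightarrow> ?R w z = (\<Sum>x\<in>V. Q w x * P x z)" for Q P b c
        by (rule exI[of _ Q], rule exI[of _ P], rule exI[of _ b], rule exI[of _ c])
          (simp add: that del: kernel_pow.simps)
      have single: ?ex if A: "\<And>x y. x \<in> V \<Longrightarrow> y \<in> V \<Longrightarrow> 0 \<le> A x y \<and> A x y \<le> 1"
        and R: "\<And>w z. w \<in> V \<Longrightarrow> z \<in> V \<Longrightarrow> ?R w z = ?p A (k - 1) w z" for A
      proof -
        define i where "i = k - 3"
        have i: "k - 1 = Suc (Suc i)" "i + 0 + 3 = k" using k by (auto simp: i_def)
        have R': "?R w z = (\<Sum>x\<in>V. ?p A (Suc 0) w x * ?p A (Suc i) x z)" if "w \<in> V" "z \<in> V" for w z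
        proof -
          have "?R w z = (\<Sum>x\<in>V. A w x * ?p A (Suc i) x z)" by (simp only: R[OF that] i kernel_pow.simps)
          also have "\<dots> = (\<Sum>x\<in>V. ?p A (Suc 0) w x * ?p A (Suc i) x z)"
            using fin by (intro sum.cong refl) (metis kernel_pow_1)
          finally show ?thesis .
        qed
        show ?ex by (rule ex[where P = "?p A (Suc i)" and Q = "?p A (Suc 0)" and b = i and c = 0])
          (use i R' pb[OF A, where i = 0] pb[OF A] in \<open>auto simp del: kernel_pow.simps\<close>)
      qed
      consider "a = 0" | "j = 0" | a' j' where "a = Suc a'" "j = Suc j'"
        by (meson not0_implies_Suc)
      then show ?ex
      proof cases
        case 1
        then show ?ex using a(3) fin
          by (intro single[OF W]) (auto simp: if_distrib of_bool_def cong: if_cong simp del: kernel_pow.simps(2))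
      next
        case 2
        then show ?ex using a(3) fin
          by (intro single[OF h]) (auto simp: sum_of_bool_eq_mult simp del: kernel_pow.simps(2))
      next
        case 3
        show ?ex by (rule ex[where P = "?p h a" and Q = "?p W j" and b = a' and c = j'])
          (use 3 a(3) pb[OF W] pb[OF h] in \<open>auto simp del: kernel_pow.simps\<close>)
      qed
    qed
    then obtain Q P b c where bc: "b + c + 3 = k"
      and P: "\<forall>x\<in>V. \<forall>y\<in>V. 0 \<le> P x y \<and> P x y \<le> ?n ^ b"
      and Q: "\<forall>x\<in>V. \<forall>y\<in>V. 0 \<le> Q x y \<and> Q x y \<le> ?n ^ c"
      and R: "\<forall>w\<in>V. \<forall>z\<in>V. ?R w z = (\<Sum>x\<in>V. Q w x * P x z)"
      by blast
    have "T (Suc j) - T j = (\<Sum>z\<in>V. \<Sum>w\<in>V. (W z w - h z w) * (\<Sum>x\<in>V. Q w x * P x z))"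
      unfolding diff using R by (intro sum.cong refl) simp
    also have "\<dots> \<le> ?n * (?n ^ b * ?n ^ c * (\<eta> * (card V)\<^sup>2))"
      using P Q by (intro cut_bound_product[OF fin cut]) auto
    also have "\<dots> = \<eta> * ?n ^ k"
      unfolding bc[symmetric] by (simp add: power_add power2_eq_square numeral_3_eq_3)
    finally show ?thesis by simp
  qed
  have "T j \<le> T 0 + j * (\<eta> * ?n ^ k)" if "j \<le> k" for j
    using that
  proof (induction j)
    case (Suc j)
    then show ?case using step[of j] by (simp add: algebra_simps)
  qed simp
  from this[of k] have "T k \<le> T 0 + k * (\<eta> * ?n ^ k)" by simp
  moreover have "T k = (\<Sum>x\<in>V. ?p W k x x)" unfolding T_def
    using fin by (intro sum.cong refl) (simp add: if_distribR cong: if_cong)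
  moreover have "T 0 = (\<Sum>x\<in>V. ?p h k x x)" unfolding T_def
    using fin by (intro sum.cong refl) (simp add: if_distrib of_bool_def cong: if_cong)
  ultimately show ?thesis by (simp add: mult_ac)
qed

section \<open>Supersaturation of closed walks\<close>

lemma finite_argmax:
  fixes f :: "'a \<Rightarrow> real"
  assumes "finite A" "A \<noteq> {}"
  obtains x where "x \<in> A" "\<And>y. y \<in> A \<Longrightarrow> f y \<le> f x"
proof -
  have "Max (f ` A) \<in> f ` A" using assms by (intro Max_in) auto
  then obtain x where "x \<in> A" "f x = Max (f ` A)" by (metis imageE)
  then show ?thesis using assms by (intro that[of x]) auto
qed

lemma real_card_Diff_singleton:
  "finite X \<Longrightarrow> a \<in> X \<Longrightarrow> real (card (X - {a})) = real (card X) - 1"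
  using card_Suc_Diff1[of X a] by linarith

lemma card_Int_ge:
  assumes "finite X" "A \<subseteq> X" "B \<subseteq> X"
  shows "real (card (A \<inter> B)) \<ge> real (card A) + real (card B) - real (card X)"
proof -
  have "card A + card B = card (A \<union> B) + card (A \<inter> B)"
    using assms by (intro card_Un_Int) (auto intro: finite_subset)
  moreover have "card (A \<union> B) \<le> card X" using assms by (intro card_mono) auto
  ultimately show ?thesis by linarith
qed

text \<open>A maximiser of the surplus \<open>?\<Phi>\<close> of arcs over a multiple of the squared
  size: deleting a vertex cannot raise the surplus, so each vertex has large degree, and comparison
  with \<open>V\<close> itself keeps the maximiser large.\<close>

lemma exists_min_degree_subset:
  fixes S :: "'a \<Rightarrow> 'a \<Rightarrow> bool" and \<epsilon> :: real
  assumes fin: "finite V" and \<epsilon>: "0 < \<epsilon>" "\<epsilon> \<le> 1" and n: "real (card V) \<ge> 4 / \<epsilon>\<^sup>2"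
    and S: "real (card {(x, y) \<in> V \<times> V. S x y}) \<ge> (1/2 + \<epsilon>) * (card V)\<^sup>2"
  obtains X where "X \<subseteq> V" "real (card X) \<ge> \<epsilon> / 2 * card V"
    "\<And>a. a \<in> X \<Longrightarrow> real (card {b \<in> X. S a b}) + real (card {b \<in> X. S b a}) \<ge> (1 + \<epsilon> / 2) * card X"
proof -
  let ?s = "\<lambda>X. card {(x, y) \<in> X \<times> X. S x y}"
  \<comment> \<open>Halfway between 1/2 and the density: one half of the excess goes into the
    degrees, the other into the size of \<open>X\<close>.\<close>
  let ?\<theta> = "1/2 + \<epsilon>/2"
  let ?\<Phi> = "\<lambda>X. real (?s X) - ?\<theta> * (card X)\<^sup>2"
  obtain X where X: "X \<in> Pow V" and max: "\<And>Y. Y \<in> Pow V \<Longrightarrow> ?\<Phi> Y \<le> ?\<Phi> X"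
    using finite_argmax[of "Pow V" ?\<Phi>] fin by blast
  have finX: "finite X" using X fin by (auto intro: finite_subset)
  have "?s X \<le> card (X \<times> X)" using finX by (intro card_mono) auto
  then have "real (?s X) \<le> (card X)\<^sup>2"
    unfolding card_cartesian_product power2_eq_square by (rule of_nat_mono)
  moreover have "0 \<le> ?\<theta> * real ((card X)\<^sup>2)" using \<epsilon> by simp
  ultimately have "?\<Phi> X \<le> (card X)\<^sup>2" by linarith
  moreover have "?\<Phi> V \<ge> \<epsilon> / 2 * (card V)\<^sup>2" using S by (simp add: algebra_simps)
  ultimately have "\<epsilon> / 2 * (card V)\<^sup>2 \<le> (real (card X))\<^sup>2" using max[of V] by simp
  moreover have "(\<epsilon> / 2)\<^sup>2 \<le> \<epsilon> / 2" using \<epsilon> by (simp add: power2_eq_square mult_le_cancel_left1)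
  then have "(\<epsilon> / 2 * card V)\<^sup>2 \<le> \<epsilon> / 2 * (card V)\<^sup>2"
    by (simp only: power_mult_distrib of_nat_power) (intro mult_right_mono, auto)
  ultimately have "(\<epsilon> / 2 * card V)\<^sup>2 \<le> (real (card X))\<^sup>2" by linarith
  then have cX: "\<epsilon> / 2 * card V \<le> card X" by (rule power2_le_imp_le) simp
  have "4 / \<epsilon>\<^sup>2 * (\<epsilon> / 2) \<le> real (card X)"
    using n cX \<epsilon> by (smt (verit) mult.commute mult_left_mono divide_nonneg_pos)
  \<comment> \<open>This absorbs the lower-order term in |X|^2 - (|X| - 1)^2 = 2|X| - 1.\<close>
  then have big: "1 \<le> \<epsilon> / 2 * card X"
    using \<epsilon> by (simp add: power2_eq_square field_simps)
  have deg: "real (card {b \<in> X. S a b}) + real (card {b \<in> X. S b a}) \<ge> (1 + \<epsilon> / 2) * card X"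
    if a: "a \<in> X" for a
  proof -
    have "{(x, y) \<in> X \<times> X. S x y} \<subseteq> {(x, y) \<in> (X - {a}) \<times> (X - {a}). S x y}
        \<union> (\<lambda>b. (a, b)) ` {b \<in> X. S a b} \<union> (\<lambda>b. (b, a)) ` {b \<in> X. S b a}"
      by auto
    then have "?s X \<le> card ({(x, y) \<in> (X - {a}) \<times> (X - {a}). S x y}
        \<union> (\<lambda>b. (a, b)) ` {b \<in> X. S a b} \<union> (\<lambda>b. (b, a)) ` {b \<in> X. S b a})"
      using finX by (intro card_mono) (auto intro: finite_subset[of _ "X \<times> X"])
    also have "\<dots> \<le> ?s (X - {a}) + card ((\<lambda>b. (a, b)) ` {b \<in> X. S a b})
        + card ((\<lambda>b. (b, a)) ` {b \<in> X. S b a})"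
      by (meson add_mono card_Un_le le_refl le_trans)
    also have "\<dots> \<le> ?s (X - {a}) + card {b \<in> X. S a b} + card {b \<in> X. S b a}"
      using finX by (intro add_mono card_image_le) auto
    finally have 1: "real (?s X) \<le> ?s (X - {a}) + card {b \<in> X. S a b} + card {b \<in> X. S b a}"
      by simp
    have 2: "?\<Phi> (X - {a}) \<le> ?\<Phi> X" using X by (intro max) auto
    have c: "real (card (X - {a})) = real (card X) - 1"
      using a finX by (intro real_card_Diff_singleton)
    have "?\<theta> * (2 * real (card X) - 1) \<le> real (card {b \<in> X. S a b}) + real (card {b \<in> X. S b a})"
      using 1 2 unfolding of_nat_power c by (simp add: power2_eq_square algebra_simps)
    moreover have "?\<theta> * (2 * real (card X) - 1) \<ge> (1 + \<epsilon> / 2) * card X"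
      using big \<epsilon> by (simp add: algebra_simps)
    ultimately show ?thesis by linarith
  qed
  from that[OF _ cX deg] X show thesis by blast
qed

text \<open>The triples are the germs of closed \<open>k\<close>-walks: \<open>c\<close> is joined to both ends of a zigzag
  along the two-way arcs \<open>a\<close>--\<open>b\<close>.\<close>

lemma many_germs:
  fixes S :: "'a \<Rightarrow> 'a \<Rightarrow> bool" and \<epsilon> :: real
  assumes fin: "finite V" and \<epsilon>: "0 < \<epsilon>" "\<epsilon> \<le> 1" and n: "real (card V) \<ge> 4 / \<epsilon>\<^sup>2"
    and S: "real (card {(x, y) \<in> V \<times> V. S x y}) \<ge> (1/2 + \<epsilon>) * (card V)\<^sup>2"
  shows "(\<Sum>c\<in>V. real (card {(a, b) \<in> V \<times> V. S a b \<and> S b a \<and> S c a \<and> S b c})) \<ge> (\<epsilon>/2) ^ 5 * card V ^ 3" (is ?odd)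
    and "(\<Sum>c\<in>V. real (card {(a, b) \<in> V \<times> V. S a b \<and> S b a \<and> S c a \<and> S a c})) \<ge> (\<epsilon>/2) ^ 5 * card V ^ 3" (is ?even)
proof -
  define \<beta> where "\<beta> = \<epsilon> / 2"
  have \<beta>: "0 < \<beta>" using \<epsilon> by (simp add: \<beta>_def)
  obtain X where X: "X \<subseteq> V" and cX: "real (card X) \<ge> \<beta> * card V"
    and deg: "\<And>a. a \<in> X \<Longrightarrow> real (card {b \<in> X. S a b}) + real (card {b \<in> X. S b a}) \<ge> (1 + \<beta>) * card X"
    using exists_min_degree_subset[OF assms] unfolding \<beta>_def by blast
  have finX: "finite X" using X fin by (auto intro: finite_subset)
  let ?m = "real (card X)" and ?n = "real (card V)"
  have "(\<beta> * ?n) ^ 3 \<le> ?m ^ 3" using cX \<beta> by (intro power_mono) auto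
  then have "\<beta>\<^sup>2 * (\<beta> * ?n) ^ 3 \<le> \<beta>\<^sup>2 * ?m ^ 3" by (intro mult_left_mono) auto
  then have m3: "\<beta> ^ 5 * ?n ^ 3 \<le> \<beta>\<^sup>2 * ?m ^ 3"
    by (simp add: power_mult_distrib flip: power_add mult.assoc)
  \<comment> \<open>The partners of \<open>a\<close> along two-way arcs; out-degree plus in-degree
    exceeds the size of \<open>X\<close>, so the two neighbourhoods overlap.\<close>
  define U where "U a = {b \<in> X. S a b \<and> S b a}" for a
  have U: "real (card (U a)) \<ge> \<beta> * ?m" if "a \<in> X" for a
  proof -
    have "U a = {b \<in> X. S a b} \<inter> {b \<in> X. S b a}" by (auto simp: U_def)
    then show ?thesis
      using card_Int_ge[OF finX, of "{b \<in> X. S a b}" "{b \<in> X. S b a}"] deg[OF that]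
      by (simp add: algebra_simps)
  qed
  have finU: "finite (U a)" for a using finX by (simp add: U_def)
  have swap: "(\<Sum>c\<in>V. real (card {(a, b) \<in> V \<times> V. S a b \<and> S b a \<and> R a b c}))
      \<ge> (\<Sum>a\<in>X. \<Sum>b\<in>U a. real (card {c \<in> X. R a b c}))" for R
  proof -
    have "(\<Sum>a\<in>X. \<Sum>b\<in>U a. card {c \<in> X. R a b c})
        = card (SIGMA p : (SIGMA a : X. U a). {c \<in> X. R (fst p) (snd p) c})"
      using finX finU by (simp add: sum.Sigma split_def)
    also have "\<dots> \<le> card ((\<lambda>(c, p). (p, c)) ` (SIGMA c : V. {(a, b) \<in> V \<times> V. S a b \<and> S b a \<and> R a b c}))"
      using X fin by (intro card_mono finite_imageI finite_SigmaI)
        (auto simp: U_def image_iff intro: finite_subset[of _ "V \<times> V"])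
    also have "\<dots> \<le> card (SIGMA c : V. {(a, b) \<in> V \<times> V. S a b \<and> S b a \<and> R a b c})"
      using fin by (intro card_image_le finite_SigmaI) (auto intro: finite_subset[of _ "V \<times> V"])
    also have "\<dots> = (\<Sum>c\<in>V. card {(a, b) \<in> V \<times> V. S a b \<and> S b a \<and> R a b c})"
      using fin by (intro card_SigmaI ballI) (auto intro: finite_subset[of _ "V \<times> V"])
    finally have "real (\<Sum>a\<in>X. \<Sum>b\<in>U a. card {c \<in> X. R a b c})
        \<le> real (\<Sum>c\<in>V. card {(a, b) \<in> V \<times> V. S a b \<and> S b a \<and> R a b c})"
      by (rule of_nat_mono)
    then show ?thesis by (simp add: split_def)
  qed
  have lower: "\<beta>\<^sup>2 * ?m ^ 3 \<le> (\<Sum>a\<in>X. \<Sum>b\<in>U a. f a b)"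
    if "\<And>a b. a \<in> X \<Longrightarrow> b \<in> U a \<Longrightarrow> f a b \<ge> \<beta> * ?m" for f
  proof -
    have "\<beta>\<^sup>2 * ?m ^ 3 = (\<Sum>a\<in>X. \<beta> * ?m * (\<beta> * ?m))"
      by (simp add: power2_eq_square power3_eq_cube)
    also have "\<dots> \<le> (\<Sum>a\<in>X. card (U a) * (\<beta> * ?m))"
      using U \<beta> by (intro sum_mono mult_right_mono) auto
    also have "\<dots> \<le> (\<Sum>a\<in>X. \<Sum>b\<in>U a. f a b)"
      using that by (intro sum_mono sum_bounded_below) auto
    finally show ?thesis .
  qed
  let ?p = "\<lambda>a b. {c \<in> X. S c a \<and> S b c}"
  \<comment> \<open>Either orientation of the triangles on a two-way arc may be rare by itself; only
    their total is bounded below, by adding the degrees of \<open>a\<close> and \<open>b\<close>.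
    The symmetry of \<open>U\<close> in the two ends equates the two sums.\<close>
  have sym: "(\<Sum>a\<in>X. \<Sum>b\<in>U a. real (card (?p a b))) = (\<Sum>a\<in>X. \<Sum>b\<in>U a. real (card (?p b a)))"
  proof -
    have "(\<Sum>a\<in>X. \<Sum>b | b \<in> X \<and> (S a b \<and> S b a). real (card (?p a b)))
      = (\<Sum>b\<in>X. \<Sum>a | a \<in> X \<and> (S a b \<and> S b a). real (card (?p a b)))"
      by (rule sum.swap_restrict[OF finX finX])
    then show ?thesis unfolding U_def by (simp add: conj_ac)
  qed
  have two: "real (card (?p a b)) + real (card (?p b a)) \<ge> 2 * \<beta> * ?m" if "a \<in> X" "b \<in> U a" for a b
  proof -
    have b: "b \<in> X" using that by (simp add: U_def)
    have "?p a b = {c \<in> X. S c a} \<inter> {c \<in> X. S b c}" "?p b a = {c \<in> X. S c b} \<inter> {c \<in> X. S a c}"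
      by auto
    then show ?thesis
      using card_Int_ge[OF finX, of "{c \<in> X. S c a}" "{c \<in> X. S b c}"]
        card_Int_ge[OF finX, of "{c \<in> X. S c b}" "{c \<in> X. S a c}"] deg[OF that(1)] deg[OF b]
      by (simp add: algebra_simps)
  qed
  have "\<beta>\<^sup>2 * ?m ^ 3 \<le> (\<Sum>a\<in>X. \<Sum>b\<in>U a. (real (card (?p a b)) + real (card (?p b a))) / 2)"
    using two by (intro lower) force
  also have "\<dots> = (\<Sum>a\<in>X. \<Sum>b\<in>U a. real (card (?p a b)))"
    using sym by (simp add: sum.distrib flip: sum_divide_distrib)
  also have "\<dots> \<le> (\<Sum>c\<in>V. real (card {(a, b) \<in> V \<times> V. S a b \<and> S b a \<and> S c a \<and> S b c}))"
    by (rule swap[of "\<lambda>a b c. S c a \<and> S b c"])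
  finally show ?odd
    using m3 by (simp add: \<beta>_def)
  have "\<beta>\<^sup>2 * ?m ^ 3 \<le> (\<Sum>a\<in>X. \<Sum>b\<in>U a. real (card (U a)))"
    using U by (intro lower) auto
  also have "\<dots> = (\<Sum>a\<in>X. \<Sum>b\<in>U a. real (card {c \<in> X. S c a \<and> S a c}))"
    by (simp add: U_def conj_ac)
  also have "\<dots> \<le> (\<Sum>c\<in>V. real (card {(a, b) \<in> V \<times> V. S a b \<and> S b a \<and> S c a \<and> S a c}))"
    by (rule swap[of "\<lambda>a b c. S c a \<and> S a c"])
  finally show ?even
    using m3 by (simp add: \<beta>_def)
qed

text \<open>Again by a maximiser, now of the number of pairs minus \<open>?\<delta>\<close> for
  every vertex used: a vertex of smaller degree would be deleted. The value at \<open>(V, V)\<close>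
  is positive, so \<open>Y\<close> is not empty, and one column already makes \<open>X\<close>
  large.\<close>

lemma bipartite_min_degree_subsets:
  fixes B :: "'a \<Rightarrow> 'a \<Rightarrow> bool" and d :: real
  assumes fin: "finite V" and pos: "0 < d" "0 < card V"
    and B: "real (card {(a, b) \<in> V \<times> V. B a b}) \<ge> d * (card V)\<^sup>2"
  obtains X Y where "X \<subseteq> V" "Y \<subseteq> V" "real (card X) \<ge> d / 4 * card V"
    "\<And>a. a \<in> X \<Longrightarrow> real (card {b \<in> Y. B a b}) \<ge> d / 4 * card V"
    "\<And>b. b \<in> Y \<Longrightarrow> real (card {a \<in> X. B a b}) \<ge> d / 4 * card V"
proof -
  let ?\<delta> = "d / 4 * card V"
  let ?\<Phi> = "\<lambda>(X, Y). real (card {(a, b) \<in> X \<times> Y. B a b}) - ?\<delta> * (card X + card Y)"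
  obtain P where P: "P \<in> Pow V \<times> Pow V" and max0: "\<And>Q. Q \<in> Pow V \<times> Pow V \<Longrightarrow> ?\<Phi> Q \<le> ?\<Phi> P"
    using finite_argmax[of "Pow V \<times> Pow V" ?\<Phi>] fin by blast
  obtain X Y where XY: "X \<subseteq> V" "Y \<subseteq> V" and PXY: "P = (X, Y)" using P by auto
  have max: "?\<Phi> (X', Y') \<le> ?\<Phi> (X, Y)" if "X' \<subseteq> V" "Y' \<subseteq> V" for X' Y'
  proof -
    have "(X', Y') \<in> Pow V \<times> Pow V" using that by simp
    from max0[OF this] show ?thesis unfolding PXY .
  qed
  have finXY: "finite X" "finite Y" using XY fin by (auto intro: finite_subset)
  have row: "real (card {b \<in> Y. B a b}) \<ge> ?\<delta>" if a: "a \<in> X" for a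
  proof -
    have "card {(a, b) \<in> X \<times> Y. B a b}
      \<le> card ({(a', b) \<in> (X - {a}) \<times> Y. B a' b} \<union> Pair a ` {b \<in> Y. B a b})"
      using finXY by (intro card_mono) (auto intro: finite_subset[of _ "X \<times> Y"])
    also have "\<dots> \<le> card {(a', b) \<in> (X - {a}) \<times> Y. B a' b} + card {b \<in> Y. B a b}"
      using finXY by (intro order_trans[OF card_Un_le] add_mono card_image_le) auto
    finally have "real (card {(a, b) \<in> X \<times> Y. B a b})
      \<le> card {(a', b) \<in> (X - {a}) \<times> Y. B a' b} + real (card {b \<in> Y. B a b})" by linarith
    moreover have "?\<Phi> (X - {a}, Y) \<le> ?\<Phi> (X, Y)" using XY by (intro max) auto
    moreover have c: "real (card (X - {a})) = real (card X) - 1"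
      using a finXY by (intro real_card_Diff_singleton)
    ultimately show ?thesis by (simp only: prod.case of_nat_add c distrib_left right_diff_distrib)
    qed
  have col: "real (card {a \<in> X. B a b}) \<ge> ?\<delta>" if b: "b \<in> Y" for b
  proof -
    have "card {(a, b) \<in> X \<times> Y. B a b}
      \<le> card ({(a, b') \<in> X \<times> (Y - {b}). B a b'} \<union> (\<lambda>a. (a, b)) ` {a \<in> X. B a b})"
      using finXY by (intro card_mono) (auto intro: finite_subset[of _ "X \<times> Y"])
    also have "\<dots> \<le> card {(a, b') \<in> X \<times> (Y - {b}). B a b'} + card {a \<in> X. B a b}"
      using finXY by (intro order_trans[OF card_Un_le] add_mono card_image_le) auto
    finally have "real (card {(a, b) \<in> X \<times> Y. B a b})
      \<le> card {(a, b') \<in> X \<times> (Y - {b}). B a b'} + real (card {a \<in> X. B a b})" by linarith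
    moreover have "?\<Phi> (X, Y - {b}) \<le> ?\<Phi> (X, Y)" using XY by (intro max) auto
    moreover have c: "real (card (Y - {b})) = real (card Y) - 1"
      using b finXY by (intro real_card_Diff_singleton)
    ultimately show ?thesis by (simp only: prod.case of_nat_add c distrib_left right_diff_distrib)
    qed
  have "?\<Phi> (V, V) \<ge> d / 2 * (card V)\<^sup>2" using B by (simp add: power2_eq_square algebra_simps)
  moreover have "0 < d / 2 * real ((card V)\<^sup>2)" using pos by simp
  moreover have "?\<Phi> (V, V) \<le> ?\<Phi> (X, Y)" by (rule max) auto
  ultimately have "0 < ?\<Phi> (X, Y)" by linarith
  moreover have "0 \<le> ?\<delta> * real (card X + card Y)" using pos by simp
  ultimately have "0 < real (card {(a, b) \<in> X \<times> Y. B a b})" by simp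
  then have "{(a, b) \<in> X \<times> Y. B a b} \<noteq> {}" by (metis card.empty less_irrefl of_nat_0)
  then obtain b where "b \<in> Y" by auto
  then have "?\<delta> \<le> real (card {a \<in> X. B a b})" by (rule col)
  also have "\<dots> \<le> card X" using finXY by (intro of_nat_mono card_mono) auto
  finally show thesis using that[OF XY _ row col] by blast
qed

text \<open>A walk goes from \<open>c\<close> into \<open>X\<close>, then alternates between
  \<open>X\<close> and \<open>Y\<close> along two-way arcs with at least \<open>?\<delta>\<close>
  choices for each of its \<open>k - 1\<close> free vertices. The last of them lies in
  \<open>Y\<close> for odd \<open>k\<close> and in \<open>X\<close> for even \<open>k\<close>, which
  decides which arc back to \<open>c\<close> the germ must provide.\<close>

lemma closed_walks_from_germs:
  fixes S :: "'a \<Rightarrow> 'a \<Rightarrow> bool" and d :: real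
  assumes fin: "finite V" and pos: "0 < d" and c: "c \<in> V" and k: "k \<ge> 3"
    and B: "real (card {(a, b) \<in> V \<times> V. B a b}) \<ge> d * (card V)\<^sup>2"
    and BS: "\<And>a b. B a b \<Longrightarrow> S a b \<and> S b a \<and> S c a \<and> (if odd k then S b c else S a c)"
  shows "kernel_pow V (\<lambda>x y. of_bool (S x y)) k c c \<ge> (d / 4 * card V) ^ (k - 1)"
proof -
  let ?s = "\<lambda>x y. of_bool (S x y) :: real"
  let ?p = "kernel_pow V ?s"
  let ?\<delta> = "d / 4 * card V"
  have "0 < card V" using fin c by (auto simp: card_gt_0_iff)
  then obtain X Y where X: "X \<subseteq> V" and Y: "Y \<subseteq> V" and cX: "real (card X) \<ge> ?\<delta>"
    and row: "\<And>a. a \<in> X \<Longrightarrow> real (card {b \<in> Y. B a b}) \<ge> ?\<delta>"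
    and col: "\<And>b. b \<in> Y \<Longrightarrow> real (card {a \<in> X. B a b}) \<ge> ?\<delta>"
    using bipartite_min_degree_subsets[OF fin pos _ B] by blast
  have \<delta>: "0 < ?\<delta>" using pos \<open>0 < card V\<close> by simp
  have nn: "0 \<le> ?p e x y" if "x \<in> V" "y \<in> V" for e x y
    using that by (intro kernel_pow_nonneg) auto
  have finXY: "finite X" "finite Y" using X Y fin by (auto intro: finite_subset)
  have sub: "(\<Sum>y\<in>V. ?s x y * f y) \<ge> card Z * \<gamma>"
    if "Z \<subseteq> V" "\<And>y. y \<in> Z \<Longrightarrow> S x y \<and> f y \<ge> \<gamma>" "\<And>y. y \<in> V \<Longrightarrow> 0 \<le> f y" for Z x f and \<gamma> :: real
  proof -
    have "card Z * \<gamma> \<le> (\<Sum>y\<in>Z. ?s x y * f y)" using that by (intro sum_bounded_below) auto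
    also have "\<dots> \<le> (\<Sum>y\<in>V. ?s x y * f y)" using that fin by (intro sum_mono2) auto
    finally show ?thesis .
  qed
  \<comment> \<open>One round trip from \<open>X\<close> to \<open>Y\<close> and back.\<close>
  have step: "?p (Suc (Suc e)) a c \<ge> ?\<delta> * (?\<delta> * \<gamma>)"
    if \<gamma>: "0 \<le> \<gamma>" "\<And>a. a \<in> X \<Longrightarrow> ?p e a c \<ge> \<gamma>" and a: "a \<in> X" for e a and \<gamma> :: real
  proof -
    have "?\<delta> * (?\<delta> * \<gamma>) \<le> card {b \<in> Y. B a b} * (?\<delta> * \<gamma>)"
      using row[OF a] \<gamma> \<delta> by (intro mult_right_mono) auto
    also have "\<dots> \<le> (\<Sum>b\<in>V. ?s a b * ?p (Suc e) b c)"
    proof (rule sub)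
      fix b assume b: "b \<in> {b \<in> Y. B a b}"
      have "?\<delta> * \<gamma> \<le> card {a' \<in> X. B a' b} * \<gamma>" using col b \<gamma> by (intro mult_right_mono) auto
      also have "\<dots> \<le> (\<Sum>a'\<in>V. ?s b a' * ?p e a' c)"
        using X BS \<gamma> nn c by (intro sub) auto
      finally show "S a b \<and> ?\<delta> * \<gamma> \<le> ?p (Suc e) b c" using BS b by auto
    qed (use Y nn c in \<open>auto simp del: kernel_pow.simps\<close>)
    finally show ?thesis by simp
  qed
  have iter: "?p (e + 2 * i) a c \<ge> ?\<delta> ^ (2 * i) * \<gamma>"
    if "0 \<le> \<gamma>" "\<And>a. a \<in> X \<Longrightarrow> ?p e a c \<ge> \<gamma>" "a \<in> X" for e i a and \<gamma> :: real
    using that(3)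
  proof (induction i arbitrary: a)
    case (Suc i)
    have "?p (Suc (Suc (e + 2 * i))) a c \<ge> ?\<delta> * (?\<delta> * (?\<delta> ^ (2 * i) * \<gamma>))"
      using Suc that(1) \<delta> by (intro step) auto
    then show ?case by (simp add: mult.assoc del: kernel_pow.simps)
  qed (use that in simp)
  \<comment> \<open>Round trips add two steps, so the induction starts from length 2 for odd
    \<open>k\<close> and from length 1 for even \<open>k\<close>. The arc closing the walk offers no
    choice, whence the exponent \<open>k - 2\<close>.\<close>
  have last: "?p (k - 1) a c \<ge> ?\<delta> ^ (k - 2)" if a: "a \<in> X" for a
  proof (cases "odd k")
    case True
    have "?p 2 a c \<ge> ?\<delta>" if "a \<in> X" for a
    proof -
      have "?\<delta> \<le> real (card {b \<in> Y. B a b}) * 1" using row[OF that] by simp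
      also have "\<dots> \<le> (\<Sum>b\<in>V. ?s a b * ?p 1 b c)"
        using Y BS nn c True fin by (intro sub) (auto simp: kernel_pow_1 simp del: kernel_pow.simps)
      finally show ?thesis by (simp add: numeral_2_eq_2)
    qed
    from iter[OF _ this a, of "(k - 3) div 2"] \<delta>
    have "?p (2 + 2 * ((k - 3) div 2)) a c \<ge> ?\<delta> ^ (2 * ((k - 3) div 2)) * ?\<delta>"
      by (simp del: kernel_pow.simps)
    moreover have "2 + 2 * ((k - 3) div 2) = k - 1" "Suc (2 * ((k - 3) div 2)) = k - 2"
      using True k by (auto elim!: oddE)
    ultimately show ?thesis by (metis power_Suc2)
  next
    case False
    have "?p (Suc 0) a c \<ge> 1" if a: "a \<in> X" for a
    proof -
      have "card {b \<in> Y. B a b} > 0" using row[OF a] \<delta> by linarith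
      then obtain b where "B a b" by (auto simp: card_gt_0_iff)
      then have "S a c" using BS[of a b] False by auto
      then show ?thesis using fin c by (simp add: kernel_pow_1 del: kernel_pow.simps)
    qed
    from iter[OF _ this a, of "(k - 2) div 2"]
    have "?p (Suc 0 + 2 * ((k - 2) div 2)) a c \<ge> ?\<delta> ^ (2 * ((k - 2) div 2))"
      by (simp del: kernel_pow.simps)
    moreover have "Suc 0 + 2 * ((k - 2) div 2) = k - 1" "2 * ((k - 2) div 2) = k - 2"
      using False k by auto
    ultimately show ?thesis by metis
  qed
  have "?\<delta> ^ (k - 1) = ?\<delta> * ?\<delta> ^ (k - 2)" using k by (subst power_Suc[symmetric]) (simp add: Suc_diff_Suc numeral_2_eq_2)
  also have "\<dots> \<le> card X * ?\<delta> ^ (k - 2)" using cX \<delta> by (intro mult_right_mono) auto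
  also have "\<dots> \<le> (\<Sum>a\<in>V. ?s c a * ?p (k - 1) a c)"
  proof (rule sub[OF X])
    fix a assume a: "a \<in> X"
    have "card {b \<in> Y. B a b} > 0" using row[OF a] \<delta> by linarith
    then obtain b where "B a b" by (auto simp: card_gt_0_iff)
    then show "S c a \<and> ?\<delta> ^ (k - 2) \<le> ?p (k - 1) a c" using BS last[OF a] by blast
  qed (use nn c in auto)
  also have "\<dots> = ?p (Suc (k - 1)) c c" by simp
  also have "Suc (k - 1) = k" using k by simp
  finally show ?thesis .
qed

text \<open>Averaging: of the d n^3 germs at most half sit at vertices with fewer than d n^2/2 of
  them, so at least d n/2 vertices are rich, and each rich one is the base of many closed walks. The
  factor d/2 is weakened to d/8 merely to obtain a pure \<open>k\<close>-th power.\<close>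

lemma closed_walk_supersaturation:
  fixes S :: "'a \<Rightarrow> 'a \<Rightarrow> bool" and \<epsilon> :: real
  assumes fin: "finite V" and k: "k \<ge> 3" and \<epsilon>: "0 < \<epsilon>" "\<epsilon> \<le> 1" and n: "real (card V) \<ge> 4 / \<epsilon>\<^sup>2"
    and S: "real (card {(x, y) \<in> V \<times> V. S x y}) \<ge> (1/2 + \<epsilon>) * (card V)\<^sup>2"
  shows "(\<Sum>c\<in>V. kernel_pow V (\<lambda>x y. of_bool (S x y)) k c c) \<ge> ((\<epsilon>/2) ^ 5 / 8 * card V) ^ k"
proof -
  let ?n = "real (card V)" and ?p = "kernel_pow V (\<lambda>x y. of_bool (S x y))"
  define d where "d = (\<epsilon>/2) ^ 5"
  have d: "0 < d" using \<epsilon> by (simp add: d_def)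
  have n0: "?n > 0" using n \<epsilon> by (smt (verit) divide_pos_pos zero_less_power)
  define B where "B c a b \<longleftrightarrow> S a b \<and> S b a \<and> S c a \<and> (if odd k then S b c else S a c)" for c a b
  let ?e = "\<lambda>c. real (card {(a, b) \<in> V \<times> V. B c a b})"
  have E: "(\<Sum>c\<in>V. ?e c) \<ge> d * ?n ^ 3"
    using many_germs[OF fin \<epsilon> n S] by (cases "odd k") (auto simp: B_def d_def)
  define G where "G = {c \<in> V. ?e c \<ge> d / 2 * ?n\<^sup>2}"
  have G: "G \<subseteq> V" "finite G" using fin by (auto simp: G_def)
  have "?e c \<le> of_bool (c \<in> G) * ?n\<^sup>2 + d / 2 * ?n\<^sup>2" if "c \<in> V" for c
  proof (cases "c \<in> G")
    case True
    have "card {(a, b) \<in> V \<times> V. B c a b} \<le> card (V \<times> V)" using fin by (intro card_mono) auto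
    then have "?e c \<le> real (card V * card V)"
      unfolding card_cartesian_product by (rule of_nat_mono)
    moreover have "0 \<le> d / 2 * ?n\<^sup>2" using d by simp
    ultimately show ?thesis using True by (simp add: power2_eq_square)
  qed (use that in \<open>auto simp: G_def\<close>)
  then have "(\<Sum>c\<in>V. ?e c) \<le> (\<Sum>c\<in>V. of_bool (c \<in> G) * ?n\<^sup>2 + d / 2 * ?n\<^sup>2)" by (rule sum_mono)
  also have "\<dots> = card G * ?n\<^sup>2 + d / 2 * ?n ^ 3"
    using G fin by (simp add: sum.distrib power2_eq_square power3_eq_cube Int_absorb1 flip: sum_distrib_right)
  finally have "d / 2 * ?n * ?n\<^sup>2 \<le> card G * ?n\<^sup>2"
    using E by (simp add: power2_eq_square power3_eq_cube)
  then have cG: "d / 2 * ?n \<le> card G" using n0 by simp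
  have "(d / 8 * ?n) ^ k = (d / 8 * ?n) * (d / 8 * ?n) ^ (k - 1)"
    using k by (simp add: power_eq_if)
  also have "\<dots> \<le> card G * (d / 8 * ?n) ^ (k - 1)"
    using cG d by (intro mult_right_mono) auto
  also have "\<dots> \<le> (\<Sum>c\<in>G. ?p k c c)"
  proof (rule sum_bounded_below)
    fix c assume "c \<in> G"
    then have "c \<in> V" "?e c \<ge> d / 2 * (card V)\<^sup>2" by (auto simp: G_def)
    then have "?p k c c \<ge> (d / 2 / 4 * ?n) ^ (k - 1)"
      using d by (intro closed_walks_from_germs[OF fin _ _ k, where B = "B c"]) (auto simp: B_def)
    then show "(d / 8 * ?n) ^ (k - 1) \<le> ?p k c c" by simp
  qed
  also have "\<dots> \<le> (\<Sum>c\<in>V. ?p k c c)"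
    using G fin by (intro sum_mono2 kernel_pow_nonneg) auto
  finally show ?thesis by (simp add: d_def)
qed

section \<open>Cycles in dense subgraphs of quasirandom digraphs\<close>

text \<open>The start \<open>x\<close> is left out of the list and the end is kept, so a closed walk
  with \<open>k\<close> steps is recorded as a cyclic list of exactly \<open>k\<close>
  vertices.\<close>

definition walk_lists :: "'a set \<Rightarrow> 'a rel \<Rightarrow> nat \<Rightarrow> 'a \<Rightarrow> 'a \<Rightarrow> 'a list set" where
  "walk_lists V H j x y = {ws. length ws = j \<and> set ws \<subseteq> V \<and>
     successively (\<lambda>u v. (u, v) \<in> H) (x # ws) \<and> last (x # ws) = y}"

lemma finite_walk_lists: "finite V \<Longrightarrow> finite (walk_lists V H j x y)"
  by (rule finite_subset[OF _ finite_lists_length_eq[of V j]]) (auto simp: walk_lists_def)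

lemma kernel_pow_le_card_walks:
  assumes fin: "finite V"
  shows "kernel_pow V (\<lambda>u v. of_bool ((u, v) \<in> H)) j x y \<le> real (card (walk_lists V H j x y))"
proof (induction j arbitrary: x)
  case 0
  have "walk_lists V H 0 x y = (if x = y then {[]} else {})" by (auto simp: walk_lists_def)
  then show ?case by simp
next
  case (Suc j)
  let ?p = "kernel_pow V (\<lambda>u v. of_bool ((u, v) \<in> H))"
  let ?Z = "{z \<in> V. (x, z) \<in> H}"
  have "?p (Suc j) x y = (\<Sum>z\<in>V. if (x, z) \<in> H then ?p j z y else 0)"
    by (auto intro!: sum.cong)
  also have "\<dots> = (\<Sum>z\<in>?Z. ?p j z y)"
    using fin by (simp add: sum.If_cases Int_def)
  also have "\<dots> \<le> (\<Sum>z\<in>?Z. real (card (walk_lists V H j z y)))" by (intro sum_mono Suc.IH)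
  also have "\<dots> = (\<Sum>z\<in>?Z. real (card ((#) z ` walk_lists V H j z y)))"
    by (intro sum.cong refl arg_cong[of _ _ real] card_image[symmetric]) auto
  also have "\<dots> = real (card (\<Union>z\<in>?Z. (#) z ` walk_lists V H j z y))"
    using fin by (subst card_UN_disjoint) (auto simp: finite_walk_lists)
  also have "(\<Union>z\<in>?Z. (#) z ` walk_lists V H j z y) \<subseteq> walk_lists V H (Suc j) x y"
    by (auto simp: walk_lists_def)
  then have "real (card (\<Union>z\<in>?Z. (#) z ` walk_lists V H j z y)) \<le> real (card (walk_lists V H (Suc j) x y))"
    by (intro of_nat_mono card_mono finite_walk_lists fin)
  finally show ?case .
qed

text \<open>There are at least (n - k)^k injective lists among n^k, and Bernoulli's inequality
  bounds the difference.\<close>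

lemma few_nondistinct_lists:
  assumes fin: "finite V" and k: "k \<le> card V"
  shows "real (card {ws. length ws = k \<and> set ws \<subseteq> V \<and> \<not> distinct ws}) \<le> real k ^ 2 * real (card V) ^ (k - 1)"
proof -
  let ?n = "card V"
  let ?all = "{ws. set ws \<subseteq> V \<and> length ws = k}"
  let ?dist = "{ws. length ws = k \<and> distinct ws \<and> set ws \<subseteq> V}"
  let ?bad = "{ws. length ws = k \<and> set ws \<subseteq> V \<and> \<not> distinct ws}"
  have all: "finite ?all" "card ?all = ?n ^ k"
    using fin by (auto simp: finite_lists_length_eq card_lists_length_eq)
  have "card ?all = card ?bad + card ?dist"
    using all(1) by (subst card_Un_disjoint[symmetric])
      (auto intro!: arg_cong[of _ _ card] intro: finite_subset[of _ ?all])
  moreover have "(?n - k) ^ k \<le> card ?dist"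
  proof -
    have "(?n - k) ^ k = (\<Prod>i\<in>{?n - k + 1..?n}. ?n - k)" using k by simp
    also have "\<dots> \<le> \<Prod>{?n - k + 1..?n}" by (intro prod_mono) auto
    also have "\<dots> = card ?dist" using fin k by (subst card_lists_distinct_length_eq) auto
    finally show ?thesis .
  qed
  ultimately have "real (card ?bad) \<le> real ?n ^ k - real ((?n - k) ^ k)"
    using all(2) by (metis (no_types, lifting) add.commute le_diff_eq of_nat_add of_nat_le_iff of_nat_power add_mono_thms_linordered_semiring(2))
  also have "real ((?n - k) ^ k) = (real ?n - real k) ^ k" using k by (simp add: of_nat_diff)
  also have "real ?n ^ k - (real ?n - real k) ^ k \<le> real k ^ 2 * real ?n ^ (k - 1)"
  proof (cases "k = 0")
    case False
    then have n: "real ?n > 0" using k by simp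
    have "1 + real k * (- real k / real ?n) \<le> (1 + - real k / real ?n) ^ k"
      using n k by (intro Bernoulli_inequality) simp
    then have "real ?n ^ k * (1 + real k * (- real k / real ?n)) \<le> real ?n ^ k * (1 + - real k / real ?n) ^ k"
      using n by (intro mult_left_mono) auto
    also have "\<dots> = (real ?n - real k) ^ k"
      using n by (simp add: field_simps flip: power_mult_distrib)
    finally have "real ?n ^ k - (real ?n - real k) ^ k \<le> real ?n ^ k * (real k * real k / real ?n)"
      by (simp add: algebra_simps)
    also have "\<dots> = real k ^ 2 * real ?n ^ (k - 1)"
      using n False by (simp add: power2_eq_square power_eq_if)
    finally show ?thesis .
  qed simp
  finally show ?thesis .
qed

text \<open>The list determines its base point, namely its last entry, so the sum over base points
  counts distinct lists; they outnumber the lists with a repetition.\<close>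

lemma closed_walks_give_cycle:
  assumes fin: "finite V" and k: "1 \<le> k" "k \<le> card V"
    and many: "(\<Sum>x\<in>V. kernel_pow V (\<lambda>u v. of_bool ((u, v) \<in> H)) k x x) > real k ^ 2 * real (card V) ^ (k - 1)"
  shows "\<exists>ws. length ws = k \<and> distinct ws \<and> set ws \<subseteq> V \<and> (\<forall>j<k. (ws ! j, ws ! (Suc j mod k)) \<in> H)"
proof -
  let ?L = "\<Union>x\<in>V. walk_lists V H k x x"
  have "(\<Sum>x\<in>V. kernel_pow V (\<lambda>u v. of_bool ((u, v) \<in> H)) k x x)
      \<le> (\<Sum>x\<in>V. real (card (walk_lists V H k x x)))"
    by (intro sum_mono kernel_pow_le_card_walks fin)
  also have "\<dots> = real (card ?L)"
  proof -
    have "card ?L = (\<Sum>x\<in>V. card (walk_lists V H k x x))"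
    proof (rule card_UN_disjoint)
      show "\<forall>x\<in>V. \<forall>y\<in>V. x \<noteq> y \<longrightarrow> walk_lists V H k x x \<inter> walk_lists V H k y y = {}"
        using k by (auto simp: walk_lists_def)
    qed (use fin in \<open>auto simp: finite_walk_lists\<close>)
    then show ?thesis by simp
  qed
  finally have "card ?L > card {ws. length ws = k \<and> set ws \<subseteq> V \<and> \<not> distinct ws}"
    using many few_nondistinct_lists[OF fin k(2)] by linarith
  moreover have "finite {ws. length ws = k \<and> set ws \<subseteq> V \<and> \<not> distinct ws}"
    by (rule finite_subset[OF _ finite_lists_length_eq[OF fin, of k]]) auto
  ultimately have "\<not> ?L \<subseteq> {ws. length ws = k \<and> set ws \<subseteq> V \<and> \<not> distinct ws}"
    by (meson card_mono not_le)
  then obtain x ws where ws: "ws \<in> walk_lists V H k x x" "distinct ws"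
    by (auto simp: walk_lists_def)
  have wsne: "ws \<noteq> []" using ws k by (auto simp: walk_lists_def)
  have len: "length ws = k" and sub: "set ws \<subseteq> V" and lst: "last ws = x"
    and succ: "\<And>i. i < k \<Longrightarrow> ((x # ws) ! i, ws ! i) \<in> H"
    using ws wsne by (auto simp: walk_lists_def successively_conv_nth)
  have "(ws ! j, ws ! (Suc j mod k)) \<in> H" if j: "j < k" for j
  proof (cases "Suc j = k")
    case True
    then have "ws ! j = x" using lst wsne len by (auto simp: last_conv_nth)
    then show ?thesis using True succ[of 0] k by simp
  next
    case False
    then show ?thesis using succ[of "Suc j"] j by simp
  qed
  then show ?thesis using ws(2) len sub by blast
qed

lemma block_avg2_eq:
  "block_avg2 V \<phi> h x y = (\<Sum>x' | x' \<in> V \<and> \<phi> x = \<phi> x'. \<Sum>y' | y' \<in> V \<and> \<phi> y = \<phi> y'. h x' y')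
     / (real (card {x' \<in> V. \<phi> x = \<phi> x'}) * real (card {y' \<in> V. \<phi> y = \<phi> y'}))"
  by (simp add: block_avg2_def block_avg_def mult.commute flip: sum_divide_distrib)

text \<open>An upper bound only, since it is to be inherited by arbitrary subsets of
  \<open>T\<close>.\<close>

definition quasirandom :: "real \<Rightarrow> 'a set \<Rightarrow> 'a rel \<Rightarrow> bool" where
  "quasirandom \<delta> V T \<longleftrightarrow> (\<forall>A B. A \<subseteq> V \<longrightarrow> B \<subseteq> V \<longrightarrow>
     real (card (T \<inter> A \<times> B)) \<le> real (card A) * real (card B) / 2 + \<delta> * (real (card V))\<^sup>2)"

lemma quasirandom_mono: "quasirandom \<delta> V T \<Longrightarrow> \<delta> \<le> \<delta>' \<Longrightarrow> quasirandom \<delta>' V T"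
  unfolding quasirandom_def by (meson add_left_mono mult_right_mono order_trans zero_le_power2)

theorem dense_subgraph_of_quasirandom_has_cycle:
  fixes \<epsilon> :: real
  assumes k: "k \<ge> 3" and \<epsilon>: "0 < \<epsilon>" "\<epsilon> \<le> 1"
  shows "\<exists>\<delta>>0. \<exists>N. \<forall>V T H. finite (V :: 'a set) \<longrightarrow> N \<le> card V \<longrightarrow> H \<subseteq> T \<longrightarrow> T \<subseteq> V \<times> V \<longrightarrow>
    quasirandom \<delta> V T \<longrightarrow> real (card H) \<ge> (1/4 + \<epsilon>) * (real (card V))\<^sup>2 \<longrightarrow>
    (\<exists>ws. length ws = k \<and> distinct ws \<and> set ws \<subseteq> V \<and> (\<forall>j<k. (ws ! j, ws ! (Suc j mod k)) \<in> H))"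
proof -
  \<comment> \<open>\<open>e\<close> is the unit of loss in densities, \<open>c\<close> the
    proportion of closed walks guaranteed in the kernel, half of which \<open>\<eta>\<close> allows
    the transfer to lose. \<open>M\<close> bounds the number of blocks, and \<open>\<delta>\<close>
    makes the quasirandom error at most \<open>e\<close> times the area of any product of two blocks
    of size at least e n/M. Beyond \<open>N\<close> the surviving c n^k/2 walks exceed the k^2
    n^(k-1) degenerate ones.\<close>
  define e where "e = \<epsilon> / 8"
  define c where "c = (e * ((\<epsilon>/2) ^ 5 / 8)) ^ k"
  define \<eta> where "\<eta> = c / (2 * k)"
  define M where "M = (4::nat) ^ nat \<lceil>1 / \<eta>\<^sup>2\<rceil>"
  define \<delta> where "\<delta> = e ^ 3 / (real M)\<^sup>2"
  define N where "N = max k (nat \<lceil>max (4 / \<epsilon>\<^sup>2) (2 * (real k)\<^sup>2 / c)\<rceil> + 1)"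
  have e: "0 < e" using \<epsilon> by (simp add: e_def)
  have c: "0 < c" using e \<epsilon> by (simp add: c_def)
  have \<eta>: "0 < \<eta>" using c k by (simp add: \<eta>_def)
  have M: "0 < M" by (simp add: M_def)
  have \<delta>: "0 < \<delta>" using e M by (simp add: \<delta>_def)
  have main: "\<exists>ws. length ws = k \<and> distinct ws \<and> set ws \<subseteq> V \<and> (\<forall>j<k. (ws ! j, ws ! (Suc j mod k)) \<in> H)"
    if fin: "finite V" and NV: "N \<le> card V" and HT: "H \<subseteq> T" and TV: "T \<subseteq> V \<times> V"
      and qr: "quasirandom \<delta> V T"
      and H: "real (card H) \<ge> (1/4 + \<epsilon>) * (real (card V))\<^sup>2" for V :: "'a set" and T H
  proof -
    let ?n = "real (card V)"
    have n: "k \<le> card V" "?n \<ge> 4 / \<epsilon>\<^sup>2" "?n > 2 * (real k)\<^sup>2 / c"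
    proof -
      have "nat \<lceil>max (4 / \<epsilon>\<^sup>2) (2 * (real k)\<^sup>2 / c)\<rceil> + 1 \<le> card V" "k \<le> card V"
        using NV by (auto simp: N_def)
      moreover have "max (4 / \<epsilon>\<^sup>2) (2 * (real k)\<^sup>2 / c) \<le> nat \<lceil>max (4 / \<epsilon>\<^sup>2) (2 * (real k)\<^sup>2 / c)\<rceil>"
        by (rule real_nat_ceiling_ge)
      ultimately show "k \<le> card V" "?n \<ge> 4 / \<epsilon>\<^sup>2" "?n > 2 * (real k)\<^sup>2 / c" by linarith+
    qed
    have n0: "?n > 0" using n(1) k by simp
    define h where "h u v = (of_bool ((u, v) \<in> H) :: real)" for u v
    have h01: "0 \<le> h x y \<and> h x y \<le> 1" for x y by (simp add: h_def)
    have HV: "H \<subseteq> V \<times> V" using HT TV by auto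
    have finH: "finite H" and finT: "finite T" using HV TV fin by (auto intro: finite_subset)
    have hsum: "(\<Sum>x\<in>A. \<Sum>y\<in>B. h x y) = card (H \<inter> A \<times> B)" if "finite A" "finite B" for A B
    proof -
      have "(\<Sum>x\<in>A. \<Sum>y\<in>B. h x y) = (\<Sum>p\<in>A \<times> B. of_bool (p \<in> H))"
        by (simp add: h_def sum.cartesian_product split_def)
      also have "\<dots> = card ((A \<times> B) \<inter> H)" using that by simp
      finally show ?thesis by (simp add: Int_commute)
    qed
    obtain \<phi> where \<phi>: "\<And>x. x \<in> V \<Longrightarrow> \<phi> x < M"
      and cut: "\<And>A B. A \<subseteq> V \<Longrightarrow> B \<subseteq> V \<Longrightarrow>
        \<bar>\<Sum>x\<in>A. \<Sum>y\<in>B. h x y - block_avg2 V \<phi> h x y\<bar> \<le> \<eta> * (card V)\<^sup>2"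
      using weak_regularity[OF fin, of h \<eta>] h01 \<eta> unfolding M_def by blast
    define W where "W = block_avg2 V \<phi> h"
    have W01: "0 \<le> W x y \<and> W x y \<le> 1" for x y
      unfolding W_def using block_avg2_bounds[OF fin h01] by simp
    have cut': "(\<Sum>x\<in>A. \<Sum>y\<in>B. W x y - h x y) \<le> \<eta> * (card V)\<^sup>2" if "A \<subseteq> V" "B \<subseteq> V" for A B
      using cut[OF that] unfolding W_def by (simp add: sum_subtractf)
    define Bl where "Bl x = {x' \<in> V. \<phi> x = \<phi> x'}" for x
    \<comment> \<open>Quasirandomness says nothing useful about tiny blocks. There are at most
      \<open>M\<close> of them, so discarding them loses at most e n vertices.\<close>
    define Z where "Z = {x \<in> V. real (card (Bl x)) < e * ?n / M}"
    have cZ: "real (card Z) \<le> e * ?n"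
    proof -
      have "Z \<subseteq> (\<Union>i<M. {x \<in> Z. \<phi> x = i})" using \<phi> by (auto simp: Z_def)
      then have "card Z \<le> card (\<Union>i<M. {x \<in> Z. \<phi> x = i})"
        using fin by (intro card_mono) (auto simp: Z_def)
      also have "\<dots> \<le> (\<Sum>i<M. card {x \<in> Z. \<phi> x = i})" by (rule card_UN_le) simp
      finally have "real (card Z) \<le> (\<Sum>i<M. real (card {x \<in> Z. \<phi> x = i}))"
        by (metis of_nat_mono of_nat_sum)
      also have "\<dots> \<le> (\<Sum>i<M. e * ?n / M)"
      proof (rule sum_mono)
        fix i
        show "real (card {x \<in> Z. \<phi> x = i}) \<le> e * ?n / M"
        proof (cases "{x \<in> Z. \<phi> x = i} = {}")
          case True
          then show ?thesis unfolding True using e by simp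
        next
          case False
          then obtain x where x: "x \<in> Z" "\<phi> x = i" by auto
          have "card {x \<in> Z. \<phi> x = i} \<le> card (Bl x)"
            using fin x by (intro card_mono) (auto simp: Bl_def Z_def)
          then show ?thesis using x by (simp add: Z_def)
        qed
      qed
      also have "\<dots> = e * ?n" using M by simp
      finally show ?thesis .
    qed
    have Wle: "W x y \<le> 1/2 + e" if x: "x \<in> V - Z" and y: "y \<in> V - Z" for x y
    proof -
      let ?b = "real (card (Bl x)) * real (card (Bl y))"
      have fb: "finite (Bl x)" "finite (Bl y)" "Bl x \<subseteq> V" "Bl y \<subseteq> V" using fin by (auto simp: Bl_def)
      have "e * ?n / M \<le> real (card (Bl x))" "e * ?n / M \<le> real (card (Bl y))"
        using x y by (auto simp: Z_def)
      then have "(e * ?n / M) * (e * ?n / M) \<le> ?b" using e by (intro mult_mono) auto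
      then have "e * ((e * ?n / M) * (e * ?n / M)) \<le> e * ?b" using e by (intro mult_left_mono) auto
      then have db: "\<delta> * ?n\<^sup>2 \<le> e * ?b"
        by (simp add: \<delta>_def power2_eq_square power3_eq_cube mult_ac)
      have "0 < e * ?n / M" using e n0 M by simp
      then have b0: "0 < ?b" using x y by (intro mult_pos_pos) (auto simp: Z_def)
      have "W x y = card (H \<inter> Bl x \<times> Bl y) / ?b"
        unfolding W_def block_avg2_eq using hsum[OF fb(1,2)] by (simp add: Bl_def)
      also have "\<dots> \<le> card (T \<inter> Bl x \<times> Bl y) / ?b"
        using HT finT b0 by (intro divide_right_mono of_nat_mono card_mono) auto
      also have "\<dots> \<le> (?b / 2 + e * ?b) / ?b"
        using qr[unfolded quasirandom_def, rule_format, OF fb(3,4)] db b0 by (intro divide_right_mono) linarith+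
      also have "\<dots> = 1/2 + e" using b0 by (simp only: add_divide_distrib) auto
      finally show ?thesis .
    qed
    define S where "S x y \<longleftrightarrow> W x y \<ge> e" for x y
    let ?S = "{(x, y) \<in> V \<times> V. S x y}"
    define \<kappa> where "\<kappa> = 1/2 + e"
    \<comment> \<open>Averaging preserves the total weight. Four losses of e n^2 arise: the excess
      of \<open>\<kappa>\<close> over 1/2, the pairs below the threshold \<open>e\<close>, and
      \<open>Z\<close> in rows and in columns. Solving for the size of the support doubles them to 8
      e = \<open>\<epsilon>\<close>.\<close>
    have cS: "real (card ?S) \<ge> (1/2 + \<epsilon>) * (card V)\<^sup>2"
    proof -
      have "(1/4 + \<epsilon>) * ?n\<^sup>2 \<le> (\<Sum>x\<in>V. \<Sum>y\<in>V. h x y)"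
        using hsum[OF fin fin] H HV by (simp add: Int_absorb2)
      also have "\<dots> = (\<Sum>x\<in>V. \<Sum>y\<in>V. W x y)"
        using sum_block_avg2[OF fin, of \<phi> "\<lambda>_ _. 1" h] by (simp add: W_def)
      also have "\<dots> \<le> (\<Sum>x\<in>V. \<Sum>y\<in>V. (\<kappa> * of_bool (S x y) + e) + (of_bool (x \<in> Z) + of_bool (y \<in> Z)))"
      proof (intro sum_mono)
        fix x y assume xy: "x \<in> V" "y \<in> V"
        show "W x y \<le> (\<kappa> * of_bool (S x y) + e) + (of_bool (x \<in> Z) + of_bool (y \<in> Z))"
        proof (cases "x \<in> Z \<or> y \<in> Z")
          case True
          have "0 \<le> \<kappa> * of_bool (S x y) + e" using e by (simp add: \<kappa>_def)
          moreover have "(1::real) \<le> of_bool (x \<in> Z) + of_bool (y \<in> Z)" using True by auto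
          ultimately show ?thesis using W01[of x y] by linarith
        next
          case False
          then show ?thesis using Wle[of x y] xy e by (cases "S x y") (auto simp: S_def \<kappa>_def)
        qed
      qed
      also have "\<dots> = \<kappa> * (\<Sum>x\<in>V. \<Sum>y\<in>V. of_bool (S x y)) + e * ?n\<^sup>2 + 2 * (?n * card Z)"
      proof -
        have "V \<inter> Z = Z" by (auto simp: Z_def)
        then show ?thesis
          using fin by (simp add: sum.distrib power2_eq_square algebra_simps flip: sum_distrib_left sum_distrib_right)
      qed
      also have "(\<Sum>x\<in>V. \<Sum>y\<in>V. of_bool (S x y)) = real (card ?S)"
      proof -
        have "(\<Sum>x\<in>V. \<Sum>y\<in>V. of_bool (S x y)) = (\<Sum>p\<in>V \<times> V. of_bool (S (fst p) (snd p)) :: real)"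
          by (simp add: sum.cartesian_product split_def)
        also have "\<dots> = real (card {p \<in> V \<times> V. S (fst p) (snd p)})"
          using fin by (simp add: Int_def)
        also have "{p \<in> V \<times> V. S (fst p) (snd p)} = ?S" by auto
        finally show ?thesis .
      qed
      finally have 1: "(1/4 + \<epsilon>) * ?n\<^sup>2 \<le> \<kappa> * card ?S + e * ?n\<^sup>2 + 2 * (?n * card Z)" .
      have "card ?S \<le> card (V \<times> V)" using fin by (intro card_mono) auto
      then have "real (card ?S) \<le> real (card V * card V)"
        unfolding card_cartesian_product by (rule of_nat_mono)
      then have 2: "e * real (card ?S) \<le> e * ?n\<^sup>2"
        using e by (intro mult_left_mono) (auto simp: power2_eq_square)
      have 3: "?n * card Z \<le> e * ?n\<^sup>2"
        using mult_left_mono[OF cZ, of ?n] by (simp add: power2_eq_square mult_ac)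
      have "(1/4 + \<epsilon>) * ?n\<^sup>2 \<le> card ?S / 2 + 4 * (e * ?n\<^sup>2)"
        using 1 2 3 by (simp only: \<kappa>_def distrib_right)
      then show ?thesis by (simp add: e_def algebra_simps)
    qed
    let ?s = "\<lambda>x y. of_bool (S x y) :: real"
    have "c * ?n ^ k = e ^ k * ((\<epsilon>/2) ^ 5 / 8 * ?n) ^ k"
      unfolding c_def by (simp only: power_mult_distrib mult.assoc)
    also have "\<dots> \<le> e ^ k * (\<Sum>x\<in>V. kernel_pow V ?s k x x)"
      using closed_walk_supersaturation[OF fin k \<epsilon> n(2) cS] e by (intro mult_left_mono) auto
    also have "\<dots> = (\<Sum>x\<in>V. e ^ k * kernel_pow V ?s k x x)" by (simp add: sum_distrib_left)
    also have "\<dots> \<le> (\<Sum>x\<in>V. kernel_pow V W k x x)"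
      using e W01 by (intro sum_mono kernel_pow_mono) (auto simp: S_def)
    also have "\<dots> \<le> (\<Sum>x\<in>V. kernel_pow V h k x x) + k * \<eta> * card V ^ k"
      by (rule closed_walk_counting[OF fin k h01 W01 cut'])
    finally have "c / 2 * ?n ^ k \<le> (\<Sum>x\<in>V. kernel_pow V h k x x)"
      using k by (simp add: \<eta>_def)
    moreover have "(real k)\<^sup>2 * ?n ^ (k - 1) < c / 2 * ?n ^ k"
    proof -
      have "(real k)\<^sup>2 < c / 2 * ?n" using n(3) c by (simp add: field_simps)
      then have "(real k)\<^sup>2 * ?n ^ (k - 1) < c / 2 * ?n * ?n ^ (k - 1)"
        using n0 by (intro mult_strict_right_mono) auto
      also have "\<dots> = c / 2 * ?n ^ k" using k by (simp add: power_eq_if)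
      finally show ?thesis .
    qed
    ultimately have "(\<Sum>x\<in>V. kernel_pow V h k x x) > (real k)\<^sup>2 * ?n ^ (k - 1)" by linarith
    then show ?thesis using k n(1) unfolding h_def by (intro closed_walks_give_cycle[OF fin]) auto
  qed
  show ?thesis
    by (rule exI[of _ \<delta>], rule conjI[OF \<delta>], rule exI[of _ N], intro allI impI)
      (rule main, assumption+)
qed

section \<open>Decomposing complete graphs into cycles\<close>

text \<open>A decomposition in the form that is easiest to verify: every edge is covered, and the
  number of cycles is at most what an exact decomposition has. Together these force every edge to be
  covered exactly once.\<close>

definition cycle_system :: "nat \<Rightarrow> 'a set \<Rightarrow> 'a list set \<Rightarrow> bool" where
  "cycle_system k V C \<longleftrightarrow> finite V \<and> finite C \<and> 2 * k * card C \<le> card V * (card V - 1) \<and>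
     (\<forall>ws\<in>C. length ws = k \<and> distinct ws \<and> set ws \<subseteq> V) \<and>
     (\<forall>u\<in>V. \<forall>v\<in>V. u \<noteq> v \<longrightarrow> (\<exists>ws\<in>C. \<exists>j<k. {u, v} = {ws ! j, ws ! (Suc j mod k)}))"

lemma cycle_system_map:
  assumes C: "cycle_system k V C" and f: "bij_betw f V V'"
  shows "cycle_system k V' (map f ` C)"
proof -
  have inj: "inj_on f V" and im: "f ` V = V'" using f by (auto simp: bij_betw_def)
  have C': "finite V" "finite C" "2 * k * card C \<le> card V * (card V - 1)"
    "\<And>ws. ws \<in> C \<Longrightarrow> length ws = k \<and> distinct ws \<and> set ws \<subseteq> V"
    "\<And>u v. u \<in> V \<Longrightarrow> v \<in> V \<Longrightarrow> u \<noteq> v \<Longrightarrow> \<exists>ws\<in>C. \<exists>j<k. {u, v} = {ws ! j, ws ! (Suc j mod k)}"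
    using C unfolding cycle_system_def by auto
  have "card V' = card V" using f by (simp add: bij_betw_same_card)
  moreover have "card (map f ` C) \<le> card C" using C'(2) by (rule card_image_le)
  then have "2 * k * card (map f ` C) \<le> 2 * k * card C" by simp
  then have "2 * k * card (map f ` C) \<le> card V * (card V - 1)" using C'(3) by (rule le_trans)
  moreover have "\<exists>ws\<in>map f ` C. \<exists>j<k. {u, v} = {ws ! j, ws ! (Suc j mod k)}"
    if uv: "u \<in> V'" "v \<in> V'" "u \<noteq> v" for u v
  proof -
    obtain u' v' where uv': "u = f u'" "v = f v'" "u' \<in> V" "v' \<in> V" using uv im by auto
    then obtain ws j where ws: "ws \<in> C" "j < k" "{u', v'} = {ws ! j, ws ! (Suc j mod k)}"
      using C'(5)[of u' v'] uv by blast
    have "{u, v} = f ` {u', v'}" using uv' by simp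
    also have "\<dots> = {map f ws ! j, map f ws ! (Suc j mod k)}"
      using ws C'(4)[OF ws(1)] by simp
    finally show ?thesis using ws by blast
  qed
  moreover have "distinct (map f ws) \<and> set (map f ws) \<subseteq> V'" if "ws \<in> C" for ws
    using C'(4)[OF that] inj im by (auto simp: distinct_map intro: inj_on_subset)
  ultimately show ?thesis
    unfolding cycle_system_def using C'(1,2,4) im by auto
qed

section \<open>Cyclic decompositions from base cycles\<close>

lemma eq_mod_of_dvd_diff: "n dvd (a - b) \<Longrightarrow> a mod n = b mod n" for a b n :: int
  by (simp add: mod_eq_dvd_iff)

text \<open>The method of differences: the \<open>p\<close> base cycles are translated by all
  residues. Since n = 2kp + 1, every nonzero residue is one of 1, ..., kp up to sign, so it suffices
  that the base cycles realise these differences.\<close>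

lemma cyclic_cycle_system:
  fixes s :: "nat \<Rightarrow> nat \<Rightarrow> int"
  assumes n: "n = 2 * k * p + 1" and k: "k > 0"
    and inj: "\<And>q i j. q < p \<Longrightarrow> i < k \<Longrightarrow> j < k \<Longrightarrow> i \<noteq> j \<Longrightarrow> \<not> int n dvd s q i - s q j"
    and cover: "\<And>d. 1 \<le> d \<Longrightarrow> d \<le> int (k * p) \<Longrightarrow>
      \<exists>q<p. \<exists>j<k. int n dvd s q (Suc j mod k) - s q j - d \<or> int n dvd s q (Suc j mod k) - s q j + d"
  shows "\<exists>C. cycle_system k {0..<int n} C"
proof -
  define cyc where "cyc q t = map (\<lambda>j. (s q j + t) mod int n) [0..<k]" for q t
  define C where "C = (\<lambda>(q, t). cyc q t) ` ({..<p} \<times> {0..<int n})"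
  have n0: "int n > 0" by (simp only: n)
  have "card C \<le> card ({..<p} \<times> {0..<int n})" unfolding C_def by (rule card_image_le) auto
  then have "card C \<le> p * n" by (simp add: card_cartesian_product)
  then have "2 * k * card C \<le> 2 * k * (p * n)" by (rule mult_le_mono2)
  also have "\<dots> = n * (n - 1)" by (simp add: n algebra_simps)
  also have "\<dots> = card {0..<int n} * (card {0..<int n} - 1)" by simp
  finally have c: "2 * k * card C \<le> card {0..<int n} * (card {0..<int n} - 1)" .
  have d: "length ws = k \<and> distinct ws \<and> set ws \<subseteq> {0..<int n}" if wsC: "ws \<in> C" for ws
  proof -
    obtain q t where q: "q < p" and ws: "ws = cyc q t" using wsC by (auto simp: C_def)
    have "i = j" if "i < k" "j < k" "(s q i + t) mod int n = (s q j + t) mod int n" for i j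
    proof -
      have "int n dvd s q i - s q j" using that(3) by (simp add: mod_eq_dvd_iff)
      then show ?thesis using inj[OF q that(1,2)] by blast
    qed
    then have "inj_on (\<lambda>j. (s q j + t) mod int n) {0..<k}" by (auto simp: inj_on_def)
    then show ?thesis using n0 by (auto simp: ws cyc_def distinct_map)
  qed
  let ?cov = "\<lambda>u v. \<exists>ws\<in>C. \<exists>j<k. {u, v} = {ws ! j, ws ! (Suc j mod k)}"
  have one: "?cov u v"
    if u: "u \<in> {0..<int n}" and v: "v \<in> {0..<int n}" and d: "1 \<le> v - u" "v - u \<le> int (k * p)
      \<or> int n - (v - u) \<le> int (k * p)" for u v
  proof -
    define d where "d = (if v - u \<le> int (k * p) then v - u else int n - (v - u))"
    have d: "1 \<le> d" "d \<le> int (k * p)" using d u v by (auto simp: d_def)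
    have dvd_d: "int n dvd d - (v - u) \<or> int n dvd d + (v - u)" by (auto simp: d_def)
    obtain q j where q: "q < p" "j < k"
      and "int n dvd s q (Suc j mod k) - s q j - d \<or> int n dvd s q (Suc j mod k) - s q j + d"
      using cover[OF d] by blast
    moreover let ?x = "s q (Suc j mod k) - s q j"
    have "?x - (v - u) = (?x - d) + (d - (v - u))" "?x - (v - u) = (?x + d) - (d + (v - u))"
      "?x + (v - u) = (?x + d) - (d - (v - u))" "?x + (v - u) = (?x - d) + (d + (v - u))" by auto
    ultimately have x: "int n dvd ?x - (v - u) \<or> int n dvd ?x + (v - u)"
      using dvd_d by (metis dvd_add dvd_diff)
    \<comment> \<open>The translation puts the \<open>j\<close>-th vertex on \<open>u\<close> or on
      \<open>v\<close>, according to the sign with which the difference occurs.\<close>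
    define t where "t = ((if int n dvd ?x - (v - u) then u else v) - s q j) mod int n"
    have t: "t \<in> {0..<int n}" using n0 by (simp add: t_def)
    have nth: "cyc q t ! i = (s q i + t) mod int n" if "i < k" for i using that by (simp add: cyc_def)
    have j': "Suc j mod k < k" using k by simp
    have e1: "(s q j + t) mod int n = (if int n dvd ?x - (v - u) then u else v)"
      using u v by (auto simp: t_def mod_simps)
    have e2: "(s q (Suc j mod k) + t) mod int n = (if int n dvd ?x - (v - u) then v else u)"
    proof (cases "int n dvd ?x - (v - u)")
      case True
      have "(s q (Suc j mod k) + t) mod int n = (s q (Suc j mod k) + (u - s q j)) mod int n"
        using True by (simp add: t_def mod_simps)
      also have "\<dots> = v mod int n"
        using True by (intro eq_mod_of_dvd_diff) (simp add: algebra_simps)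
      finally show ?thesis using True v by simp
    next
      case False
      have "(s q (Suc j mod k) + t) mod int n = (s q (Suc j mod k) + (v - s q j)) mod int n"
        using False by (simp add: t_def mod_simps)
      also have "\<dots> = u mod int n"
        using False x by (intro eq_mod_of_dvd_diff) (simp add: algebra_simps)
      finally show ?thesis using False u by simp
    qed
    have "{u, v} = {cyc q t ! j, cyc q t ! (Suc j mod k)}"
      using e1 e2 nth q j' by auto
    moreover have "cyc q t \<in> C" using q t by (auto simp: C_def)
    ultimately show ?thesis using q by blast
  qed
  have "?cov u v"
    if "u \<in> {0..<int n}" "v \<in> {0..<int n}" "u \<noteq> v" for u v
  proof -
    have b: "x \<le> int (k * p) \<or> int n - x \<le> int (k * p)" for x using n by (auto simp: algebra_simps)
    show ?thesis
    proof (cases "u < v")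
      case True then show ?thesis using one[of u v] that b[of "v - u"] by auto
    next
      case False
      then have "?cov v u"
        using one[of v u] that b[of "u - v"] by auto
      then show ?thesis by (simp only: insert_commute)
    qed
  qed
  then have "cycle_system k {0..<int n} C"
    unfolding cycle_system_def using c d by (auto simp: C_def)
  then show ?thesis ..
qed

section \<open>Base cycles from zigzag labellings\<close>

text \<open>A zigzag labelling of the \<open>k\<close>-cycle whose edge differences are \<open>1, \<dots>, k\<close>, except that
  \<open>k\<close> becomes \<open>k + 1\<close> when \<open>k mod 4 \<in> {1, 2}\<close>. The low labels run upwards at even positions,
  the high ones downwards at odd positions; one difference is skipped halfway and supplied by
  the closing edge.\<close>

definition zig :: "nat \<Rightarrow> nat \<Rightarrow> int" where
  "zig k j = (let b = (k + 1) div 2; \<delta> = int (b mod 2); i = j div 2 in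
     if even j then int i + (if i > 0 then \<delta> else 0)
     else int k + \<delta> - int i - (if i \<ge> b div 2 then 1 else 0))"

lemma half_decomp:
  fixes k :: nat assumes "k \<ge> 3"
  obtains b s \<delta> where "(k + 1) div 2 = b" "b = 2 * s + \<delta>" "b mod 2 = \<delta>" "b div 2 = s" "\<delta> \<le> 1" "s \<ge> 1"
    "k = 2 * b \<or> k + 1 = 2 * b"
  using assms by (intro that[of "(k + 1) div 2" "((k + 1) div 2) div 2" "((k + 1) div 2) mod 2"]) auto

lemma zig_even: "zig k (2 * i) = int i + (if i > 0 then int ((k + 1) div 2 mod 2) else 0)"
  by (simp add: zig_def)

lemma zig_odd: "zig k (2 * i + 1) = int k + int ((k + 1) div 2 mod 2) - int i
    - (if i \<ge> (k + 1) div 2 div 2 then 1 else 0)"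
  by (simp add: zig_def)

lemma zig_low_high:
  assumes k: "k \<ge> 3" and "2 * i < k" "2 * j + 1 < k"
  shows "0 \<le> zig k (2 * i)" "zig k (2 * i) < zig k (2 * j + 1)" "zig k (2 * j + 1) \<le> int k + 1"
    "2 * zig k (2 * i) \<le> int k + 1" "2 * zig k (2 * j + 1) \<ge> int k"
proof -
  obtain b s \<delta> where b: "(k + 1) div 2 = b" "b = 2 * s + \<delta>" "b mod 2 = \<delta>" "b div 2 = s" "\<delta> \<le> 1" "s \<ge> 1"
    "k = 2 * b \<or> k + 1 = 2 * b" using half_decomp[OF k] .
  have "\<delta> = 0 \<or> \<delta> = 1" using b(5) by auto
  then show "0 \<le> zig k (2 * i)" "zig k (2 * i) < zig k (2 * j + 1)" "zig k (2 * j + 1) \<le> int k + 1"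
    "2 * zig k (2 * i) \<le> int k + 1" "2 * zig k (2 * j + 1) \<ge> int k"
    unfolding zig_even zig_odd b(1,3,4) using b(2,6,7) assms(2,3) by (auto split: if_splits)
qed

lemma zig_inj:
  assumes k: "k \<ge> 3" and ij: "i < k" "j < k" "i \<noteq> j"
  shows "zig k i \<noteq> zig k j"
proof (cases "even i = even j")
  case True
  show ?thesis
  proof (cases "even i")
    case t: True
    then obtain i' j' where "i = 2 * i'" "j = 2 * j'" using True by (auto elim!: evenE)
    then show ?thesis using ij by (auto simp: zig_even)
  next
    case False
    then obtain i' j' where "i = 2 * i' + 1" "j = 2 * j' + 1" using True by (auto elim!: oddE)
    then show ?thesis using ij by (auto simp: zig_odd simp del: One_nat_def add_2_eq_Suc')
  qed
next
  case False
  then show ?thesis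
  proof (cases "even i")
    case True
    then obtain i' j' where "i = 2 * i'" "j = 2 * j' + 1" using False by (auto elim!: evenE oddE)
    then show ?thesis using zig_low_high(2)[OF k, of i' j'] ij by auto
  next
    case f: False
    then obtain i' j' where "i = 2 * i' + 1" "j = 2 * j'" using False by (auto elim!: evenE oddE)
    then show ?thesis using zig_low_high(2)[OF k, of j' i'] ij by auto
  qed
qed

lemma zig_range:
  assumes k: "k \<ge> 3" and j: "j < k"
  shows "0 \<le> zig k j" "zig k j \<le> int k + 1"
proof -
  have "0 \<le> zig k j \<and> zig k j \<le> int k + 1"
  proof (cases "even j")
    case True
    then obtain i where "j = 2 * i" by (elim evenE)
    then show ?thesis using zig_low_high(1,4)[OF k, of i 0] j k by auto
  next
    case False
    then obtain i where "j = 2 * i + 1" by (elim oddE)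
    then show ?thesis using zig_low_high(1,2,3)[OF k, of 0 i] j k by auto
  qed
  then show "0 \<le> zig k j" "zig k j \<le> int k + 1" by auto
qed

text \<open>The case distinction on \<open>even j\<close> expresses every difference as odd position
  minus even position. For odd \<open>k\<close> the closing edge joins the even positions
  \<open>k - 1\<close> and 0, which accounts for its sign.\<close>

lemma zig_edges:
  assumes k: "k \<ge> 3" and D: "1 \<le> D" "D \<le> k"
  shows "\<exists>j<k. (if even j then zig k (Suc j mod k) - zig k j else zig k j - zig k (Suc j mod k))
      = (if Suc j = k \<and> odd k then - 1 else 1) * (int D + (if D = k then int ((k + 1) div 2 mod 2) else 0))"
proof -
  obtain b s \<delta> where b: "(k + 1) div 2 = b" "b = 2 * s + \<delta>" "b mod 2 = \<delta>" "b div 2 = s" "\<delta> \<le> 1" "s \<ge> 1"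
    "k = 2 * b \<or> k + 1 = 2 * b" using half_decomp[OF k] .
  have \<delta>: "\<delta> = 0 \<or> \<delta> = 1" using b(5) by auto
  show ?thesis
  proof (cases "D = k - 2 * s")
    case False
    \<comment> \<open>The differences fall by one from each edge to the next, starting at
      \<open>k\<close> (raised to \<open>k + 1\<close> in the exceptional case), except that
      \<open>k - 2 * s\<close> is jumped over just before edge \<open>2 * s\<close>;
      \<open>m\<close> inverts this numbering.\<close>
    define m where "m = (if D > k - 2 * s then k - D else k - 1 - D)"
    have m: "int D = int k - int m - (if m \<ge> 2 * s then 1 else 0)" "m = 0 \<longleftrightarrow> D = k" "Suc m < k"
      using False D b by (auto simp: m_def)
    then have mod: "Suc m mod k = Suc m" by simp
    show ?thesis
    proof (cases "even m")
      case True
      then obtain i where i: "m = 2 * i" by (elim evenE)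
      have "zig k (2 * i + 1) - zig k (2 * i) = int D + (if D = k then int \<delta> else 0)"
        unfolding zig_even zig_odd b(1,3,4) using m i b(6) by auto
      then show ?thesis unfolding b(1,3) using m mod i by (intro exI[of _ m]) simp
    next
      case False
      then obtain i where i: "m = 2 * i + 1" by (elim oddE)
      have "zig k (2 * i + 1) - zig k (2 * (i + 1)) = int D + (if D = k then int \<delta> else 0)"
        unfolding zig_even zig_odd b(1,3,4) using m i by auto
      then show ?thesis unfolding b(1,3) using m mod i by (intro exI[of _ m]) simp
    qed
  next
    case 2: True
    have Dk: "D \<noteq> k" using 2 b k by auto
    have mod: "Suc (k - 1) mod k = 0" using k by simp
    have z0: "zig k 0 = 0" using zig_even[of k 0] by simp
    show ?thesis
    proof (cases "even k")
      case True
      then have kb: "k = 2 * b" using b(7) by presburger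
      then have "k - 1 = 2 * (b - 1) + 1" using k by simp
      then have "zig k (k - 1) = int D"
        using zig_odd[of k "b - 1"] b(2-6) kb 2 by (auto simp: b(1))
      then show ?thesis using True k mod z0 Dk by (intro exI[of _ "k - 1"]) auto
    next
      case False
      then have kb: "k + 1 = 2 * b" using b(7) by presburger
      then have "k - 1 = 2 * (b - 1)" using k by simp
      then have "zig k (k - 1) = int D"
        using zig_even[of k "b - 1"] b(2-6) kb 2 k by (auto simp: b(1) split: if_splits)
      then show ?thesis using False k mod z0 Dk by (intro exI[of _ "k - 1"]) auto
    qed
  qed
qed

lemma not_dvd_of_small: "a \<noteq> b \<Longrightarrow> \<bar>a - b\<bar> < n \<Longrightarrow> \<not> n dvd a - b" for a b n :: int
  using zdvd_not_zless[of "\<bar>a - b\<bar>" n] by auto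

text \<open>A single base cycle suffices, because the exceptional difference \<open>k + 1\<close> is
  congruent to \<open>- k\<close> modulo \<open>2 * k + 1\<close>.\<close>

lemma cycle_system_2k1:
  assumes k: "k \<ge> 3"
  shows "\<exists>C. cycle_system k {0..<int (2 * k + 1)} C"
proof -
  define n where "n = 2 * k * 1 + 1"
  have n: "n = 2 * k * 1 + 1" by (fact n_def)
  have "\<exists>C. cycle_system k {0..<int n} C"
  proof (rule cyclic_cycle_system[OF n, of "\<lambda>_. zig k"])
    fix i j assume ij: "i < k" "j < k" "i \<noteq> j"
    show "\<not> int n dvd zig k i - zig k j"
      using zig_inj[OF k ij] zig_range[OF k ij(1)] zig_range[OF k ij(2)] k
      by (intro not_dvd_of_small) (auto simp: n)
  next
    fix d :: int assume d: "1 \<le> d" "d \<le> int (k * 1)"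
    define D where "D = nat d"
    have D: "1 \<le> D" "D \<le> k" "d = int D" using d by (auto simp: D_def)
    let ?d = "int D + (if D = k then int ((k + 1) div 2 mod 2) else 0)"
    obtain j where j: "j < k" and
      "(if even j then zig k (Suc j mod k) - zig k j else zig k j - zig k (Suc j mod k))
      = (if Suc j = k \<and> odd k then - 1 else 1) * ?d"
      using zig_edges[OF k D(1,2)] by blast
    then have x: "zig k (Suc j mod k) - zig k j = ?d \<or> zig k (Suc j mod k) - zig k j = - ?d"
      by (auto split: if_splits)
    have "?d = d \<or> (d = int k \<and> ?d = int k + 1)" using D by auto
    then have "int n dvd zig k (Suc j mod k) - zig k j - d \<or> int n dvd zig k (Suc j mod k) - zig k j + d"
    proof
      assume "?d = d"
      then show ?thesis using x by (elim disjE) simp_all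
    next
      assume a: "d = int k \<and> ?d = int k + 1"
      from x show ?thesis
      proof
        assume "zig k (Suc j mod k) - zig k j = ?d"
        then have "zig k (Suc j mod k) - zig k j + d = int n" using a n by simp
        then show ?thesis by (metis dvd_refl)
      next
        assume "zig k (Suc j mod k) - zig k j = - ?d"
        then have "zig k (Suc j mod k) - zig k j - d = - int n" using a n by simp
        then show ?thesis by (metis dvd_minus_iff dvd_refl)
      qed
    qed
    then show "\<exists>q<1::nat. \<exists>j<k. int n dvd zig k (Suc j mod k) - zig k j - d \<or> int n dvd zig k (Suc j mod k) - zig k j + d"
      using j by auto
  qed (use k in auto)
  then show ?thesis by (simp add: n)
qed

text \<open>For even \<open>k\<close> all edges, including the closing one, join a low label to a
  high one, so raising the high labels by q k raises all differences by q k. If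
  \<open>\<delta>\<close> is 1, this yields q k + k + 1 in place of q k + k. Cycles with odd
  \<open>q\<close> are therefore reflected: they yield q k in place of q k + 1, and the defects of
  neighbouring cycles cancel.\<close>

lemma cycle_system_even:
  assumes k: "k \<ge> 3" "even k"
  shows "\<exists>C. cycle_system k {0..<int (2 * k * p + 1)} C"
proof -
  define \<delta> where "\<delta> = (k + 1) div 2 mod 2"
  have \<delta>: "\<delta> = 0 \<or> \<delta> = 1" by (auto simp: \<delta>_def)
  define n where "n = 2 * k * p + 1"
  define up where "up q \<longleftrightarrow> \<delta> = 0 \<or> even q" for q :: nat
  define Q where "Q q = int (q * k)" for q
  define hi where "hi q j = (if up q then zig k j + Q q else Q q + int k + 1 - zig k j)" for q j
  define s where "s q j = (if odd j then hi q j else if up q then zig k j else - zig k j)" for q j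
  have low: "0 \<le> zig k j" "2 * zig k j \<le> int k + 1" if "even j" "j < k" for j
    using that zig_low_high(1,4)[OF k(1), of "j div 2" 0] k by auto
  have high: "2 * zig k j \<ge> int k" "zig k j \<le> int k + 1" if "odd j" "j < k" for j
    using that zig_low_high(3,5)[OF k(1), of 0 "j div 2"] k by (auto elim!: oddE)
  have lh: "zig k i < zig k j" if "even i" "odd j" "i < k" "j < k" for i j
    using that zig_low_high(2)[OF k(1), of "i div 2" "j div 2"] by (auto elim!: oddE)
  have qk: "int (q * k) + int k \<le> int (k * p)" if "q < p" for q
  proof -
    have "(q + 1) * k \<le> p * k" using that by (intro mult_le_mono1) simp
    then have "q * k + k \<le> k * p" by (simp add: mult.commute)
    then show ?thesis by (metis of_nat_add of_nat_mono)
  qed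
  have edge: "\<exists>j<k. s q (Suc j mod k) - s q j = x \<or> s q (Suc j mod k) - s q j = - x"
    if D: "1 \<le> D" "D \<le> k" and x: "x = (let D' = int D + (if D = k then int \<delta> else 0) in
      if up q then Q q + D' else Q q + int k + 1 - D')" for D q x
  proof -
    let ?D = "int D + (if D = k then int \<delta> else 0)"
    obtain j where j: "j < k" and
      z: "(if even j then zig k (Suc j mod k) - zig k j else zig k j - zig k (Suc j mod k)) = ?D"
      using zig_edges[OF k(1) D] k(2) unfolding \<delta>_def by auto
    have par: "even (Suc j mod k) \<longleftrightarrow> odd j" using j k by (cases "Suc j = k") auto
    show ?thesis
      using z par by (intro exI[of _ j] conjI j, cases "even j"; cases "up q")
        (auto simp: s_def hi_def x Let_def)
  qed
  have "\<exists>C. cycle_system k {0..<int n} C"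
  proof (rule cyclic_cycle_system[OF n_def, of s])
    fix q i j assume q: "q < p" and ij: "i < k" "j < k" "i \<noteq> j"
    have ne: "zig k i \<noteq> zig k j" by (rule zig_inj[OF k(1) ij])
    have r: "0 \<le> zig k i" "zig k i \<le> int k + 1" "0 \<le> zig k j" "zig k j \<le> int k + 1"
      using zig_range[OF k(1)] ij by auto
    define P where "P = int (k * p)"
    have qp: "0 \<le> Q q" "Q q + int k \<le> P" using qk[OF q] by (auto simp: Q_def P_def)
    have nn: "int n = 2 * P + 1" by (simp add: n_def P_def)
    \<comment> \<open>Reflected cycles have \<open>q \<ge> 1\<close>, which keeps their high labels
      clear of the negated low ones.\<close>
    have qk': "int k \<le> Q q" if "\<not> up q"
      using that by (cases q) (auto simp: up_def Q_def)
    show "\<not> int n dvd s q i - s q j"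
    proof (cases "even i = even j")
      case True
      then show ?thesis using ne r qp k(1)
        by (intro not_dvd_of_small) (auto simp: s_def hi_def nn)
    next
      case False
      then show ?thesis
        using r qp k(1) low[of i] low[of j] high[of i] high[of j] lh[of i j] lh[of j i] ij qk' ne
        by (intro not_dvd_of_small; cases "even i"; cases "even j"; cases "up q")
          (auto simp: s_def hi_def nn)
    qed
  next
    fix d :: int assume d: "1 \<le> d" "d \<le> int (k * p)"
    let ?goal = "\<exists>q<p. \<exists>j<k. int n dvd s q (Suc j mod k) - s q j - d \<or> int n dvd s q (Suc j mod k) - s q j + d"
    \<comment> \<open>Division with remainder in 1, ..., k instead of 0, ..., k - 1, so that
      \<open>d\<close> is \<open>Q q + e\<close>.\<close>
    define q where "q = nat ((d - 1) div int k)"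
    define e where "e = nat ((d - 1) mod int k + 1)"
    have k0: "int k > 0" using k by simp
    have m: "0 \<le> (d - 1) mod int k" "(d - 1) mod int k < int k" using k0 by auto
    then have ie: "int e = (d - 1) mod int k + 1" by (simp add: e_def)
    then have e: "1 \<le> e" "e \<le> k" using m by linarith+
    have "d - 1 = (d - 1) div int k * int k + (d - 1) mod int k" by simp
    moreover have "int q = (d - 1) div int k"
      using d k0 by (simp add: q_def pos_imp_zdiv_nonneg_iff)
    ultimately have dq: "d = Q q + int e" using ie by (simp add: Q_def)
    have QS: "Q (Suc q) = Q q + int k" for q by (simp add: Q_def)
    have q: "q < p"
    proof (rule ccontr)
      assume "\<not> q < p"
      then have "k * p \<le> q * k" by (simp add: mult.commute)
      then have "int (k * p) \<le> int (q * k)" by (rule of_nat_mono)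
      then show False using dq d(2) e(1) unfolding Q_def by linarith
    qed
    have fin: ?goal
      if q': "q' < p" and D: "1 \<le> D" "D \<le> k"
        and x: "x = (let D' = int D + (if D = k then int \<delta> else 0) in
          if up q' then Q q' + D' else Q q' + int k + 1 - D')"
        and xd: "x = d \<or> x + d = int n" for q' D x
    proof -
      obtain j where j: "j < k" "s q' (Suc j mod k) - s q' j = x \<or> s q' (Suc j mod k) - s q' j = - x"
        using edge[OF D x] by blast
      have "int n dvd s q' (Suc j mod k) - s q' j - d \<or> int n dvd s q' (Suc j mod k) - s q' j + d"
        using xd j(2) by (elim disjE) (simp_all, metis dvd_minus_iff dvd_refl minus_add_distrib uminus_add_conv_diff add.commute)
      then show ?thesis using q' j(1) by blast
    qed
    show ?goal
    proof (cases "\<delta> = 0")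
      case True
      then show ?thesis using fin[OF q e refl] dq by (simp add: up_def)
    next
      case False
      then have \<delta>1: "\<delta> = 1" using \<delta> by simp
      show ?thesis
      proof (cases "even q")
        case True
        then have u: "up q" by (simp add: up_def)
        show ?thesis
        proof (cases "e = k")
          case ek: False
          then show ?thesis using fin[OF q e refl] dq u by simp
        next
          case ek: True
          show ?thesis
          proof (cases "Suc q < p")
            case True
            \<comment> \<open>The difference missing from cycle \<open>q\<close> is the exceptional
              one of its reflected successor.\<close>
            have nu: "\<not> up (Suc q)" using \<open>even q\<close> False by (simp add: up_def)
            show ?thesis
              using fin[OF True, of k] k nu dq ek \<delta>1 by (simp add: Let_def QS)
          next
            case False
            \<comment> \<open>Without a successor, the exceptional difference k p + 1 of the last
              cycle is congruent to -k p modulo \<open>n\<close>.\<close>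
            then have "p = Suc q" using q by simp
            then show ?thesis
              using fin[OF q e refl] u dq ek \<delta>1 by (simp add: Let_def n_def Q_def algebra_simps)
          qed
        qed
      next
        case oq: False
        then have nu: "\<not> up q" using False by (simp add: up_def)
        show ?thesis
        proof (cases "e = 1")
          case True
          \<comment> \<open>The first difference of a reflected block is the exceptional one of its
            predecessor.\<close>
          obtain q' where q': "q = Suc q'" using oq by (cases q) auto
          then have "up q'" "q' < p" using oq q by (auto simp: up_def)
          then show ?thesis using fin[of q' k] q' dq True \<delta>1 k by (simp add: Let_def QS)
        next
          case e1: False
          have "1 \<le> k + 1 - e" "k + 1 - e \<le> k" "k + 1 - e \<noteq> k" "int (k + 1 - e) = int k + 1 - int e"
            using e e1 by auto
          then show ?thesis using fin[OF q, of "k + 1 - e"] nu dq by (simp add: Let_def)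
        qed
      qed
    qed
  qed (use k in auto)
  then show ?thesis by (simp add: n_def)
qed

section \<open>Commutative quasigroups with holes of size two\<close>

definition half_mod :: "int \<Rightarrow> int \<Rightarrow> int" where
  "half_mod m z = (z * ((m + 1) div 2)) mod m"

text \<open>\<open>(m + 1) div 2\<close> is the inverse of 2 modulo an odd \<open>m\<close>, so this
  is division by 2.\<close>

lemma half_mod:
  assumes "odd m" "m > 0"
  shows "0 \<le> half_mod m z" "half_mod m z < m" "m dvd 2 * half_mod m z - z"
proof -
  show "0 \<le> half_mod m z" "half_mod m z < m" using assms by (auto simp: half_mod_def)
  have "2 * ((m + 1) div 2) = m + 1" using assms by presburger
  then have eq: "2 * (z * ((m + 1) div 2)) - z = z * m" by (simp add: algebra_simps)
  have "m dvd z * ((m + 1) div 2) - half_mod m z"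
    by (simp add: half_mod_def mod_eq_dvd_iff[symmetric])
  then have "m dvd 2 * (z * ((m + 1) div 2)) - 2 * half_mod m z" by (metis dvd_mult right_diff_distrib)
  then have "m dvd z * m - (2 * (z * ((m + 1) div 2)) - 2 * half_mod m z)"
    by (rule dvd_diff[rotated]) simp
  also have "z * m - (2 * (z * ((m + 1) div 2)) - 2 * half_mod m z) = 2 * half_mod m z - z"
    using eq by simp
  finally show "m dvd 2 * half_mod m z - z" .
qed

lemma dvd_double: "odd m \<Longrightarrow> m dvd 2 * x \<longleftrightarrow> m dvd x" for m x :: int
  by (simp add: coprime_dvd_mult_right_iff)

lemma half_mod_eqI:
  assumes "odd m" "m > 0" "0 \<le> y" "y < m" "m dvd z - 2 * y"
  shows "half_mod m z = y"
proof -
  have "m dvd (2 * half_mod m z - z) + (z - 2 * y)" using half_mod(3)[OF assms(1,2)] assms(5) by (rule dvd_add)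
  then have "m dvd 2 * (half_mod m z - y)" by (simp add: algebra_simps)
  then have "m dvd half_mod m z - y" using dvd_double[OF assms(1)] by blast
  then show ?thesis using half_mod(1,2)[OF assms(1,2), of z] assms(3,4)
    by (metis mod_eq_dvd_iff mod_pos_pos_trivial)
qed

lemma half_mod_add_neq:
  assumes "odd m" "m > 0" "0 \<le> x" "x < m" "0 \<le> y" "y < m" "x \<noteq> y"
  shows "half_mod m (x + y) \<noteq> x" "half_mod m (x + y) \<noteq> y"
proof -
  have nd: "\<not> m dvd x - y" using assms by (intro not_dvd_of_small) auto
  show "half_mod m (x + y) \<noteq> x"
  proof
    assume "half_mod m (x + y) = x"
    then have "m dvd x - y" using half_mod(3)[OF assms(1,2), of "x + y"] by simp
    then show False using nd by blast
  qed
  show "half_mod m (x + y) \<noteq> y"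
  proof
    assume "half_mod m (x + y) = y"
    then have "m dvd - (x - y)" using half_mod(3)[OF assms(1,2), of "x + y"] by simp
    then show False using nd by (simp only: dvd_minus_iff) 
  qed
qed

text \<open>A commutative quasigroup with holes of size two: the first component is the hole, and
  products are taken of elements of distinct holes only.\<close>

definition holey_quasigroup :: "int \<Rightarrow> (int \<times> int \<Rightarrow> int \<times> int \<Rightarrow> int \<times> int) \<Rightarrow> bool" where
  "holey_quasigroup p f \<longleftrightarrow> (\<forall>X \<in> {0..<p} \<times> {0, 1}. \<forall>Y \<in> {0..<p} \<times> {0, 1}. fst X \<noteq> fst Y \<longrightarrow>
     f X Y = f Y X \<and> f X Y \<in> {0..<p} \<times> {0, 1} \<and> f X Y \<noteq> X \<and> f X Y \<noteq> Y \<and>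
     (\<exists>W \<in> {0..<p} \<times> {0, 1}. fst W \<noteq> fst X \<and> f X W = Y))"

text \<open>The product of the idempotent half-sum quasigroup modulo \<open>m\<close> with addition
  modulo 2; idempotency of the first factor gives the holes. Solving (x + w)/2 = y leads to w = 2y -
  x.\<close>

lemma holey_quasigroup_odd:
  assumes m: "odd m" "m > 0"
  shows "\<exists>f. holey_quasigroup m f"
proof -
  define f where "f X Y = (half_mod m (fst X + fst Y), (snd X + snd Y) mod 2)" for X Y :: "int \<times> int"
  have "holey_quasigroup m f"
    unfolding holey_quasigroup_def
  proof (intro ballI impI conjI)
    fix X Y :: "int \<times> int" assume X: "X \<in> {0..<m} \<times> {0, 1}" and Y: "Y \<in> {0..<m} \<times> {0, 1}" and ne: "fst X \<noteq> fst Y"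
    obtain x a y b where XY: "X = (x, a)" "Y = (y, b)" by (cases X; cases Y)
    have xy: "0 \<le> x" "x < m" "0 \<le> y" "y < m" "x \<noteq> y" "a = 0 \<or> a = 1" "b = 0 \<or> b = 1"
      using X Y ne by (auto simp: XY)
    show "f X Y = f Y X" by (simp add: f_def add.commute)
    show "f X Y \<in> {0..<m} \<times> {0, 1}" using half_mod[OF m] by (auto simp: f_def)
    show "f X Y \<noteq> X" "f X Y \<noteq> Y" using half_mod_add_neq[OF m xy(1-5)] by (auto simp: f_def XY)
    let ?W = "((2 * y - x) mod m, (a + b) mod 2)"
    have "m dvd (2 * y - x) mod m - (2 * y - x)" by (simp add: mod_eq_dvd_iff[symmetric])
    then have "half_mod m (x + (2 * y - x) mod m) = y"
      using xy by (intro half_mod_eqI[OF m]) (auto simp: algebra_simps)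
    moreover have "(2 * y - x) mod m \<noteq> x"
    proof
      assume "(2 * y - x) mod m = x"
      then have "m dvd (2 * y - x) - x" by (metis mod_eq_dvd_iff mod_mod_trivial)
      then have "m dvd 2 * (y - x)" by (simp add: algebra_simps)
      then have "m dvd y - x" using dvd_double[OF m(1)] by blast
      then show False using xy not_dvd_of_small[of y x m] by auto
    qed
    ultimately show "\<exists>W \<in> {0..<m} \<times> {0, 1}. fst W \<noteq> fst X \<and> f X W = Y"
      using m xy by (intro bexI[of _ ?W]) (auto simp: f_def XY)
  qed
  then show ?thesis by blast
qed

text \<open>A prolongation of the odd case by a new hole with first component \<open>m\<close>.
  Mixed products (second components 0 and 1) at offset 2 or -2 are redirected into the new hole,
  which displaces (x + 1, 1) and (x - 1, 1) from the row of x. In the rows of (x, 1) the products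
  with the new hole restore them. In the rows of (x, 0) they come from the products (0, 0) at the
  same offsets, whose second component is switched to 1; what these displace is then supplied by the
  new hole.\<close>

lemma holey_quasigroup_even:
  assumes m: "odd m" "m \<ge> 3"
  shows "\<exists>f. holey_quasigroup (m + 1) f"
proof -
  have m0: "m > 0" using m by simp
  define g where "g c y b = ((y + (if c = b then - 1 else 1)) mod m, b)" for c y b :: int
  define f where "f = (\<lambda>(x, a) (y, b :: int).
    if x = m then g a y b else if y = m then g b x a
    else if a = 0 \<and> b = 0 then (half_mod m (x + y), if m dvd y - x - 2 \<or> m dvd y - x + 2 then 1 else 0)
    else if a = 1 \<and> b = 1 then (half_mod m (x + y), 0)
    else if m dvd (if a = 0 then y - x else x - y) + 2 then (m, 0)
    else if m dvd (if a = 0 then y - x else x - y) - 2 then (m, 1)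
    else (half_mod m (x + y), 1 :: int))"
  have modd: "m dvd z mod m - z" "m dvd z - z mod m" for z by (simp_all add: mod_eq_dvd_iff[symmetric])
  \<comment> \<open>The last of these keeps the offsets 2 and -2 distinct modulo
    \<open>m\<close>.\<close>
  have small: "\<not> m dvd 1" "\<not> m dvd 2" "\<not> m dvd 4"
  proof -
    show "\<not> m dvd 1" "\<not> m dvd 2" using m zdvd_imp_le[of m 1] zdvd_imp_le[of m 2] by auto
    show "\<not> m dvd 4" using dvd_double[OF m(1), of 2] \<open>\<not> m dvd 2\<close> by simp
  qed
  have shift: "(x + c) mod m \<noteq> x" if "\<not> m dvd c" for x c
  proof
    assume "(x + c) mod m = x"
    then have "m dvd (x + c) - x" by (metis mod_eq_dvd_iff mod_mod_trivial)
    then show False using that by simp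
  qed
  have bnd: "0 \<le> z mod m" "z mod m < m" for z using m0 by auto
  have bnd': "0 \<le> half_mod m z" "half_mod m z < m" for z using half_mod[OF m(1) m0] by auto
  have hole: "half_mod m (x + (2 * y - x) mod m) = y" if "0 \<le> y" "y < m" for x y
    using that modd(1)[of "2 * y - x"] by (intro half_mod_eqI[OF m(1) m0]) (auto simp: algebra_simps)
  have hne: "(2 * y - x) mod m \<noteq> x" if "0 \<le> y" "y < m" "0 \<le> x" "x < m" "x \<noteq> y" for x y
  proof
    assume "(2 * y - x) mod m = x"
    then have "m dvd (2 * y - x) - x" by (metis mod_eq_dvd_iff mod_mod_trivial)
    then have "m dvd 2 * (y - x)" by (simp add: algebra_simps)
    then have "m dvd y - x" using dvd_double[OF m(1)] by blast
    then show False using that not_dvd_of_small[of y x m] by auto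
  qed
  have dbl: "m dvd (2 * y - x) mod m - x + 2 * c \<longleftrightarrow> m dvd y - x + c" for x y c
  proof -
    have "m dvd (2 * y - x) mod m - x + 2 * c \<longleftrightarrow> m dvd (2 * y - x) - x + 2 * c"
      using modd(1)[of "2 * y - x"] dvd_add_right_iff[of m "(2 * y - x) mod m - (2 * y - x)" "(2 * y - x) - x + 2 * c"]
      by (simp add: algebra_simps)
    also have "(2 * y - x) - x + 2 * c = 2 * (y - x + c)" by simp
    finally show ?thesis using dvd_double[OF m(1)] by blast
  qed
  have dbl2: "m dvd (2 * y - x) mod m - x + 2 \<longleftrightarrow> m dvd y - x + 1"
    "m dvd (2 * y - x) mod m - x - 2 \<longleftrightarrow> m dvd y - x - 1" for x y
    using dbl[of y x 1] dbl[of y x "-1"] by auto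
  have dbl3: "m dvd x - (2 * y - x) mod m + 2 \<longleftrightarrow> m dvd y - x - 1"
    "m dvd x - (2 * y - x) mod m - 2 \<longleftrightarrow> m dvd y - x + 1" for x y
    using dbl2[of y x] dvd_minus_iff[of m "(2 * y - x) mod m - x + 2"] dvd_minus_iff[of m "(2 * y - x) mod m - x - 2"]
    by (auto simp: algebra_simps)
  have eqmod: "(x + c) mod m = y" if "m dvd y - x - c" "0 \<le> y" "y < m" for x y c
  proof -
    have "m dvd y - (x + c)" using that(1) by (simp add: algebra_simps)
    then have "y mod m = (x + c) mod m" by (simp only: mod_eq_dvd_iff)
    then show ?thesis using that by simp
  qed
  have shift2: "m dvd (x + c) mod m - x - c" for x c
    using modd(1)[of "x + c"] by (simp add: algebra_simps)
  have comm: "f (x, a) (y, b) = f (y, b) (x, a)" if "a = 0 \<or> a = 1" "b = 0 \<or> b = 1" "x \<noteq> y" for x y a b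
  proof -
    have "(m dvd y - x - 2) = (m dvd x - y + 2)" "(m dvd y - x + 2) = (m dvd x - y - 2)"
      using dvd_minus_iff[of m "y - x - 2"] dvd_minus_iff[of m "y - x + 2"] by (auto simp: algebra_simps)
    then show ?thesis using that by (auto simp: f_def add.commute)
  qed
  have "holey_quasigroup (m + 1) f"
    unfolding holey_quasigroup_def
  proof (intro ballI impI conjI)
    fix X Y :: "int \<times> int" assume X: "X \<in> {0..<m + 1} \<times> {0, 1}" and Y: "Y \<in> {0..<m + 1} \<times> {0, 1}" and ne: "fst X \<noteq> fst Y"
    obtain x a y b where XY: "X = (x, a)" "Y = (y, b)" by (cases X; cases Y)
    have xy: "0 \<le> x" "x \<le> m" "0 \<le> y" "y \<le> m" "x \<noteq> y" and ab: "a = 0 \<or> a = 1" "b = 0 \<or> b = 1"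
      using X Y ne by (auto simp: XY)
    show "f X Y = f Y X" using comm[of a b x y] xy ab by (auto simp: XY)
    show "f X Y \<in> {0..<m + 1} \<times> {0, 1}"
      using bnd bnd' ab m0 by (auto simp: f_def XY g_def less_imp_le zle_add1_eq_le)
    have "half_mod m (x + y) \<noteq> x \<and> half_mod m (x + y) \<noteq> y" if "x \<noteq> m" "y \<noteq> m"
      using half_mod_add_neq[OF m(1) m0, of x y] xy that by auto
    moreover have "(z + 1) mod m \<noteq> z" "(z - 1) mod m \<noteq> z" for z
      using shift[of 1 z] shift[of "-1" z] small by auto
    moreover have "z mod m \<noteq> m" for z using bnd(2)[of z] by auto
    ultimately show "f X Y \<noteq> X" "f X Y \<noteq> Y"
      using xy by (auto simp: f_def XY g_def)
    have "\<exists>w c. 0 \<le> w \<and> w \<le> m \<and> (c = 0 \<or> c = 1) \<and> w \<noteq> x \<and> f (x, a) (w, c) = (y, b)"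
    proof -
      consider "x = m" | "y = m" "x < m" | "x < m" "y < m" using xy by linarith
      then show ?thesis
      proof cases
        case 1
        let ?c = "if a = b then 1 else -1 :: int"
        have y: "y < m" using xy 1 by simp
        have "((y + ?c) mod m - ?c) mod m = y mod m" by (simp add: mod_simps)
        then have "((y + ?c) mod m + (if a = b then - 1 else 1)) mod m = y" using y xy by (auto split: if_splits)
        then show ?thesis using 1 bnd[of "y + ?c"] ab
          by (intro exI[of _ "(y + ?c) mod m"] exI[of _ b]) (auto simp: f_def g_def)
      next
        case 2
        \<comment> \<open>A target in the new hole is attained only at a mixed product; the offset
          is 2 or -2 depending on whether \<open>a = b\<close>.\<close>
        define c where "c = (if a = b then -2 else 2 :: int)"
        have c: "\<not> m dvd c" using small by (simp add: c_def)
        obtain w where w: "0 \<le> w" "w < m" "w \<noteq> x" and d: "m dvd w - x - c"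
          using bnd shift[OF c] shift2 by blast
        then have d': "m dvd x - w + c" using dvd_minus_iff[of m "w - x - c"] by (simp add: algebra_simps)
        have n4: "\<not> m dvd w - x + c" "\<not> m dvd x - w - c"
        proof -
          have "2 * c = 4 \<or> 2 * c = - 4" by (simp add: c_def)
          then have "\<not> m dvd 2 * c" using small(3) by (metis dvd_minus_iff)
          moreover have "2 * c = (w - x + c) - (w - x - c)" "2 * c = (x - w + c) - (x - w - c)" by auto
          ultimately show "\<not> m dvd w - x + c" "\<not> m dvd x - w - c"
            using d d' by (metis dvd_diff)+
        qed
        show ?thesis
          by (rule exI[of _ w], rule exI[of _ "1 - a"])
            (use w d d' n4 ab 2 in \<open>auto simp: f_def c_def split: if_splits\<close>)
      next
        case 3
        obtain w where w: "0 \<le> w" "w < m" "w \<noteq> x" and [simp]: "half_mod m (x + w) = y"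
          and [simp]: "m dvd w - x + 2 \<longleftrightarrow> m dvd y - x + 1" "m dvd w - x - 2 \<longleftrightarrow> m dvd y - x - 1"
            "m dvd x - w + 2 \<longleftrightarrow> m dvd y - x - 1" "m dvd x - w - 2 \<longleftrightarrow> m dvd y - x + 1"
          by (rule that[of "(2 * y - x) mod m"]) (intro bnd hne hole dbl2 dbl3; use 3 xy in simp)+
        have pm: "m dvd y - x - 1 \<Longrightarrow> (x + 1) mod m = y" "m dvd y - x + 1 \<Longrightarrow> (x - 1) mod m = y"
          using eqmod[of y x 1] eqmod[of y x "-1"] 3 xy by auto
        show ?thesis
        \<comment> \<open>For a target with the second component of X, the neighbours x + 1 and x -
          1 are reached through the new hole; all other targets here have the half-sum solution w =
          2y - x.\<close>
        proof (cases "b = 0 \<and> a = 0 \<or> b = 1 \<and> a = 1")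
          case True
          show ?thesis
          proof (cases "m dvd y - x - 1 \<or> m dvd y - x + 1")
            case e: True
            then show ?thesis
            proof
              assume "m dvd y - x - 1"
              then show ?thesis using pm(1) True 3 m0 xy
                by (intro exI[of _ m] exI[of _ "1 - a"]) (auto simp: f_def g_def)
            next
              assume "m dvd y - x + 1"
              then show ?thesis using pm(2) True 3 m0 xy
                by (intro exI[of _ m] exI[of _ a]) (auto simp: f_def g_def)
            qed
          next
            case False
            then show ?thesis using True w 3
              by (intro exI[of _ w] exI[of _ 0]) (auto simp: f_def)
          qed
        next
          case False
          then consider "a = 1" "b = 0" | "a = 0" "b = 1" using ab by auto
          then show ?thesis
          proof cases
            case 1
            then show ?thesis using w 3 by (intro exI[of _ w] exI[of _ 1]) (auto simp: f_def)
          next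
            case 2
            show ?thesis
            proof (cases "m dvd y - x - 1 \<or> m dvd y - x + 1")
              case True
              then show ?thesis using 2 w 3 by (intro exI[of _ w] exI[of _ 0]) (auto simp: f_def)
            next
              case False
              then show ?thesis using 2 w 3 by (intro exI[of _ w] exI[of _ 1]) (auto simp: f_def)
            qed
          qed
        qed
      qed
    qed
    then show "\<exists>W \<in> {0..<m + 1} \<times> {0, 1}. fst W \<noteq> fst X \<and> f X W = Y"
      unfolding XY by force
  qed
  then show ?thesis by blast
qed

lemma holey_quasigroup_exists:
  assumes "p \<ge> 3"
  shows "\<exists>f. holey_quasigroup p f"
proof (cases "odd p")
  case True
  then show ?thesis using assms holey_quasigroup_odd by simp
next
  case False
  then have "odd (p - 1)" "p - 1 \<ge> 3" using assms by presburger+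
  then show ?thesis using holey_quasigroup_even[of "p - 1"] by simp
qed

section \<open>Assembling the decomposition for odd k\<close>

type_synonym holey_vertex = "((int \<times> int) \<times> int) option"

text \<open>The point \<open>None\<close> is common to all holes: each hole then has 2 levels of
  \<open>k\<close> vertices and one more, hence \<open>2 * k + 1\<close>, the size of the cyclic
  system with one base cycle.\<close>

definition hole_verts :: "nat \<Rightarrow> int \<Rightarrow> holey_vertex set" where
  "hole_verts k h = insert None (Some ` (({h} \<times> {0, 1}) \<times> {0..<int k}))"

definition holey_verts :: "nat \<Rightarrow> int \<Rightarrow> holey_vertex set" where
  "holey_verts k p = insert None (Some ` (({0..<p} \<times> {0, 1}) \<times> {0..<int k}))"

definition level_vertex :: "nat \<Rightarrow> int \<times> int \<Rightarrow> int \<Rightarrow> holey_vertex" where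
  "level_vertex k X i = Some (X, i mod int k)"

text \<open>A zigzag between the levels \<open>X\<close> and \<open>Y\<close>, closed up through a vertex on level \<open>Z\<close>. With
  \<open>k = 2 r + 3\<close> its \<open>X\<close>--\<open>Y\<close> edges have the offsets \<open>-r, \<dots>, r\<close>; the two remaining offsets
  \<open>\<plusminus>(r + 1)\<close> occur at the edges to level \<open>Z\<close>.\<close>

definition level_cycle :: "nat \<Rightarrow> int \<times> int \<Rightarrow> int \<times> int \<Rightarrow> int \<times> int \<Rightarrow> int \<Rightarrow> holey_vertex list" where
  "level_cycle k X Y Z i = map (\<lambda>e.
     if e = k - 1 then level_vertex k Z (i + int ((k - 1) div 2))
     else if even e then level_vertex k X (i - int (e div 2))
     else level_vertex k Y (i - int ((k - 3) div 2) + int (e div 2))) [0..<k]"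

lemma level_vertex_eq: "level_vertex k X i = level_vertex k Y j \<longleftrightarrow> X = Y \<and> int k dvd i - j"
  by (auto simp: level_vertex_def mod_eq_dvd_iff)

lemma level_vertex_mod: "0 \<le> i \<Longrightarrow> i < int k \<Longrightarrow> level_vertex k X i = Some (X, i)"
  by (simp add: level_vertex_def)

lemma level_cycle_nth:
  assumes "e < k"
  shows "level_cycle k X Y Z i ! e = (if e = k - 1 then level_vertex k Z (i + int ((k - 1) div 2))
     else if even e then level_vertex k X (i - int (e div 2))
     else level_vertex k Y (i - int ((k - 3) div 2) + int (e div 2)))"
  using assms by (simp add: level_cycle_def)

lemma distinct_level_cycle:
  assumes k: "odd k" "k \<ge> 3" and XYZ: "X \<noteq> Y" "Z \<noteq> X" "Z \<noteq> Y"
  shows "distinct (level_cycle k X Y Z i)"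
proof -
  have "level_cycle k X Y Z i ! e \<noteq> level_cycle k X Y Z i ! e'" if "e < e'" "e' < k" for e e'
  proof
    assume eq: "level_cycle k X Y Z i ! e = level_cycle k X Y Z i ! e'"
    have e: "e < k" "e \<noteq> k - 1" using that by auto
    from eq that e XYZ have ne: "e' \<noteq> k - 1"
      by (auto simp: level_cycle_nth level_vertex_eq split: if_splits)
    from eq that e XYZ ne have par: "even e = even e'" and d: "int k dvd int (e div 2) - int (e' div 2)"
      by (auto simp: level_cycle_nth level_vertex_eq dvd_diff_commute split: if_splits)
    have "e div 2 \<noteq> e' div 2" using par that(1) by presburger
    then show False using d that not_dvd_of_small[of "int (e div 2)" "int (e' div 2)" "int k"] by auto
  qed
  moreover have "length (level_cycle k X Y Z i) = k" by (simp add: level_cycle_def)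
  ultimately show ?thesis unfolding distinct_conv_nth by (metis linorder_neqE_nat)
qed

lemma set_level_cycle:
  assumes "k > 0" "X \<in> Q" "Y \<in> Q" "Z \<in> Q"
  shows "set (level_cycle k X Y Z i) \<subseteq> Some ` (Q \<times> {0..<int k})"
  using assms by (auto simp: level_cycle_def level_vertex_def)

lemma level_cycle_offset_edge:
  assumes k: "odd k" "k \<ge> 3" and d: "\<bar>d\<bar> \<le> int ((k - 3) div 2)"
  shows "\<exists>i e. e < k \<and> {level_vertex k X u, level_vertex k Y (u + d)}
      = {level_cycle k X Y Z i ! e, level_cycle k X Y Z i ! (Suc e mod k)}"
proof -
  define r where "r = (k - 3) div 2"
  have kr: "k = 2 * r + 3" using k by (auto simp: r_def elim!: oddE)
  \<comment> \<open>The edge from position \<open>e\<close> to \<open>e + 1\<close> of the zigzag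
    has offset e - r; the index \<open>i\<close> is then chosen so that its end on level
    \<open>X\<close> is \<open>u\<close>.\<close>
  define e where "e = nat (d + int r)"
  have e: "int e = d + int r" "e \<le> 2 * r" using d by (auto simp: e_def r_def)
  then have ek: "e < k - 2" "Suc e mod k = Suc e" using kr by auto
  show ?thesis
  proof (cases "even e")
    case True
    then obtain j where j: "e = 2 * j" by (elim evenE)
    have "level_cycle k X Y Z (u + int j) ! e = level_vertex k X u"
      using ek True j by (subst level_cycle_nth) auto
    moreover have "level_cycle k X Y Z (u + int j) ! (Suc e) = level_vertex k Y (u + d)"
    proof -
      have E: "u + int j - int r + int (Suc e div 2) = u + d" using e j by simp
      have "level_cycle k X Y Z (u + int j) ! (Suc e) = level_vertex k Y (u + int j - int r + int (Suc e div 2))"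
        using ek True by (subst level_cycle_nth) (auto simp: r_def)
      then show ?thesis unfolding E .
    qed
    ultimately show ?thesis using ek by (intro exI[of _ "u + int j"] exI[of _ e]) auto
  next
    case False
    then obtain j where j: "e = 2 * j + 1" by (elim oddE)
    have "level_cycle k X Y Z (u + int j + 1) ! (Suc e) = level_vertex k X u"
      using ek False j by (subst level_cycle_nth) auto
    moreover have "level_cycle k X Y Z (u + int j + 1) ! e = level_vertex k Y (u + d)"
    proof -
      have E: "u + int j + 1 - int r + int (e div 2) = u + d" using e j by simp
      have "level_cycle k X Y Z (u + int j + 1) ! e = level_vertex k Y (u + int j + 1 - int r + int (e div 2))"
        using ek False by (subst level_cycle_nth) (auto simp: r_def)
      then show ?thesis unfolding E .
    qed
    ultimately show ?thesis using ek by (intro exI[of _ "u + int j + 1"] exI[of _ e]) auto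
  qed
qed

text \<open>The zigzag starts and ends at the same index, on levels \<open>X\<close> and
  \<open>Y\<close>, so both edges to the apex have the same offset (k - 1)/2, the one that no zigzag
  edge attains.\<close>

lemma level_cycle_apex_edges:
  assumes k: "odd k" "k \<ge> 3"
  shows "level_cycle k X Y Z i ! 0 = level_vertex k X i"
    and "level_cycle k X Y Z i ! (k - 2) = level_vertex k Y i"
    and "level_cycle k X Y Z i ! (k - 1) = level_vertex k Z (i + int ((k - 1) div 2))"
proof -
  obtain r where kr: "k = 2 * r + 3" using k by (intro that[of "(k - 3) div 2"]) (auto elim!: oddE)
  show "level_cycle k X Y Z i ! 0 = level_vertex k X i"
    "level_cycle k X Y Z i ! (k - 2) = level_vertex k Y i"
    "level_cycle k X Y Z i ! (k - 1) = level_vertex k Z (i + int ((k - 1) div 2))"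
    using kr by (auto simp: level_cycle_nth)
qed

lemma card_tournament_rel:
  assumes fin: "finite V" and sub: "A \<subseteq> V \<times> V" and irr: "\<And>u. (u, u) \<notin> A"
    and one: "\<And>u v. u \<in> V \<Longrightarrow> v \<in> V \<Longrightarrow> u \<noteq> v \<Longrightarrow> ((u, v) \<in> A) \<noteq> ((v, u) \<in> A)"
  shows "2 * card A = card V * (card V - 1)"
proof -
  let ?D = "(\<lambda>x. (x, x)) ` V"
  have finA: "finite A" using sub fin by (auto intro: finite_subset)
  have "V \<times> V = (A \<union> A\<inverse>) \<union> ?D" using sub one by (auto simp: image_iff)
  then have "card (V \<times> V) = card ((A \<union> A\<inverse>) \<union> ?D)" by (rule arg_cong)
  also have "\<dots> = card (A \<union> A\<inverse>) + card ?D" using fin finA irr by (intro card_Un_disjoint) auto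
  also have "card (A \<union> A\<inverse>) = card A + card (A\<inverse>)"
  proof (rule card_Un_disjoint)
    show "A \<inter> A\<inverse> = {}"
    proof (rule equals0I)
      fix e assume "e \<in> A \<inter> A\<inverse>"
      then obtain a b where ab: "(a, b) \<in> A" "(b, a) \<in> A" by auto
      then have "a \<in> V" "b \<in> V" "a \<noteq> b" using sub irr by auto
      then show False using ab one[of a b] by blast
    qed
  qed (use finA in auto)
  also have "card (A\<inverse>) = card A" by (rule card_inverse)
  also have "card ?D = card V" by (simp add: card_image inj_on_def)
  finally have "card V * card V = 2 * card A + card V" by (simp add: card_cartesian_product)
  then show ?thesis by (cases "card V") auto
qed

text \<open>Pairs inside a hole are covered by a copy of the system on \<open>2 * k + 1\<close>
  vertices. Between different holes, small offsets come from zigzags between the two levels; the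
  largest comes from a cycle having one of the levels as apex, which exists because the quasigroup
  equation is solvable. The number of cycles is at most p (2k + 1) + 4k p (p - 1)/2 = p (2kp +
  1).\<close>

lemma cycle_system_odd:
  assumes k: "odd k" "k \<ge> 3" and p: "p \<ge> 3"
  shows "\<exists>C. cycle_system k (holey_verts k (int p)) C"
proof -
  have "int p \<ge> 3" using p by simp
  then obtain f where f: "holey_quasigroup (int p) f" using holey_quasigroup_exists by blast
  let ?Q = "{0..<int p} \<times> {0, 1 :: int}"
  have fQ: "f X Y = f Y X" "f X Y \<in> ?Q" "f X Y \<noteq> X" "f X Y \<noteq> Y" "\<exists>W\<in>?Q. fst W \<noteq> fst X \<and> f X W = Y"
    if "X \<in> ?Q" "Y \<in> ?Q" "fst X \<noteq> fst Y" for X Y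
    using f that unfolding holey_quasigroup_def by blast+
  define V where "V = holey_verts k (int p)"
  define H where "H h = hole_verts k h" for h
  have k0: "k > 0" using k by simp
  have cV: "card V = 2 * k * p + 1"
    unfolding V_def holey_verts_def by (simp add: card_image card_cartesian_product)
  have cH: "card (H h) = 2 * k + 1" and finH: "finite (H h)" for h
    unfolding H_def hole_verts_def by (simp_all add: card_image card_cartesian_product)
  have HV: "H h \<subseteq> V" if "h \<in> {0..<int p}" for h
    using that unfolding H_def V_def hole_verts_def holey_verts_def by auto
  have finV: "finite V" unfolding V_def holey_verts_def by simp
  obtain C0 where C0: "cycle_system k {0..<int (2 * k + 1)} C0" using cycle_system_2k1[OF k(2)] by blast
  have "\<exists>C. cycle_system k (H h) C \<and> card C \<le> 2 * k + 1" for h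
  proof -
    have "card {0..<int (2 * k + 1)} = card (H h)" by (simp add: cH)
    then obtain g where g: "bij_betw g {0..<int (2 * k + 1)} (H h)"
      using finite_same_card_bij finH by blast
    have C: "cycle_system k (H h) (map g ` C0)" by (rule cycle_system_map[OF C0 g])
    then have "2 * k * card (map g ` C0) \<le> (2 * k + 1) * (2 * k)"
      unfolding cycle_system_def cH by simp
    then have "2 * k * card (map g ` C0) \<le> 2 * k * (2 * k + 1)" by (simp only: mult.commute)
    then have "card (map g ` C0) \<le> 2 * k + 1" using k0 by (subst (asm) nat_mult_le_cancel1) auto
    then show ?thesis using C by blast
  qed
  then obtain B where B: "\<And>h. cycle_system k (H h) (B h)" "\<And>h. card (B h) \<le> 2 * k + 1" by metis
  define P where "P = {(x, y). x \<in> {0..<int p} \<and> y \<in> {0..<int p} \<and> x < (y::int)}"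
  \<comment> \<open>Each unordered pair of levels in distinct holes is listed once, by increasing
    hole; commutativity of \<open>f\<close> makes the apex independent of this choice.\<close>
  define I where "I = P \<times> (({0, 1 :: int} \<times> {0, 1 :: int}) \<times> {0..<int k})"
  define cyc where "cyc = (\<lambda>((x, y), ((a, b), i)). level_cycle k (x, a) (y, b) (f (x, a) (y, b)) i)"
  define C where "C = (\<Union>h\<in>{0..<int p}. B h) \<union> cyc ` I"
  have finP: "finite P" unfolding P_def by (rule finite_subset[of _ "{0..<int p} \<times> {0..<int p}"]) auto
  have finI: "finite I" unfolding I_def using finP by simp
  have finB: "finite (B h)" for h using B(1) by (simp add: cycle_system_def)
  have finC: "finite C" unfolding C_def using finB finI by simp
  have "card C \<le> card (\<Union>h\<in>{0..<int p}. B h) + card (cyc ` I)" unfolding C_def by (rule card_Un_le)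
  also have "\<dots> \<le> p * (2 * k + 1) + card P * (4 * k)"
  proof (rule add_mono)
    have "card (\<Union>h\<in>{0..<int p}. B h) \<le> (\<Sum>h\<in>{0..<int p}. card (B h))" by (rule card_UN_le) simp
    also have "\<dots> \<le> of_nat (card {0..<int p}) * (2 * k + 1)" by (rule sum_bounded_above) (rule B(2))
    finally show "card (\<Union>h\<in>{0..<int p}. B h) \<le> p * (2 * k + 1)" by simp
    have "card (cyc ` I) \<le> card I" by (rule card_image_le[OF finI])
    also have "\<dots> = card P * (4 * k)" by (simp add: I_def card_cartesian_product)
    finally show "card (cyc ` I) \<le> card P * (4 * k)" .
  qed
  also have "card P * (4 * k) = (2 * card P) * (2 * k)" by simp
  also have "2 * card P = card {0..<int p} * (card {0..<int p} - 1)"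
    unfolding P_def by (rule card_tournament_rel) auto
  also have "\<dots> = p * (p - 1)" by simp
  also have "p * (2 * k + 1) + p * (p - 1) * (2 * k) = p * (2 * k * p + 1)"
    by (cases p) (auto simp: algebra_simps)
  finally have "card C \<le> p * (2 * k * p + 1)" .
  then have "2 * k * card C \<le> 2 * k * (p * (2 * k * p + 1))" by (rule mult_le_mono2)
  also have "\<dots> = card V * (card V - 1)" by (simp add: cV algebra_simps)
  finally have count: "2 * k * card C \<le> card V * (card V - 1)" .
  have good: "length ws = k \<and> distinct ws \<and> set ws \<subseteq> V" if wsC: "ws \<in> C" for ws
  proof -
    consider h where "h \<in> {0..<int p}" "ws \<in> B h" | z where "z \<in> I" "ws = cyc z"
      using wsC unfolding C_def by blast
    then show ?thesis
    proof cases
      case 1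
      then show ?thesis using B(1)[of h] HV[OF 1(1)] unfolding cycle_system_def by blast
    next
      case 2
      obtain x y a b i where z: "z = ((x, y), ((a, b), i))" by (metis surj_pair)
      have XY: "(x, a) \<in> ?Q" "(y, b) \<in> ?Q" "x \<noteq> y" using 2 by (auto simp: z I_def P_def)
      then have F: "f (x, a) (y, b) \<in> ?Q" "f (x, a) (y, b) \<noteq> (x, a)" "f (x, a) (y, b) \<noteq> (y, b)"
        using fQ[OF XY(1,2)] by auto
      have ws: "ws = level_cycle k (x, a) (y, b) (f (x, a) (y, b)) i" by (simp add: 2 z cyc_def)
      have "distinct ws" unfolding ws using XY F by (intro distinct_level_cycle[OF k]) auto
      moreover have "set ws \<subseteq> Some ` (?Q \<times> {0..<int k})"
        unfolding ws by (rule set_level_cycle[OF k0 XY(1,2) F(1)])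
      moreover have "length ws = k" by (simp add: ws level_cycle_def)
      ultimately show ?thesis unfolding V_def holey_verts_def by auto
    qed
  qed
  let ?cov = "\<lambda>u v. \<exists>ws\<in>C. \<exists>j<k. {u, v} = {ws ! j, ws ! (Suc j mod k)}"
  have cov_sym: "?cov u v \<Longrightarrow> ?cov v u" for u v by (simp add: insert_commute)
  have inC: "level_cycle k X Y (f X Y) i \<in> C" if "X \<in> ?Q" "Y \<in> ?Q" "fst X < fst Y" for X Y i
  proof -
    have "level_cycle k X Y (f X Y) i = level_cycle k X Y (f X Y) (i mod int k)"
      using dvd_minus_mod[of "int k" i] unfolding level_cycle_def by (auto simp: level_vertex_eq)
    also have "\<dots> = cyc ((fst X, fst Y), ((snd X, snd Y), i mod int k))" by (simp add: cyc_def)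
    also have "\<dots> \<in> cyc ` I" using that k0 by (intro imageI) (auto simp: I_def P_def)
    finally show ?thesis unfolding C_def by blast
  qed
  have near: "?cov (level_vertex k X u) (level_vertex k Y (u + d))"
    if "X \<in> ?Q" "Y \<in> ?Q" "fst X \<noteq> fst Y" "\<bar>d\<bar> \<le> int ((k - 3) div 2)" for X Y u d
  proof (cases "fst X < fst Y")
    case True
    then show ?thesis
      using level_cycle_offset_edge[OF k that(4), of X u Y "f X Y"] inC[OF that(1,2)] by metis
  next
    case False
    then have lt: "fst Y < fst X" using that by auto
    have "?cov (level_vertex k Y (u + d)) (level_vertex k X (u + d + - d))"
      using level_cycle_offset_edge[OF k, of "- d" Y "u + d" X "f Y X"] that(4) inC[OF that(2,1) lt] by (metis abs_minus_cancel)
    then show ?thesis using cov_sym by simp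
  qed
  have far: "?cov (level_vertex k X u) (level_vertex k Y (u + int ((k - 1) div 2)))"
    if XY: "X \<in> ?Q" "Y \<in> ?Q" "fst X \<noteq> fst Y" for X Y u
  proof -
    \<comment> \<open>\<open>Y\<close> is the apex over the levels \<open>X\<close> and
      \<open>W\<close>; whichever of these comes first, the edge sought is one of the two at the
      apex.\<close>
    obtain W where W: "W \<in> ?Q" "fst W \<noteq> fst X" "f X W = Y" using fQ(5)[OF XY] by blast
    have mod: "Suc (k - 1) mod k = 0" "Suc (k - 2) mod k = k - 1" "k - 1 < k" "k - 2 < k" using k by (auto simp: Suc_diff_Suc)
    show ?thesis
    proof (cases "fst X < fst W")
      case True
      note a = level_cycle_apex_edges[OF k, of X W Y u]
      have "{level_vertex k X u, level_vertex k Y (u + int ((k - 1) div 2))}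
        = {level_cycle k X W (f X W) u ! (k - 1), level_cycle k X W (f X W) u ! (Suc (k - 1) mod k)}"
        unfolding mod W(3) a by (rule insert_commute)
      then show ?thesis using inC[OF XY(1) W(1) True] mod by blast
    next
      case False
      then have lt: "fst W < fst X" using W by auto
      have fW: "f W X = Y" using fQ(1)[OF W(1) XY(1)] W by auto
      note a = level_cycle_apex_edges[OF k, of W X Y u]
      have "{level_vertex k X u, level_vertex k Y (u + int ((k - 1) div 2))}
        = {level_cycle k W X (f W X) u ! (k - 2), level_cycle k W X (f W X) u ! (Suc (k - 2) mod k)}"
        unfolding mod fW a by (rule refl)
      then show ?thesis using inC[OF W(1) XY(1) lt] mod by blast
    qed
  qed
  have in_hole: "?cov u v" if "h \<in> {0..<int p}" "u \<in> H h" "v \<in> H h" "u \<noteq> v" for h u v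
  proof -
    have "\<exists>ws\<in>B h. \<exists>j<k. {u, v} = {ws ! j, ws ! (Suc j mod k)}"
      using B(1)[of h] that unfolding cycle_system_def by blast
    then show ?thesis using that(1) unfolding C_def by blast
  qed
  have cov_None: "?cov None (Some (X, i))" if "X \<in> ?Q" "i \<in> {0..<int k}" for X i
    using that by (intro in_hole[of "fst X"]) (auto simp: H_def hole_verts_def)
  have cov_Some: "?cov (Some (X, i)) (Some (Y, j))"
    if X: "X \<in> ?Q" "i \<in> {0..<int k}" and Y: "Y \<in> ?Q" "j \<in> {0..<int k}" and ne: "(X, i) \<noteq> (Y, j)" for X Y i j
  proof (cases "fst X = fst Y")
    case True
    then show ?thesis using that by (intro in_hole[of "fst X"]) (auto simp: H_def hole_verts_def)
  next
    case False
    define r where "r = int ((k - 3) div 2)"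
    obtain r' where "k = 2 * r' + 3" using k by (intro that[of "(k - 3) div 2"]) (auto elim!: oddE)
    then have kr: "int k = 2 * r + 3" and r1: "int ((k - 1) div 2) = r + 1" by (auto simp: r_def)
    \<comment> \<open>The residue of least absolute value: since k = 2r + 3, the residues are
      represented by -(r + 1), ..., r + 1.\<close>
    define d where "d = (if \<bar>j - i\<bar> \<le> r + 1 then j - i else if j > i then j - i - int k else j - i + int k)"
    have d: "\<bar>d\<bar> \<le> r + 1" using X Y kr by (auto simp: d_def)
    have "int k dvd j - (i + d)" by (simp add: d_def)
    then have lv_Y: "level_vertex k Y j = level_vertex k Y (i + d)" by (simp add: level_vertex_eq)
    have "Some (X, i) = level_vertex k X i" "Some (Y, j) = level_vertex k Y j"
      using X Y by (auto simp: level_vertex_mod)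
    note lv = this lv_Y
    consider "\<bar>d\<bar> \<le> r" | "d = r + 1" | "d = - (r + 1)" using d by linarith
    then show ?thesis
    proof cases
      case 1
      then show ?thesis using near[OF X(1) Y(1) False, of d i] unfolding lv by (simp add: r_def)
    next
      case 2
      show ?thesis using far[OF X(1) Y(1) False, of i] unfolding lv r1 2 .
    next
      case 3
      have "?cov (level_vertex k Y (i + d)) (level_vertex k X (i + d + (r + 1)))"
        using far[OF Y(1) X(1) False[symmetric], of "i + d"] unfolding r1 .
      moreover have "i + d + (r + 1) = i" using 3 by simp
      ultimately show ?thesis unfolding lv by (simp only:) (rule cov_sym)
    qed
  qed
  have "?cov u v" if "u \<in> V" "v \<in> V" "u \<noteq> v" for u v
  proof -
    have "u = None \<or> (\<exists>X i. u = Some (X, i) \<and> X \<in> ?Q \<and> i \<in> {0..<int k})"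
      "v = None \<or> (\<exists>X i. v = Some (X, i) \<and> X \<in> ?Q \<and> i \<in> {0..<int k})"
      using that unfolding V_def holey_verts_def by auto
    then consider "u = None" "v = None" | X i where "u = None" "v = Some (X, i)" "X \<in> ?Q" "i \<in> {0..<int k}"
      | X i where "v = None" "u = Some (X, i)" "X \<in> ?Q" "i \<in> {0..<int k}"
      | X i Y j where "u = Some (X, i)" "X \<in> ?Q" "i \<in> {0..<int k}" "v = Some (Y, j)" "Y \<in> ?Q" "j \<in> {0..<int k}"
      by blast
    then show ?thesis
    proof cases
      case 1 then show ?thesis using that by simp
    next
      case 2 then show ?thesis using cov_None by simp
    next
      case 3 then show ?thesis using cov_None cov_sym by simp
    next
      case 4 then show ?thesis using cov_Some that by simp
    qed
  qed
  then have "cycle_system k V C"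
    unfolding cycle_system_def using finV finC count good by blast
  then show ?thesis unfolding V_def by blast
qed

lemma cycle_system_transfer:
  assumes C: "cycle_system k V C" and n: "card V = n"
  shows "\<exists>C. cycle_system k {..<n} C"
proof -
  have "finite V" using C by (simp add: cycle_system_def)
  then obtain g where "bij_betw g V {..<n}" using n finite_same_card_bij[of V "{..<n}"] by auto
  then show ?thesis using cycle_system_map[OF C] by blast
qed

theorem cycle_system_exists:
  assumes k: "k \<ge> 3" and p: "p \<ge> 3" and n: "n = 2 * k * p + 1"
  shows "\<exists>C. cycle_system k {..<n} C"
proof -
  have "\<exists>(V :: holey_vertex set) C. cycle_system k V C \<and> card V = n" if "odd k"
  proof -
    have "card (holey_verts k (int p)) = n"
      unfolding holey_verts_def n by (simp add: card_image card_cartesian_product)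
    then show ?thesis using cycle_system_odd[OF that k p] by blast
  qed
  moreover have "\<exists>(V :: int set) C. cycle_system k V C \<and> card V = n" if "even k"
  proof -
    have "card {0..<int n} = n" by simp
    then show ?thesis using cycle_system_even[OF k that, of p] unfolding n by blast
  qed
  ultimately show ?thesis by (metis cycle_system_transfer)
qed

section \<open>Random orientations of a cycle decomposition\<close>

definition cycle_arcs :: "'a list \<Rightarrow> 'a rel" where
  "cycle_arcs ws = (\<lambda>j. (ws ! j, ws ! (Suc j mod length ws))) ` {..<length ws}"

text \<open>\<open>J\<close> collects the cycles that keep their listed direction. The subsets of
  \<open>C\<close> form the probability space, and all probabilities below are counts of such
  \<open>J\<close>.\<close>

definition orient :: "'a list set \<Rightarrow> 'a list set \<Rightarrow> 'a rel" where
  "orient C J = (\<Union>ws\<in>C. if ws \<in> J then cycle_arcs ws else (cycle_arcs ws)\<inverse>)"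

lemma finite_cycle_arcs: "finite (cycle_arcs ws)"
  by (simp add: cycle_arcs_def)

lemma card_cycle_arcs: "distinct ws \<Longrightarrow> card (cycle_arcs ws) = length ws"
  by (auto simp: cycle_arcs_def card_image inj_on_def nth_eq_iff_index_eq)

lemma cycle_arcs_subset: "cycle_arcs ws \<subseteq> set ws \<times> set ws"
  by (auto simp: cycle_arcs_def intro!: nth_mem mod_less_divisor)

text \<open>The positions on cycles map onto the edges but are no more numerous than them, so the
  map is a bijection and the bound on the number of cycles is an equality.\<close>

lemma cycle_system_edges:
  assumes C: "cycle_system k V C"
  shows "inj_on (\<lambda>(ws, j). {ws ! j, ws ! (Suc j mod k)}) (C \<times> {..<k})"
    and "2 * k * card C = card V * (card V - 1)"
proof -
  let ?f = "\<lambda>(ws, j). {ws ! j, ws ! (Suc j mod k)}"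
  let ?A = "C \<times> {..<k}" and ?E = "{e. e \<subseteq> V \<and> card e = 2}"
  have fin: "finite V" "finite C" and le: "2 * k * card C \<le> card V * (card V - 1)"
    using C by (auto simp: cycle_system_def)
  have E: "2 * card ?E = card V * (card V - 1)"
  proof -
    have "even (card V * (card V - 1))" by auto
    then show ?thesis using fin by (simp only: n_subsets choose_two dvd_mult_div_cancel)
  qed
  have "?E \<subseteq> ?f ` ?A"
  proof
    fix e assume "e \<in> ?E"
    then obtain u v where e: "e = {u, v}" "u \<noteq> v" "u \<in> V" "v \<in> V" by (auto simp: card_2_iff)
    then obtain ws j where "ws \<in> C" "j < k" "{u, v} = {ws ! j, ws ! (Suc j mod k)}"
      using C unfolding cycle_system_def by blast
    then show "e \<in> ?f ` ?A" using e by (intro image_eqI[of _ _ "(ws, j)"]) auto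
  qed
  then have "card ?E \<le> card (?f ` ?A)" using fin by (intro card_mono) auto
  moreover have "card (?f ` ?A) \<le> card ?A" using fin by (intro card_image_le) auto
  moreover have "card ?A = k * card C" by (simp add: card_cartesian_product)
  ultimately have eq: "card (?f ` ?A) = card ?A" "2 * (k * card C) = 2 * card ?E" using E le by auto
  then show "inj_on ?f ?A" using fin by (intro eq_card_imp_inj_on) auto
  show "2 * k * card C = card V * (card V - 1)" using eq E by simp
qed

locale cycle_decomposition =
  fixes k :: nat and V :: "'a set" and C :: "'a list set"
  assumes sys: "cycle_system k V C" and k3: "k \<ge> 3"
begin

lemma finV: "finite V" and finC: "finite C"
  and cyc: "\<And>ws. ws \<in> C \<Longrightarrow> length ws = k \<and> distinct ws \<and> set ws \<subseteq> V"
  and cover: "\<And>u v. u \<in> V \<Longrightarrow> v \<in> V \<Longrightarrow> u \<noteq> v \<Longrightarrow> \<exists>ws\<in>C. \<exists>j<k. {u, v} = {ws ! j, ws ! (Suc j mod k)}"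
  using sys unfolding cycle_system_def by blast+

lemma edge_unique:
  "ws \<in> C \<Longrightarrow> ws' \<in> C \<Longrightarrow> j < k \<Longrightarrow> j' < k
    \<Longrightarrow> {ws ! j, ws ! (Suc j mod k)} = {ws' ! j', ws' ! (Suc j' mod k)} \<Longrightarrow> ws = ws' \<and> j = j'"
  using inj_onD[OF cycle_system_edges(1)[OF sys], of "(ws, j)" "(ws', j')"] by auto

lemma cycle_arcs_eq: "ws \<in> C \<Longrightarrow> cycle_arcs ws = (\<lambda>j. (ws ! j, ws ! (Suc j mod k))) ` {..<k}"
  using cyc by (simp add: cycle_arcs_def)

lemma arc_ends_neq: "ws \<in> C \<Longrightarrow> j < k \<Longrightarrow> ws ! j \<noteq> ws ! (Suc j mod k)"
  using cyc[of ws] k3 by (subst nth_eq_iff_index_eq) (auto simp: mod_Suc)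

lemma arc_cycle_unique:
  assumes "ws \<in> C" "ws' \<in> C" "(u, v) \<in> cycle_arcs ws \<union> (cycle_arcs ws)\<inverse>"
    "(u, v) \<in> cycle_arcs ws' \<union> (cycle_arcs ws')\<inverse>"
  shows "ws = ws'"
proof -
  have "\<exists>j<k. {u, v} = {ws ! j, ws ! (Suc j mod k)}"
    if "ws \<in> C" "(u, v) \<in> cycle_arcs ws \<union> (cycle_arcs ws)\<inverse>" for ws
    using that by (auto simp: cycle_arcs_eq)
  from this[OF assms(1,3)] this[OF assms(2,4)] show ?thesis
    using edge_unique[OF assms(1,2)] by metis
qed

lemma arc_not_both:
  assumes "ws \<in> C" "(u, v) \<in> cycle_arcs ws" shows "(v, u) \<notin> cycle_arcs ws"
proof
  assume "(v, u) \<in> cycle_arcs ws"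
  then obtain i j where ij: "i < k" "j < k" "u = ws ! i" "v = ws ! (Suc i mod k)" "v = ws ! j" "u = ws ! (Suc j mod k)"
    using assms by (auto simp: cycle_arcs_eq)
  then have "{ws ! i, ws ! (Suc i mod k)} = {ws ! j, ws ! (Suc j mod k)}" by auto
  then have "i = j" using edge_unique[OF assms(1,1) ij(1,2)] by blast
  then show False using ij arc_ends_neq[OF assms(1) ij(1)] by auto
qed

lemma orient_subset: "orient C J \<subseteq> V \<times> V"
proof -
  have "cycle_arcs ws \<subseteq> V \<times> V" if "ws \<in> C" for ws
    using cycle_arcs_subset[of ws] cyc[OF that] by blast
  then show ?thesis unfolding orient_def by (auto split: if_splits)
qed

lemma orient_irrefl: "(u, u) \<notin> orient C J"
proof
  assume "(u, u) \<in> orient C J"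
  then obtain ws where "ws \<in> C" "(u, u) \<in> cycle_arcs ws" unfolding orient_def by (auto split: if_splits)
  then show False using arc_not_both by blast
qed

lemma orient_one:
  assumes "u \<in> V" "v \<in> V" "u \<noteq> v"
  shows "((u, v) \<in> orient C J) \<noteq> ((v, u) \<in> orient C J)"
proof -
  obtain ws j where ws: "ws \<in> C" "j < k" "{u, v} = {ws ! j, ws ! (Suc j mod k)}" using cover[OF assms] by blast
  then have ex: "(u, v) \<in> cycle_arcs ws \<or> (v, u) \<in> cycle_arcs ws"
    by (auto simp: cycle_arcs_eq doubleton_eq_iff)
  have eq: "ws' = ws" if "ws' \<in> C" "(u, v) \<in> cycle_arcs ws' \<or> (v, u) \<in> cycle_arcs ws'" for ws'
    using arc_cycle_unique[OF that(1) ws(1), of u v] that(2) ex by auto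
  have mem: "(a, b) \<in> orient C J \<longleftrightarrow> (if ws \<in> J then (a, b) \<in> cycle_arcs ws else (b, a) \<in> cycle_arcs ws)"
    if "a = u \<and> b = v \<or> a = v \<and> b = u" for a b
  proof
    assume "(a, b) \<in> orient C J"
    then obtain ws' where w: "ws' \<in> C" "if ws' \<in> J then (a, b) \<in> cycle_arcs ws' else (b, a) \<in> cycle_arcs ws'"
      unfolding orient_def by (auto split: if_splits)
    then have "ws' = ws" using that by (intro eq) (auto split: if_splits)
    then show "if ws \<in> J then (a, b) \<in> cycle_arcs ws else (b, a) \<in> cycle_arcs ws" using w by blast
  next
    assume "if ws \<in> J then (a, b) \<in> cycle_arcs ws else (b, a) \<in> cycle_arcs ws"
    then show "(a, b) \<in> orient C J" unfolding orient_def using ws(1) by (intro UN_I[of ws]) (auto split: if_splits)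
  qed
  show ?thesis using mem[of u v] mem[of v u] ex arc_not_both[OF ws(1)] by auto
qed

lemma finite_orient: "finite (orient C J)"
  using orient_subset[of J] finV by (auto intro: finite_subset)

text \<open>Each cycle through a vertex contributes one arc in and one arc out, whatever its direction.\<close>

lemma card_orient_out: "card {w. (v, w) \<in> orient C J} = card {ws \<in> C. v \<in> set ws}"
proof -
  define Cv where "Cv = {ws \<in> C. v \<in> set ws}"
  define nx where "nx ws = ws ! (Suc (THE j. j < k \<and> ws ! j = v) mod k)" for ws
  define pv where "pv ws = (THE u. (u, v) \<in> cycle_arcs ws)" for ws
  have nx: "(v, w) \<in> cycle_arcs ws \<longleftrightarrow> w = nx ws" if wsv: "ws \<in> Cv" for ws w
  proof -
    have C: "ws \<in> C" "length ws = k" "distinct ws" using wsv cyc[of ws] by (auto simp: Cv_def)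
    obtain j where j: "j < k" "ws ! j = v" using wsv C by (auto simp: Cv_def in_set_conv_nth)
    have "(THE j. j < k \<and> ws ! j = v) = j"
      using j C by (intro the_equality) (auto simp: nth_eq_iff_index_eq)
    then have "nx ws = ws ! (Suc j mod k)" by (simp add: nx_def)
    then show ?thesis using C j by (auto simp: cycle_arcs_eq nth_eq_iff_index_eq)
  qed
  have pv: "(w, v) \<in> cycle_arcs ws \<longleftrightarrow> w = pv ws" if wsv: "ws \<in> Cv" for ws w
  proof -
    have C: "ws \<in> C" "length ws = k" "distinct ws" using wsv cyc[of ws] by (auto simp: Cv_def)
    obtain j where j: "j < k" "ws ! j = v" using wsv C by (auto simp: Cv_def in_set_conv_nth)
    define i where "i = (if j = 0 then k - 1 else j - 1)"
    have i: "i < k" "Suc i mod k = j" using j k3 by (auto simp: i_def)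
    have uniq: "i' = i" if "i' < k" "Suc i' mod k = j" for i'
      using that i j k3 by (auto simp: i_def mod_Suc split: if_splits)
    have ch: "(w, v) \<in> cycle_arcs ws \<longleftrightarrow> w = ws ! i" for w
    proof
      assume "(w, v) \<in> cycle_arcs ws"
      then obtain i' where "i' < k" "w = ws ! i'" "ws ! (Suc i' mod k) = v" using C by (auto simp: cycle_arcs_eq)
      moreover then have "Suc i' mod k = j" using C j k3 nth_eq_iff_index_eq[of ws "Suc i' mod k" j] by auto
      ultimately show "w = ws ! i" using uniq by blast
    qed (use C i j in \<open>auto simp: cycle_arcs_eq\<close>)
    then show ?thesis unfolding pv_def by (simp add: the_equality)
  qed
  have inCv: "ws \<in> Cv" if "ws \<in> C" "(v, w) \<in> cycle_arcs ws \<union> (cycle_arcs ws)\<inverse>" for ws w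
    using that cycle_arcs_subset[of ws] by (auto simp: Cv_def)
  have CvC: "ws \<in> C" if "ws \<in> Cv" for ws using that by (simp add: Cv_def)
  have out: "{w. (v, w) \<in> orient C J} = (\<lambda>ws. if ws \<in> J then nx ws else pv ws) ` Cv"
  proof (intro equalityI subsetI)
    fix w assume "w \<in> {w. (v, w) \<in> orient C J}"
    then obtain ws where ws: "ws \<in> C" "(v, w) \<in> (if ws \<in> J then cycle_arcs ws else (cycle_arcs ws)\<inverse>)"
      by (auto simp: orient_def)
    then have "ws \<in> Cv" using inCv[of ws w] by (auto split: if_splits)
    then show "w \<in> (\<lambda>ws. if ws \<in> J then nx ws else pv ws) ` Cv"
      using ws nx[of ws w] pv[of ws w] by (intro image_eqI[of _ _ ws]) (auto split: if_splits)
  next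
    fix w assume "w \<in> (\<lambda>ws. if ws \<in> J then nx ws else pv ws) ` Cv"
    then obtain ws where "ws \<in> Cv" "w = (if ws \<in> J then nx ws else pv ws)" by auto
    then show "w \<in> {w. (v, w) \<in> orient C J}"
      using nx[of ws w] pv[of ws w] CvC unfolding orient_def by (auto intro!: bexI[of _ ws])
  qed
  have uniq: "ws = ws'" if "ws \<in> Cv" "ws' \<in> Cv" "w = nx ws \<or> w = pv ws" "w = nx ws' \<or> w = pv ws'" for ws ws' w
    using that nx[of ws w] pv[of ws w] nx[of ws' w] pv[of ws' w] CvC
    by (intro arc_cycle_unique[of ws ws' v w]) auto
  have "card {w. (v, w) \<in> orient C J} = card Cv"
    unfolding out using uniq by (intro card_image inj_onI) (auto split: if_splits)
  then show ?thesis by (simp add: Cv_def)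
qed

lemma orient_Compl: "orient C (- J) = (orient C J)\<inverse>"
  by (auto simp: orient_def split: if_splits)

text \<open>The out-degree is the number of cycles through \<open>v\<close>, whatever
  \<open>J\<close> is. Passing to the complement of \<open>J\<close> reverses all arcs, so the
  in-degree has the same value.\<close>

lemma orient_out_degree:
  assumes "v \<in> V"
  shows "2 * card {w. (v, w) \<in> orient C J} = card V - 1"
proof -
  let ?out = "{w. (v, w) \<in> orient C J}" and ?in = "{w. (w, v) \<in> orient C J}"
  have sub: "?out \<subseteq> V" "?in \<subseteq> V" using orient_subset[of J] by auto
  have "?out \<union> ?in = V - {v}"
    using sub orient_irrefl[of v J] orient_one[OF assms, of _ J] by auto
  moreover have "?out \<inter> ?in = {}"
    using sub orient_one[OF assms, of _ J] orient_irrefl[of v J] by auto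
  ultimately have "card ?out + card ?in = card (V - {v})"
    using sub finV by (metis card_Un_disjoint finite_subset)
  moreover have "card ?in = card ?out"
    using card_orient_out[of v J] card_orient_out[of v "- J"] by (simp add: orient_Compl)
  ultimately show ?thesis using assms finV by simp
qed

end

text \<open>The moment bound cosh x <= exp (x^2) behind a Hoeffding inequality, with a constant that
  has an elementary proof on [-1, 1].\<close>

lemma exp_plus_exp_minus_le:
  fixes x :: real
  assumes "\<bar>x\<bar> \<le> 1"
  shows "exp x + exp (- x) \<le> 2 * exp (x\<^sup>2)"
proof -
  have *: "exp y + exp (- y) \<le> 2 * exp (y\<^sup>2)" if y: "0 \<le> y" "y \<le> 1" for y :: real
  proof -
    \<comment> \<open>From (1 + y) (1 - y + y^2) = 1 + y^3 and
      \<open>1 + y \<le> exp y\<close>.\<close>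
    have "exp (- y) \<le> 1 - y + y\<^sup>2"
    proof -
      have "1 \<le> (1 + y) * (1 - y + y\<^sup>2)" using y by (simp add: algebra_simps power2_eq_square)
      also have "\<dots> \<le> exp y * (1 - y + y\<^sup>2)"
      proof (rule mult_right_mono)
        have "0 \<le> (1 - y) + y\<^sup>2" using y by (intro add_nonneg_nonneg) auto
        then show "0 \<le> 1 - y + y\<^sup>2" by simp
      qed (rule exp_ge_add_one_self)
      finally show ?thesis by (simp add: exp_minus field_simps)
    qed
    then have "exp y + exp (- y) \<le> 2 * (1 + y\<^sup>2)" using exp_bound[OF y] by simp
    also have "\<dots> \<le> 2 * exp (y\<^sup>2)" by (intro mult_left_mono exp_ge_add_one_self) auto
    finally show ?thesis .
  qed
  show ?thesis using *[of x] *[of "- x"] assms by (cases "0 \<le> x") auto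
qed

text \<open>A Chernoff bound in counting form: the sum over \<open>J\<close> of the exponentials of
  the signed sums factors as a product over \<open>C\<close>, which is where the independence of the
  directions enters.\<close>

lemma exponential_moment_count:
  fixes \<alpha> :: "'a \<Rightarrow> real"
  assumes fin: "finite C" and \<alpha>: "\<And>c. c \<in> C \<Longrightarrow> \<bar>\<alpha> c\<bar> \<le> K" and l: "0 \<le> l" "l * K \<le> 1"
  shows "real (card {J \<in> Pow C. (\<Sum>c\<in>J. \<alpha> c) - (\<Sum>c\<in>C - J. \<alpha> c) \<ge> \<theta>})
    \<le> 2 ^ card C * exp ((l * K)\<^sup>2 * card C - l * \<theta>)"
proof -
  let ?s = "\<lambda>J. (\<Sum>c\<in>J. \<alpha> c) - (\<Sum>c\<in>C - J. \<alpha> c)"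
  let ?B = "{J \<in> Pow C. ?s J \<ge> \<theta>}"
  have "real (card ?B) * exp (l * \<theta>) \<le> (\<Sum>J\<in>?B. exp (l * ?s J))"
    using l by (intro sum_bounded_below) (auto intro: mult_left_mono)
  also have "\<dots> \<le> (\<Sum>J\<in>Pow C. exp (l * ?s J))" using fin by (intro sum_mono2) auto
  also have "\<dots> = (\<Sum>J\<in>Pow C. (\<Prod>c\<in>J. exp (l * \<alpha> c)) * (\<Prod>c\<in>C - J. exp (- (l * \<alpha> c))))"
  proof (rule sum.cong[OF refl])
    fix J assume "J \<in> Pow C"
    then have "finite J" "finite (C - J)" using fin by (auto intro: finite_subset)
    then show "exp (l * ?s J) = (\<Prod>c\<in>J. exp (l * \<alpha> c)) * (\<Prod>c\<in>C - J. exp (- (l * \<alpha> c)))"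
      by (simp add: exp_sum[symmetric] exp_add[symmetric] right_diff_distrib sum_distrib_left sum_negf)
  qed
  also have "\<dots> = (\<Prod>c\<in>C. exp (l * \<alpha> c) + exp (- (l * \<alpha> c)))"
    using fin by (rule prod_add[symmetric])
  also have "\<dots> \<le> (\<Prod>c\<in>C. 2 * exp ((l * K)\<^sup>2))"
  proof (rule prod_mono, rule conjI)
    fix c assume c: "c \<in> C"
    have lk: "\<bar>l * \<alpha> c\<bar> \<le> l * K" using \<alpha>[OF c] l by (simp add: abs_mult mult_left_mono)
    then have "exp (l * \<alpha> c) + exp (- (l * \<alpha> c)) \<le> 2 * exp ((l * \<alpha> c)\<^sup>2)"
      using l by (intro exp_plus_exp_minus_le) linarith
    also have "(l * \<alpha> c)\<^sup>2 \<le> (l * K)\<^sup>2" using power_mono[OF lk, of 2] by simp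
    finally show "exp (l * \<alpha> c) + exp (- (l * \<alpha> c)) \<le> 2 * exp ((l * K)\<^sup>2)" by simp
  qed (simp add: add_nonneg_nonneg)
  also have "\<dots> = 2 ^ card C * exp ((l * K)\<^sup>2 * card C)"
    by (simp add: power_mult_distrib exp_of_nat_mult[symmetric] mult.commute)
  finally have "real (card ?B) * exp (l * \<theta>) * exp (- (l * \<theta>))
      \<le> 2 ^ card C * exp ((l * K)\<^sup>2 * card C) * exp (- (l * \<theta>))"
    by (intro mult_right_mono) auto
  then show ?thesis by (simp add: mult.assoc flip: exp_add)
qed

context cycle_decomposition
begin

text \<open>Twice the arcs chosen equals the arcs in both directions plus the signed difference.
  Different cycles have no pair in common, so both directions together fill at most
  \<open>A \<times> B\<close>.\<close>

lemma orient_Int_le: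
  assumes A: "A \<subseteq> V" and B: "B \<subseteq> V" and J: "J \<subseteq> C"
  defines "\<alpha> \<equiv> \<lambda>ws. real (card (cycle_arcs ws \<inter> A \<times> B)) - real (card ((cycle_arcs ws)\<inverse> \<inter> A \<times> B))"
  shows "2 * real (card (orient C J \<inter> A \<times> B)) \<le> real (card A) * real (card B) + ((\<Sum>ws\<in>J. \<alpha> ws) - (\<Sum>ws\<in>C - J. \<alpha> ws))"
proof -
  let ?o = "\<lambda>ws. (if ws \<in> J then cycle_arcs ws else (cycle_arcs ws)\<inverse>) \<inter> A \<times> B"
  let ?u = "\<lambda>ws. (cycle_arcs ws \<union> (cycle_arcs ws)\<inverse>) \<inter> A \<times> B"
  let ?a = "\<lambda>ws. real (card (cycle_arcs ws \<inter> A \<times> B))" and ?b = "\<lambda>ws. real (card ((cycle_arcs ws)\<inverse> \<inter> A \<times> B))"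
  have finAB: "finite (A \<times> B)" using A B finV by (auto intro: finite_subset)
  have O: "orient C J \<inter> A \<times> B = (\<Union>ws\<in>C. ?o ws)"
    unfolding orient_def by auto
  have "card (orient C J \<inter> A \<times> B) \<le> (\<Sum>ws\<in>C. card (?o ws))"
    unfolding O by (rule card_UN_le[OF finC])
  then have "real (card (orient C J \<inter> A \<times> B)) \<le> real (\<Sum>ws\<in>C. card (?o ws))"
    by (rule of_nat_mono)
  also have "\<dots> = (\<Sum>ws\<in>C. if ws \<in> J then ?a ws else ?b ws)"
    unfolding of_nat_sum by (intro sum.cong refl) auto
  finally have 1: "2 * real (card (orient C J \<inter> A \<times> B)) \<le> (\<Sum>ws\<in>C. 2 * (if ws \<in> J then ?a ws else ?b ws))"
    by (simp only: sum_distrib_left[symmetric])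
  have "(\<Sum>ws\<in>C. card (?u ws))
      = card (\<Union>ws\<in>C. ?u ws)"
  proof (rule card_UN_disjoint[symmetric, OF finC])
    show "\<forall>ws\<in>C. finite (?u ws)"
      using finAB by auto
    show "\<forall>ws\<in>C. \<forall>ws'\<in>C. ws \<noteq> ws' \<longrightarrow>
        ?u ws \<inter> ?u ws' = {}"
      using arc_cycle_unique by blast
  qed
  also have "\<dots> \<le> card (A \<times> B)" using finAB by (intro card_mono) auto
  finally have "real (\<Sum>ws\<in>C. card (?u ws)) \<le> real (card (A \<times> B))"
    by (rule of_nat_mono)
  moreover have "real (card (?u ws)) = ?a ws + ?b ws" if "ws \<in> C" for ws
  proof -
    have "card (?u ws)
        = card (cycle_arcs ws \<inter> A \<times> B) + card ((cycle_arcs ws)\<inverse> \<inter> A \<times> B)"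
      using arc_not_both[OF that] finAB by (subst card_Un_disjoint[symmetric]) (auto simp: Int_Un_distrib2)
    then show ?thesis by simp
  qed
  ultimately have 2: "(\<Sum>ws\<in>C. ?a ws + ?b ws) \<le> real (card A) * real (card B)"
    by (simp add: card_cartesian_product)
  have CJ: "C \<inter> J = J" "C \<inter> - J = C - J" using J by auto
  have "(\<Sum>ws\<in>C. 2 * (if ws \<in> J then ?a ws else ?b ws)) = (\<Sum>ws\<in>C. (?a ws + ?b ws) + (if ws \<in> J then \<alpha> ws else - \<alpha> ws))"
    by (intro sum.cong refl) (simp add: \<alpha>_def)
  also have "\<dots> = (\<Sum>ws\<in>C. ?a ws + ?b ws) + (\<Sum>ws\<in>C. if ws \<in> J then \<alpha> ws else - \<alpha> ws)"
    by (rule sum.distrib)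
  also have "(\<Sum>ws\<in>C. if ws \<in> J then \<alpha> ws else - \<alpha> ws) = (\<Sum>ws\<in>J. \<alpha> ws) - (\<Sum>ws\<in>C - J. \<alpha> ws)"
    using finC by (simp add: sum.If_cases CJ sum_negf)
  finally show ?thesis using 1 2 by linarith
qed

lemma quasirandom_orientation:
  fixes \<delta> :: real
  assumes \<delta>: "0 < \<delta>" "\<delta> \<le> 1" and n: "real (card V) \<ge> 2 * k / \<delta>\<^sup>2"
  shows "\<exists>J\<subseteq>C. quasirandom \<delta> V (orient C J)"
proof (rule ccontr)
  let ?n = "real (card V)"
  define \<alpha> where "\<alpha> A B ws = real (card (cycle_arcs ws \<inter> A \<times> B)) - real (card ((cycle_arcs ws)\<inverse> \<inter> A \<times> B))"
    for A B :: "'a set" and ws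
  define Bad where "Bad A B = {J \<in> Pow C. (\<Sum>ws\<in>J. \<alpha> A B ws) - (\<Sum>ws\<in>C - J. \<alpha> A B ws) \<ge> 2 * \<delta> * ?n\<^sup>2}" for A B
  \<comment> \<open>This gives a moment term of at most D = \<open>\<delta>\<close>^2 n^2/(2k)
    against a gain of 4 D in the exponent. The factor 4^n of the union bound costs at most 2n <= 2
    D, so the total stays negative.\<close>
  define l where "l = \<delta> / k"
  have k0: "real k > 0" using k3 by simp
  have "2 * k / \<delta>\<^sup>2 > 0" using k0 \<delta> by simp
  then have n0: "?n > 0" using n by linarith
  assume neg: "\<not> ?thesis"
  have "Pow C \<subseteq> (\<Union>p\<in>Pow V \<times> Pow V. Bad (fst p) (snd p))"
  proof
    fix J assume J: "J \<in> Pow C"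
    then obtain A B where AB: "A \<subseteq> V" "B \<subseteq> V"
      and big: "real (card (orient C J \<inter> A \<times> B)) > real (card A) * real (card B) / 2 + \<delta> * ?n\<^sup>2"
      using neg by (auto simp: quasirandom_def not_le)
    have "J \<in> Bad A B"
      unfolding Bad_def \<alpha>_def using orient_Int_le[OF AB, of J] J big by auto
    then show "J \<in> (\<Union>p\<in>Pow V \<times> Pow V. Bad (fst p) (snd p))" using AB by (intro UN_I[of "(A, B)"]) auto
  qed
  then have "card (Pow C) \<le> card (\<Union>p\<in>Pow V \<times> Pow V. Bad (fst p) (snd p))"
    using finC finV by (intro card_mono finite_UN_I) (auto simp: Bad_def)
  also have "\<dots> \<le> (\<Sum>p\<in>Pow V \<times> Pow V. card (Bad (fst p) (snd p)))"
    using finV by (intro card_UN_le) auto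
  finally have "real (card (Pow C)) \<le> (\<Sum>p\<in>Pow V \<times> Pow V. real (card (Bad (fst p) (snd p))))"
    unfolding of_nat_sum[symmetric] by (rule of_nat_mono)
  also have "\<dots> \<le> (\<Sum>p\<in>Pow V \<times> Pow V. 2 ^ card C * exp ((l * k)\<^sup>2 * card C - l * (2 * \<delta> * ?n\<^sup>2)))"
  proof (rule sum_mono)
    fix p :: "'a set \<times> 'a set"
    have ab: "\<bar>\<alpha> A B ws\<bar> \<le> real k" if "ws \<in> C" for A B ws
    proof -
      have c: "card (cycle_arcs ws) = k" using card_cycle_arcs cyc[OF that] by metis
      have "card (cycle_arcs ws \<inter> A \<times> B) \<le> k"
        unfolding c[symmetric] by (intro card_mono finite_cycle_arcs) auto
      moreover have "card ((cycle_arcs ws)\<inverse> \<inter> A \<times> B) \<le> card ((cycle_arcs ws)\<inverse>)"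
        by (intro card_mono) (auto simp: finite_cycle_arcs)
      then have "card ((cycle_arcs ws)\<inverse> \<inter> A \<times> B) \<le> k" by (simp add: c)
      ultimately show ?thesis unfolding \<alpha>_def by linarith
    qed
    show "real (card (Bad (fst p) (snd p))) \<le> 2 ^ card C * exp ((l * k)\<^sup>2 * card C - l * (2 * \<delta> * ?n\<^sup>2))"
      unfolding Bad_def using finC ab \<delta> k0 by (intro exponential_moment_count) (auto simp: l_def)
  qed
  also have "\<dots> = 4 ^ card V * (2 ^ card C * exp ((l * k)\<^sup>2 * card C - l * (2 * \<delta> * ?n\<^sup>2)))"
    using finV by (simp add: card_cartesian_product card_Pow flip: power_mult_distrib)
  finally have "2 ^ card C * 1 \<le> (2::real) ^ card C * (4 ^ card V * exp ((l * k)\<^sup>2 * card C - l * (2 * \<delta> * ?n\<^sup>2)))"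
    using finC by (simp add: card_Pow mult_ac)
  then have "1 \<le> 4 ^ card V * exp ((l * k)\<^sup>2 * card C - l * (2 * \<delta> * ?n\<^sup>2))"
    by (subst (asm) mult_le_cancel_left_pos) auto
  also have "\<dots> \<le> exp 2 ^ card V * exp ((l * k)\<^sup>2 * card C - l * (2 * \<delta> * ?n\<^sup>2))"
  proof -
    have "(4::real) \<le> exp 2"
    proof -
      have "(2::real) * 2 \<le> exp 1 * exp 1" using exp_ge_add_one_self[of "1::real"] by (intro mult_mono) auto
      then show ?thesis by (simp flip: exp_add)
    qed
    then show ?thesis by (intro mult_right_mono power_mono) auto
  qed
  also have "\<dots> = exp (2 * ?n + ((l * k)\<^sup>2 * card C - l * (2 * \<delta> * ?n\<^sup>2)))"
    by (simp add: exp_add exp_of_nat_mult[symmetric] mult.commute)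
  finally have "0 \<le> 2 * ?n + ((l * k)\<^sup>2 * card C - l * (2 * \<delta> * ?n\<^sup>2))" by simp
  moreover have "(l * k)\<^sup>2 * card C \<le> \<delta>\<^sup>2 / (2 * k) * ?n\<^sup>2"
  proof -
    have "2 * k * card C \<le> card V * card V" using cycle_system_edges(2)[OF sys] by simp
    then have "real (2 * k * card C) \<le> real (card V * card V)" by (rule of_nat_mono)
    then have "real (card C) \<le> ?n\<^sup>2 / (2 * k)" using k0 by (simp add: field_simps power2_eq_square)
    then have "\<delta>\<^sup>2 * real (card C) \<le> \<delta>\<^sup>2 * (?n\<^sup>2 / (2 * k))" by (rule mult_left_mono) simp
    then show ?thesis using k0 by (simp add: l_def)
  qed
  moreover have "l * (2 * \<delta> * ?n\<^sup>2) = 4 * (\<delta>\<^sup>2 / (2 * k) * ?n\<^sup>2)"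
    using k0 by (simp add: l_def power2_eq_square)
  moreover have "2 * ?n \<le> 2 * (\<delta>\<^sup>2 / (2 * k) * ?n\<^sup>2)"
  proof -
    have "2 \<le> \<delta>\<^sup>2 / k * ?n" using n k0 \<delta> by (simp add: field_simps)
    then have "2 * ?n \<le> \<delta>\<^sup>2 / k * ?n * ?n" using n0 by (intro mult_right_mono) auto
    then show ?thesis by (simp add: power2_eq_square field_simps)
  qed
  moreover have "0 < \<delta>\<^sup>2 / (2 * k) * ?n\<^sup>2" using \<delta> k0 n0 by simp
  ultimately show False by linarith
qed

end

section \<open>Copies of directed cycles\<close>

lemma cycle_arcs_rev: "cycle_arcs (rev ws) = (cycle_arcs ws)\<inverse>"
proof -
  have sub: "cycle_arcs (rev ws) \<subseteq> (cycle_arcs ws)\<inverse>" for ws :: "'a list"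
  proof
    let ?k = "length ws"
    fix e assume "e \<in> cycle_arcs (rev ws)"
    then obtain j where j: "j < ?k" and e: "e = (rev ws ! j, rev ws ! (Suc j mod ?k))"
      by (auto simp: cycle_arcs_def)
    define i where "i = ?k - 1 - (Suc j mod ?k)"
    have "Suc j mod ?k < ?k" using j by (intro mod_less_divisor) auto
    then have 1: "rev ws ! (Suc j mod ?k) = ws ! i" "i < ?k" using j by (auto simp: i_def rev_nth)
    have "Suc i mod ?k = ?k - 1 - j" using j by (cases "Suc j = ?k") (auto simp: i_def mod_Suc)
    then have "rev ws ! j = ws ! (Suc i mod ?k)" using j by (simp add: rev_nth)
    then show "e \<in> (cycle_arcs ws)\<inverse>" using e 1 by (auto simp: cycle_arcs_def)
  qed
  show ?thesis using sub[of ws] sub[of "rev ws"] by auto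
qed

lemma wf_with_proj: "wf_digraph (with_proj D) \<longleftrightarrow> parcs D \<subseteq> pverts D \<times> pverts D"
  by (auto simp: wf_digraph_def)

text \<open>Replaces the isomorphism in the definition by an injective list of vertices; different
  rotations of the list give the same subgraph.\<close>

lemma mem_cycle_copies:
  assumes k: "k \<ge> 3" and D: "parcs D \<subseteq> pverts D \<times> pverts D"
  shows "X \<in> cycle_copies k D \<longleftrightarrow> (\<exists>ws. length ws = k \<and> distinct ws \<and> set ws \<subseteq> pverts D \<and>
    cycle_arcs ws \<subseteq> parcs D \<and> X = \<lparr>pverts = set ws, parcs = cycle_arcs ws\<rparr>)" (is "_ \<longleftrightarrow> ?R")
proof
  let ?C = "directed_cycle k"
  assume X: "X \<in> cycle_copies k D"
  then obtain f where f: "pre_digraph.digraph_isomorphism (with_proj ?C) f" "with_proj X = app_iso f (with_proj ?C)"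
    by (auto simp: cycle_copies_def digraph_iso_def)
  define g where "g = iso_verts f"
  have pv: "pverts X = g ` {..<k}"
    using arg_cong[OF f(2), of verts] by (simp add: verts_app_iso g_def directed_cycle_def)
  have pa: "parcs X = iso_arcs f ` parcs ?C"
    using arg_cong[OF f(2), of arcs] by (simp add: arcs_app_iso)
  \<comment> \<open>Comparing the tail and head maps of both sides forces the arc part of the
    isomorphism to be induced by its vertex part.\<close>
  have tl: "iso_tail f = fst" "iso_head f = snd"
    using arg_cong[OF f(2), of tail] arg_cong[OF f(2), of head] by (simp_all add: tail_app_iso head_app_iso)
  have inj: "inj_on g {..<k}" using f(1) by (simp add: pre_digraph.digraph_isomorphism_def g_def directed_cycle_def)
  have arc: "iso_arcs f a = (g (fst a), g (snd a))" if "a \<in> parcs ?C" for a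
    using f(1) that unfolding pre_digraph.digraph_isomorphism_def by (simp add: tl g_def prod_eq_iff)
  define ws where "ws = map g [0..<k]"
  have ws: "length ws = k" "distinct ws" "set ws = pverts X"
    using inj by (auto simp: ws_def distinct_map pv lessThan_atLeast0)
  have "parcs X = (\<lambda>a. (g (fst a), g (snd a))) ` parcs ?C" unfolding pa using arc by (rule image_cong[OF refl])
  also have "\<dots> = cycle_arcs ws"
    unfolding cycle_arcs_def ws(1) image_image directed_cycle_def pair_pre_digraph.simps
    using k by (intro image_cong refl) (auto simp: ws_def)
  finally have pX: "parcs X = cycle_arcs ws" .
  then have "X = \<lparr>pverts = set ws, parcs = cycle_arcs ws\<rparr>" using ws by (cases X) auto
  moreover have "pverts X \<subseteq> pverts D" "parcs X \<subseteq> parcs D"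
    using X by (auto simp: cycle_copies_def subgraph_def)
  ultimately show ?R
    using ws pX by (intro exI[of _ ws]) simp
next
  let ?C = "directed_cycle k"
  assume ?R
  then obtain ws where ws: "length ws = k" "distinct ws" "set ws \<subseteq> pverts D" "cycle_arcs ws \<subseteq> parcs D"
    and X: "X = \<lparr>pverts = set ws, parcs = cycle_arcs ws\<rparr>" by blast
  define f :: "(nat, nat \<times> nat, 'a, 'a \<times> 'a) digraph_isomorphism" where
    "f = \<lparr>iso_verts = (!) ws, iso_arcs = (\<lambda>a. (ws ! fst a, ws ! snd a)), iso_head = snd, iso_tail = fst\<rparr>"
  have wfC: "wf_digraph (with_proj ?C)"
    unfolding wf_with_proj using k by (auto simp: directed_cycle_def)
  have "pre_digraph.digraph_isomorphism (with_proj ?C) f"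
    unfolding pre_digraph.digraph_isomorphism_def using wfC ws k
    by (auto simp: f_def directed_cycle_def inj_on_def nth_eq_iff_index_eq)
  moreover have "with_proj X = app_iso f (with_proj ?C)"
  proof -
    have "(!) ws ` {..<k} = set ws" using ws(1) by (auto simp: set_conv_nth)
    moreover have "(\<lambda>a. (ws ! fst a, ws ! snd a)) ` parcs ?C = cycle_arcs ws"
      by (simp add: directed_cycle_def cycle_arcs_def ws(1) image_image)
    ultimately show ?thesis
      by (simp add: app_iso_def f_def X with_proj_def) (simp add: directed_cycle_def)
  qed
  ultimately have "digraph_iso (with_proj ?C) (with_proj X)" unfolding digraph_iso_def by blast
  moreover have "subgraph (with_proj X) (with_proj D)"
    unfolding subgraph_def wf_with_proj compatible_def
    using ws D cycle_arcs_subset[of ws] by (auto simp: X)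
  ultimately show "X \<in> cycle_copies k D" by (simp add: cycle_copies_def)
qed

lemma finite_cycle_copies:
  assumes k: "k \<ge> 3" and D: "parcs D \<subseteq> pverts D \<times> pverts D" and fin: "finite (pverts D)"
  shows "finite (cycle_copies k D)"
proof -
  have "cycle_copies k D \<subseteq> (\<lambda>ws. \<lparr>pverts = set ws, parcs = cycle_arcs ws\<rparr>) ` {ws. set ws \<subseteq> pverts D \<and> length ws = k}"
    using mem_cycle_copies[OF k D] by auto
  then show ?thesis using finite_lists_length_eq[OF fin] by (auto intro: finite_subset)
qed

lemma cycle_copy_arcs:
  assumes k: "k \<ge> 3" and D: "parcs D \<subseteq> pverts D \<times> pverts D" and X: "X \<in> cycle_copies k D"
  shows "parcs X \<subseteq> parcs D" "card (parcs X) = k"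
  using X mem_cycle_copies[OF k D] by (auto simp: card_cycle_arcs)

text \<open>Double counting of incidences: every copy has \<open>k\<close> arcs, and every arc
  carries total weight at most 1.\<close>

lemma fractional_packing_le:
  fixes m :: "'a pair_pre_digraph \<Rightarrow> real"
  assumes k: "k \<ge> 3" and D: "parcs D \<subseteq> pverts D \<times> pverts D" and fin: "finite (pverts D)"
    and m: "fractional_packing k D m"
  shows "real k * (\<Sum>X\<in>cycle_copies k D. m X) \<le> real (card (parcs D))"
proof -
  let ?CC = "cycle_copies k D"
  have finC: "finite ?CC" by (rule finite_cycle_copies[OF k D fin])
  have finA: "finite (parcs D)" using D fin by (auto intro: finite_subset)
  have "real k * (\<Sum>X\<in>?CC. m X) = (\<Sum>X\<in>?CC. \<Sum>e | e \<in> parcs D \<and> e \<in> parcs X. m X)"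
  proof -
    have "{e. e \<in> parcs D \<and> e \<in> parcs X} = parcs X" if "X \<in> ?CC" for X
      using cycle_copy_arcs(1)[OF k D that] by auto
    then show ?thesis using cycle_copy_arcs(2)[OF k D] by (simp add: sum_distrib_left)
  qed
  also have "\<dots> = (\<Sum>e\<in>parcs D. \<Sum>X | X \<in> ?CC \<and> e \<in> parcs X. m X)"
    by (rule sum.swap_restrict[OF finC finA])
  also have "\<dots> \<le> (\<Sum>e\<in>parcs D. 1)"
    using m by (intro sum_mono) (simp add: fractional_packing_def)
  finally show ?thesis by simp
qed

text \<open>The indicator of an integral packing is a fractional one, and a decomposition attains
  the double counting bound, so it is optimal in both senses.\<close>

lemma nu_eq_nu_frac_of_decomposition:
  assumes k: "k \<ge> 3" and D: "parcs D \<subseteq> pverts D \<times> pverts D" and fin: "finite (pverts D)"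
    and P: "P \<subseteq> cycle_copies k D" "pairwise arc_disjoint P" and full: "k * card P = card (parcs D)"
  shows "nu k D = card P" "nu_frac k D = card P"
proof -
  let ?CC = "cycle_copies k D"
  have finC: "finite ?CC" by (rule finite_cycle_copies[OF k D fin])
  have k0: "real k > 0" using k by simp
  define ind where "ind Q X = (of_bool (X \<in> Q) :: real)" for Q :: "'a pair_pre_digraph set" and X
  have frac: "fractional_packing k D (ind Q)" "(\<Sum>X\<in>?CC. ind Q X) = card Q"
    if Q: "Q \<subseteq> ?CC" "pairwise arc_disjoint Q" for Q
  proof -
    show "(\<Sum>X\<in>?CC. ind Q X) = card Q"
      using Q finC by (simp add: ind_def Int_absorb1)
    have "(\<Sum>X | X \<in> ?CC \<and> e \<in> parcs X. ind Q X) \<le> 1" for e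
    proof -
      have "(\<Sum>X | X \<in> ?CC \<and> e \<in> parcs X. ind Q X) = card {X \<in> Q. e \<in> parcs X}"
      proof -
        have "{X. X \<in> ?CC \<and> e \<in> parcs X} \<inter> Q = {X \<in> Q. e \<in> parcs X}" using Q by auto
        then show ?thesis using finC by (simp add: ind_def)
      qed
      also have "card {X \<in> Q. e \<in> parcs X} \<le> 1"
        using Q finC by (subst card_le_Suc0_iff_eq[unfolded One_nat_def[symmetric]])
          (auto simp: pairwise_def arc_disjoint_def intro: finite_subset)
      finally show ?thesis by simp
    qed
    then show "fractional_packing k D (ind Q)" by (simp add: fractional_packing_def ind_def)
  qed
  have le: "s \<le> card P" if "fractional_packing k D m" "s = (\<Sum>X\<in>?CC. m X)" for m and s :: real
  proof -
    have "k * s \<le> k * real (card P)"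
      using fractional_packing_le[OF k D fin that(1)] full unfolding that(2) by (metis of_nat_mult)
    then show ?thesis using k0 by simp
  qed
  show "nu_frac k D = card P"
    unfolding nu_frac_def
  proof (rule Greatest_equality)
    show "\<exists>m. fractional_packing k D m \<and> real (card P) = (\<Sum>X\<in>?CC. m X)"
      using frac[OF P] by (intro exI[of _ "ind P"]) simp
  next
    fix s assume "\<exists>m. fractional_packing k D m \<and> s = (\<Sum>X\<in>?CC. m X)"
    then obtain m where "fractional_packing k D m" "s = (\<Sum>X\<in>?CC. m X)" by (elim exE conjE)
    then show "s \<le> real (card P)" by (rule le)
  qed
  have fin': "finite {card Q | Q. Q \<subseteq> ?CC \<and> pairwise arc_disjoint Q}"
    by (rule finite_subset[of _ "card ` Pow ?CC"]) (blast, simp add: finC)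
  show "nu k D = card P"
    unfolding nu_def
  proof (rule Max_eqI[OF fin'])
    fix q assume "q \<in> {card Q | Q. Q \<subseteq> ?CC \<and> pairwise arc_disjoint Q}"
    then obtain Q where "Q \<subseteq> ?CC" "pairwise arc_disjoint Q" "q = card Q" by blast
    then show "q \<le> card P" using le[OF frac(1), of Q "real q"] frac(2)[of Q] by simp
  qed (use P in blast)
qed

text \<open>The successor of a vertex of least potential on the cycle would have a smaller
  one.\<close>

lemma no_cycle_copies_of_potential:
  fixes r :: "'a \<Rightarrow> int"
  assumes k: "k \<ge> 3" and D: "parcs D \<subseteq> pverts D \<times> pverts D"
    and dec: "\<And>u v. (u, v) \<in> parcs D \<Longrightarrow> r v < r u"
  shows "cycle_copies k D = {}"
proof (rule equals0I)
  fix X assume "X \<in> cycle_copies k D"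
  then obtain ws where ws: "length ws = k" "cycle_arcs ws \<subseteq> parcs D"
    using mem_cycle_copies[OF k D] by blast
  have "Min (r ` set ws) \<in> r ` set ws" using ws k by (intro Min_in) auto
  then obtain j where j: "j < k" "r (ws ! j) = Min (r ` set ws)" using ws by (auto simp: in_set_conv_nth)
  have "(ws ! j, ws ! (Suc j mod k)) \<in> parcs D" using ws j by (auto simp: cycle_arcs_def)
  then have "r (ws ! (Suc j mod k)) < Min (r ` set ws)" using dec j by metis
  moreover have "ws ! (Suc j mod k) \<in> set ws" using ws k by (auto intro!: nth_mem)
  then have "Min (r ` set ws) \<le> r (ws ! (Suc j mod k))" by simp
  ultimately show False by simp
qed

lemma finite_tau_set:
  assumes "finite (parcs D)"
  shows "finite {card F | F. F \<subseteq> parcs D \<and> cycle_copies k (D\<lparr>parcs := parcs D - F\<rparr>) = {}}"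
  by (rule finite_subset[of _ "card ` Pow (parcs D)"]) (blast, simp add: assms)

lemma tau_le:
  assumes "finite (parcs D)" "F \<subseteq> parcs D" "cycle_copies k (D\<lparr>parcs := parcs D - F\<rparr>) = {}"
  shows "tau k D \<le> card F"
  unfolding tau_def using assms(2,3) by (intro Min_le finite_tau_set[OF assms(1)]) blast

lemma tau_attained:
  assumes k: "k \<ge> 3" and fin: "finite (parcs D)"
  obtains F where "F \<subseteq> parcs D" "cycle_copies k (D\<lparr>parcs := parcs D - F\<rparr>) = {}" "tau k D = card F"
proof -
  let ?S = "{card F | F. F \<subseteq> parcs D \<and> cycle_copies k (D\<lparr>parcs := parcs D - F\<rparr>) = {}}"
  let ?E = "D\<lparr>parcs := parcs D - parcs D\<rparr>"
  have "cycle_copies k ?E = {}"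
  proof (rule equals0I)
    fix X assume X: "X \<in> cycle_copies k ?E"
    have "parcs ?E \<subseteq> pverts ?E \<times> pverts ?E" by simp
    from cycle_copy_arcs[OF k this X] show False using k by simp
  qed
  then have "?S \<noteq> {}" by blast
  then have "Min ?S \<in> ?S" using finite_tau_set[OF fin] by (intro Min_in)
  then show thesis using that unfolding tau_def by blast
qed

text \<open>Removing the ascending arcs, or the descending ones, leaves an acyclic digraph; the
  smaller of these two disjoint classes has at most half of the arcs.\<close>

lemma tau_le_half:
  fixes D :: "nat pair_pre_digraph"
  assumes k: "k \<ge> 3" and D: "parcs D \<subseteq> pverts D \<times> pverts D" and fin: "finite (pverts D)"
    and irr: "\<And>u. (u, u) \<notin> parcs D"
  shows "2 * tau k D \<le> card (parcs D)"
proof -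
  let ?I = "{(u, v) \<in> parcs D. u < v}" and ?R = "{(u, v) \<in> parcs D. v < u}"
  have finA: "finite (parcs D)" using D fin by (auto intro: finite_subset)
  have "tau k D \<le> card ?I"
    using D irr finA by (intro tau_le no_cycle_copies_of_potential[OF k, of _ int]) (auto, metis linorder_neqE_nat)
  moreover have "tau k D \<le> card ?R"
    using D irr finA by (intro tau_le no_cycle_copies_of_potential[OF k, of _ "\<lambda>u. - int u"]) (auto, metis linorder_neqE_nat)
  moreover have "card ?I + card ?R = card (?I \<union> ?R)"
    using finA by (intro card_Un_disjoint[symmetric]) (auto intro: finite_subset)
  moreover have "card (?I \<union> ?R) \<le> card (parcs D)" using finA by (intro card_mono) auto
  ultimately show ?thesis by linarith
qed

section \<open>The tournaments\<close>

definition optimal_tournament :: "nat \<Rightarrow> nat \<Rightarrow> nat pair_pre_digraph \<Rightarrow> bool" where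
  "optimal_tournament k n T \<longleftrightarrow> regular_tournament T \<and> card (pverts T) = n \<and>
     real (nu k T) = nu_frac k T \<and> nu_frac k T = real n * (real n - 1) / (2 * real k)"

lemma (in tournament) parcs_card: "2 * card (parcs G) = card (pverts G) * (card (pverts G) - 1)"
proof (rule card_tournament_rel[OF pair_finite_verts _ _ exactly_one_arc])
  show "parcs G \<subseteq> pverts G \<times> pverts G" using in_arcsD1 in_arcsD2 by auto
  show "(u, u) \<notin> parcs G" for u using pair_no_loops[of "(u, u)"] by auto
qed

text \<open>Makes the error term nonnegative, so that a lower bound on \<open>tau\<close> controls
  its absolute value.\<close>

lemma tau_tournament_le:
  assumes k: "k \<ge> 3" and T: "tournament (T :: nat pair_pre_digraph)"
  shows "4 * real (tau k T) \<le> (real (card (pverts T)))\<^sup>2"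
proof -
  interpret tournament T by (fact T)
  have "parcs T \<subseteq> pverts T \<times> pverts T" using in_arcsD1 in_arcsD2 by auto
  moreover have "(u, u) \<notin> parcs T" for u using pair_no_loops[of "(u, u)"] by auto
  ultimately have "2 * tau k T \<le> card (parcs T)"
    using pair_finite_verts by (intro tau_le_half[OF k])
  moreover have "2 * card (parcs T) \<le> card (pverts T) * card (pverts T)" using parcs_card by simp
  ultimately have "4 * tau k T \<le> card (pverts T) * card (pverts T)" by linarith
  then have "real (4 * tau k T) \<le> real (card (pverts T) * card (pverts T))" by (rule of_nat_mono)
  then show ?thesis by (simp add: power2_eq_square)
qed

lemma optimal_tournament_exists:
  fixes \<epsilon> :: real
  assumes k: "k \<ge> 3" and \<epsilon>: "0 < \<epsilon>" "\<epsilon> \<le> 1"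
  shows "\<exists>N. \<forall>n\<ge>N. [n = 1] (mod (2 * k)) \<longrightarrow>
    (\<exists>T. optimal_tournament k n T \<and> real (tau k T) \<ge> (real n)\<^sup>2 / 4 - \<epsilon> * (real n)\<^sup>2)"
proof -
  have "0 < \<epsilon> / 2" "\<epsilon> / 2 \<le> 1" using \<epsilon> by auto
  from dense_subgraph_of_quasirandom_has_cycle[OF k this, where ?'a = nat]
  obtain \<delta>0 N0 where \<delta>0: "\<delta>0 > 0" and core0: "\<forall>V T H. finite (V :: nat set) \<longrightarrow> N0 \<le> card V \<longrightarrow> H \<subseteq> T \<longrightarrow> T \<subseteq> V \<times> V \<longrightarrow>
    quasirandom \<delta>0 V T \<longrightarrow> real (card H) \<ge> (1/4 + \<epsilon> / 2) * (real (card V))\<^sup>2 \<longrightarrow>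
    (\<exists>ws. length ws = k \<and> distinct ws \<and> set ws \<subseteq> V \<and> (\<forall>j<k. (ws ! j, ws ! (Suc j mod k)) \<in> H))"
    by (elim exE conjE)
  note core = core0[rule_format]
  define \<delta> where "\<delta> = min \<delta>0 1"
  have \<delta>: "0 < \<delta>" "\<delta> \<le> 1" "\<delta> \<le> \<delta>0" using \<delta>0 by (auto simp: \<delta>_def)
  \<comment> \<open>The summands serve, in order, the cycle theorem, the random orientation, the
    bound n <= \<open>\<epsilon>\<close> n^2, and p >= 3 in n = 2kp + 1.\<close>
  define N where "N = N0 + nat \<lceil>2 * k / \<delta>\<^sup>2\<rceil> + nat \<lceil>1 / \<epsilon>\<rceil> + 6 * k + 2"
  show ?thesis
  proof (intro exI[of _ N] allI impI)
    fix n assume n: "N \<le> n" and cong: "[n = 1] (mod (2 * k))"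
    have nN: "N0 \<le> n" "real n \<ge> 2 * k / \<delta>\<^sup>2" "real n \<ge> 1 / \<epsilon>" "n \<ge> 6 * k + 2"
      using n unfolding N_def by linarith+
    have "n mod (2 * k) = 1" using cong k by (simp add: cong_def)
    then obtain p where p: "n = 2 * k * p + 1" by (metis mult_div_mod_eq)
    have p3: "p \<ge> 3"
    proof (rule ccontr)
      assume "\<not> p \<ge> 3"
      then have "2 * k * p \<le> 2 * k * 2" by (intro mult_le_mono2) simp
      then show False using nN(4) p k by linarith
    qed
    obtain C where C: "cycle_system k {..<n} C" using cycle_system_exists[OF k p3 p] by blast
    interpret cycle_decomposition k "{..<n}" C by unfold_locales (use C k in auto)
    obtain J where J: "J \<subseteq> C" and qr: "quasirandom \<delta> {..<n} (orient C J)"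
      using quasirandom_orientation[OF \<delta>(1,2)] nN(2) by auto
    define T where "T = \<lparr>pverts = {..<n}, parcs = orient C J\<rparr>"
    have Tsub: "parcs T \<subseteq> pverts T \<times> pverts T" using orient_subset[of J] by (simp add: T_def)
    have Tfin: "finite (pverts T)" "finite (parcs T)" using finite_orient[of J] by (simp_all add: T_def)
    have tour: "tournament T"
    proof unfold_locales
      show "fst e \<in> pverts T" "snd e \<in> pverts T" if "e \<in> parcs T" for e using Tsub that by auto
      show "fst e \<noteq> snd e" if "e \<in> parcs T" for e
        using that orient_irrefl[of "fst e" J] by (cases e) (auto simp: T_def)
      show "((u, v) \<in> parcs T) \<noteq> ((v, u) \<in> parcs T)" if "u \<in> pverts T" "v \<in> pverts T" "u \<noteq> v" for u v
        using that orient_one[of u v J] by (simp add: T_def)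
    qed (use Tfin in auto)
    have reg: "regular_tournament T"
      unfolding regular_tournament_def
    proof (intro conjI exI ballI tour)
      fix v assume v: "v \<in> pverts T"
      have "out_arcs (with_proj T) v = Pair v ` {w. (v, w) \<in> orient C J}"
        by (auto simp: out_arcs_def T_def)
      then have "out_degree (with_proj T) v = card {w. (v, w) \<in> orient C J}"
        by (simp add: out_degree_def card_image inj_on_def)
      then show "out_degree (with_proj T) v = (n - 1) div 2"
        using orient_out_degree[of v J] v by (simp add: T_def)
    qed
    define dir where "dir ws = (if ws \<in> J then ws else rev ws)" for ws :: "nat list"
    define cp where "cp ws = \<lparr>pverts = set ws, parcs = (if ws \<in> J then cycle_arcs ws else (cycle_arcs ws)\<inverse>)\<rparr>" for ws
    have cp_copy: "cp ws \<in> cycle_copies k T" if ws: "ws \<in> C" for ws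
      unfolding mem_cycle_copies[OF k Tsub]
    proof (intro exI[of _ "dir ws"] conjI)
      have arcs: "cycle_arcs (dir ws) = parcs (cp ws)"
        using cyc[OF ws] k by (simp add: dir_def cp_def cycle_arcs_rev)
      show "cycle_arcs (dir ws) \<subseteq> parcs T" unfolding arcs using ws by (auto simp: cp_def T_def orient_def)
      show "cp ws = \<lparr>pverts = set (dir ws), parcs = cycle_arcs (dir ws)\<rparr>" unfolding arcs by (simp add: cp_def dir_def)
    qed (use cyc[OF ws] in \<open>auto simp: dir_def T_def\<close>)
    have disj: "arc_disjoint (cp ws) (cp ws')" if "ws \<in> C" "ws' \<in> C" "ws \<noteq> ws'" for ws ws'
      unfolding arc_disjoint_def
    proof (rule equals0I)
      fix e assume "e \<in> parcs (cp ws) \<inter> parcs (cp ws')"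
      then show False using arc_cycle_unique[OF that(1,2), of "fst e" "snd e"] that(3)
        by (auto simp: cp_def split: if_splits)
    qed
    have cp_inj: "inj_on cp C"
    proof (rule inj_onI, rule ccontr)
      fix ws ws' assume a: "ws \<in> C" "ws' \<in> C" "cp ws = cp ws'" "ws \<noteq> ws'"
      then have "parcs (cp ws) = {}" using disj[of ws ws'] by (simp add: arc_disjoint_def)
      then show False using cycle_copy_arcs(2)[OF k Tsub cp_copy[OF a(1)]] k by simp
    qed
    have cardP: "card (cp ` C) = card C" by (rule card_image[OF cp_inj])
    have "2 * (k * card (cp ` C)) = 2 * card (parcs T)"
      using cycle_system_edges(2)[OF C] tournament.parcs_card[OF tour] by (simp add: cardP T_def)
    then have full: "k * card (cp ` C) = card (parcs T)" by simp
    have P: "cp ` C \<subseteq> cycle_copies k T" "pairwise arc_disjoint (cp ` C)"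
      using cp_copy disj by (auto simp: pairwise_def)
    note nu = nu_eq_nu_frac_of_decomposition[OF k Tsub Tfin(1) P full]
    have cC: "2 * real k * real (card C) = real n * (real n - 1)"
    proof -
      have "2 * k * card C = n * (n - 1)" using cycle_system_edges(2)[OF C] by simp
      then have "real (2 * k * card C) = real (n * (n - 1))" by (rule arg_cong)
      moreover have "real (n - 1) = real n - 1" using p by simp
      ultimately show ?thesis by simp
    qed
    have opt: "optimal_tournament k n T"
      unfolding optimal_tournament_def nu cardP
    proof (intro conjI reg)
      show "real (card C) = real n * (real n - 1) / (2 * real k)" using cC k by (simp add: field_simps)
    qed (simp_all add: T_def)
    obtain F where F: "F \<subseteq> parcs T" "cycle_copies k (T\<lparr>parcs := parcs T - F\<rparr>) = {}" "tau k T = card F"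
      using tau_attained[OF k Tfin(2)] .
    \<comment> \<open>Otherwise the arcs left after removing \<open>F\<close> would contain a
      \<open>k\<close>-cycle. Half of \<open>\<epsilon>\<close> is spent here; the other half
      absorbs the linear term of n (n - 1)/2.\<close>
    have small: "real (card (parcs T - F)) < (1/4 + \<epsilon> / 2) * (real n)\<^sup>2"
    proof (rule ccontr)
      assume "\<not> ?thesis"
      moreover have "quasirandom \<delta>0 {..<n} (parcs T)"
        using quasirandom_mono[OF qr \<delta>(3)] by (simp add: T_def)
      ultimately obtain ws where ws: "length ws = k" "distinct ws" "set ws \<subseteq> {..<n}"
        "\<forall>j<k. (ws ! j, ws ! (Suc j mod k)) \<in> parcs T - F"
        using core[of "{..<n}" "parcs T - F" "parcs T"] nN(1) Tsub by (auto simp: T_def)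
      let ?D = "T\<lparr>parcs := parcs T - F\<rparr>"
      have "parcs ?D \<subseteq> pverts ?D \<times> pverts ?D" using Tsub by auto
      moreover have "cycle_arcs ws \<subseteq> parcs ?D" using ws by (auto simp: cycle_arcs_def)
      ultimately have "\<lparr>pverts = set ws, parcs = cycle_arcs ws\<rparr> \<in> cycle_copies k ?D"
        using ws by (subst mem_cycle_copies[OF k]) (auto simp: T_def)
      then show False using F(2) by simp
    qed
    have "card (parcs T - F) = card (parcs T) - card F" using F(1) Tfin(2) by (simp add: card_Diff_subset finite_subset)
    moreover have "card F \<le> card (parcs T)" using F(1) Tfin(2) by (rule card_mono[rotated])
    ultimately have "real (card F) = real (card (parcs T)) - real (card (parcs T - F))" by simp
    moreover have "2 * real (card (parcs T)) = real n * (real n - 1)"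
      using cC full cardP by (metis mult.assoc of_nat_mult of_nat_numeral)
    ultimately have "2 * real (card F) \<ge> real n * (real n - 1) - 2 * ((1/4 + \<epsilon> / 2) * (real n)\<^sup>2)"
      using small by linarith
    moreover have "real n \<le> \<epsilon> * (real n)\<^sup>2"
      using nN(3) \<epsilon> mult_right_mono[of "1 / \<epsilon>" "real n" "real n * \<epsilon>"] by (simp add: power2_eq_square field_simps)
    ultimately have "real (tau k T) \<ge> (real n)\<^sup>2 / 4 - \<epsilon> * (real n)\<^sup>2"
      unfolding F(3) by (simp add: power2_eq_square algebra_simps)
    then show "\<exists>T. optimal_tournament k n T \<and> real (tau k T) \<ge> (real n)\<^sup>2 / 4 - \<epsilon> * (real n)\<^sup>2"
      using opt by blast
  qed
qed

text \<open>The construction gives, for each error, a tournament that depends on it. Taking the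
  largest \<open>tau\<close> among all tournaments with the required packing numbers yields one
  function that is at least as good for every error.\<close>

theorem theorem1p6:
  fixes k :: nat
  assumes "k \<ge> 3"
  shows "\<exists>f :: nat \<Rightarrow> real. f \<in> o(\<lambda>n. (real n)\<^sup>2) \<and>
    (\<forall>\<^sub>F n in sequentially. [n = 1] (mod (2 * k)) \<longrightarrow>
      (\<exists>T :: nat pair_pre_digraph.
         regular_tournament T \<and> card (pverts T) = n \<and>
         real (nu k T) = nu_frac k T \<and>
         nu_frac k T = real n * (real n - 1) / (2 * real k) \<and>
         real (tau k T) = (real n)\<^sup>2 / 4 - f n))"
proof -
  define S where "S n = {tau k T | T. optimal_tournament k n T}" for n
  define t where "t n = Max (S n)" for n
  \<comment> \<open>The value 0 outside the residue class, and where no suitable tournament exists,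
    keeps \<open>f\<close> small along all of the natural numbers.\<close>
  define f where "f n = (if [n = 1] (mod (2 * k)) \<and> S n \<noteq> {} then (real n)\<^sup>2 / 4 - real (t n) else 0)" for n
  have bound: "4 * real s \<le> (real n)\<^sup>2" if "s \<in> S n" for s n
    using that tau_tournament_le[OF assms] by (auto simp: S_def optimal_tournament_def regular_tournament_def)
  have fin: "finite (S n)" for n
  proof (rule finite_subset)
    show "S n \<subseteq> {..n * n}"
    proof
      fix s assume "s \<in> S n"
      then have "real s \<le> real (n * n)" using bound[of s n] by (simp add: power2_eq_square)
      then show "s \<in> {..n * n}" by (simp only: of_nat_le_iff atMost_iff)
    qed
  qed simp
  have small: "\<forall>\<^sub>F n in sequentially. norm (f n) \<le> c * norm ((real n)\<^sup>2)" if c: "c > 0" for c :: real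
  proof -
    obtain N where N: "\<And>n. n \<ge> N \<Longrightarrow> [n = 1] (mod (2 * k)) \<Longrightarrow>
        \<exists>T. optimal_tournament k n T \<and> real (tau k T) \<ge> (real n)\<^sup>2 / 4 - min c 1 * (real n)\<^sup>2"
      using optimal_tournament_exists[OF assms, of "min c 1"] c by (metis min.cobounded2 min_less_iff_conj zero_less_one)
    have "norm (f n) \<le> c * norm ((real n)\<^sup>2)" if n: "n \<ge> N" for n
    proof (cases "[n = 1] (mod (2 * k)) \<and> S n \<noteq> {}")
      case True
      obtain T where T: "optimal_tournament k n T" "real (tau k T) \<ge> (real n)\<^sup>2 / 4 - min c 1 * (real n)\<^sup>2"
        using N[OF n] True by blast
      have "tau k T \<le> t n" unfolding t_def using T fin by (intro Max_ge) (auto simp: S_def)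
      moreover have "t n \<in> S n" unfolding t_def using True fin by (intro Max_in) auto
      then have "4 * real (t n) \<le> (real n)\<^sup>2" by (rule bound)
      moreover have "min c 1 * (real n)\<^sup>2 \<le> c * (real n)\<^sup>2" by (intro mult_right_mono) auto
      ultimately have "\<bar>(real n)\<^sup>2 / 4 - real (t n)\<bar> \<le> c * (real n)\<^sup>2" using T(2) by linarith
      then show ?thesis using True by (simp add: f_def)
    qed (use c in \<open>auto simp: f_def\<close>)
    then show ?thesis by (auto simp: eventually_sequentially)
  qed
  then have "f \<in> o(\<lambda>n. (real n)\<^sup>2)" by (rule landau_o.smallI)
  moreover have "\<forall>\<^sub>F n in sequentially. [n = 1] (mod (2 * k)) \<longrightarrow>
      (\<exists>T. optimal_tournament k n T \<and> real (tau k T) = (real n)\<^sup>2 / 4 - f n)"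
  proof -
    obtain N where N: "\<And>n. n \<ge> N \<Longrightarrow> [n = 1] (mod (2 * k)) \<Longrightarrow> \<exists>T. optimal_tournament k n T"
      using optimal_tournament_exists[OF assms zero_less_one order_refl] by blast
    have "\<exists>T. optimal_tournament k n T \<and> real (tau k T) = (real n)\<^sup>2 / 4 - f n"
      if n: "n \<ge> N" "[n = 1] (mod (2 * k))" for n
    proof -
      have ne: "S n \<noteq> {}" using N[OF n] by (auto simp: S_def)
      then have "t n \<in> S n" unfolding t_def using fin by (intro Max_in) auto
      then obtain T where "optimal_tournament k n T" "tau k T = t n" by (auto simp: S_def)
      then show ?thesis using n ne by (intro exI[of _ T]) (simp add: f_def)
    qed
    then show ?thesis by (auto simp: eventually_sequentially)
  qed
  ultimately show ?thesis unfolding optimal_tournament_def by (intro exI[of _ f]) (simp add: conj_assoc)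
qed

end
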